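(* Let $F=\alpha\phi(s)$, $s=\beta/\alpha$, be a generalized Berwald $(\alpha,\beta)$-metric on an $n$-dimensional manifold $M$. Then ${\bf S}=0$ if and only if $F$ is Riemannian or $\beta$ is a Killing form with constant length (with respect to $\alpha$).
   Context: An $(\alpha,\beta)$-metric is a Finsler metric of the form $F=\alpha\phi(s)$, $s=\beta/\alpha$, where $\alpha=\sqrt{a_{ij}(x)y^iy^j}$ is a Riemannian metric, $\beta=b_i(x)y^i$ is a 1-form on $M$, and $\phi$ is a smooth function on a symmetric interval $(-b_0,b_0)$ with the regularity making $F$ a Finsler metric. $F$ is a generalized Berwald metric if there is a covariant derivative $\nabla$ on $M$ whose parallel translations preserve $F$. $\beta$ is a Killing form (with respect to $\alpha$) if $r_{ij}:=\frac12(b_{i;j}+b_{j;i})=0$, where $b_{i;j}$ is the covariant derivative of $\beta$ with respect to the Levi-Civita connection of $\alpha$. Its length is $\|\beta\|_\alpha=\sqrt{a^{ij}b_ib_j}$. For a Finsler metric $F$ on an $n$-manifold, $g_{ij}=\frac12(F^2)_{y^iy^j}$ and $G^i=\frac14g^{il}\big[\frac{\partial^2F^2}{\partial x^k\partial y^l}y^k-\frac{\partial F^2}{\partial x^l}\big]$. The S-curvature is ${\bf S}=\frac{\partial G^i}{\partial y^i}-y^i\frac{\partial}{\partial x^i}[\ln\sigma_F(x)]$, where $\sigma_F(x)=\mathrm{Vol}(\mathbb B^n(1))/\mathrm{Vol}\{(y^i)\in\mathbb R^n: F(y^i\frac{\partial}{\partial x^i}|_x)<1\}$.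
   Formalization: M is assumed connected and n at least 2; the claim fails for n = 1 (some non-reversible F on the line) and for disconnected M (for example β = 0 on one component, β Killing of nonzero constant length on another). *)

theory Defs
  imports "HOL-Analysis.Analysis"
begin

section \<open>Smooth functions\<close>

primrec Ck_on :: "nat \<Rightarrow> 'a::real_normed_vector set \<Rightarrow> ('a \<Rightarrow> 'b::real_normed_vector) \<Rightarrow> bool" where
  "Ck_on 0 S f \<longleftrightarrow> continuous_on S f"
| "Ck_on (Suc k) S f \<longleftrightarrow>
     (\<forall>x\<in>S. f differentiable (at x)) \<and> (\<forall>v. Ck_on k S (\<lambda>x. frechet_derivative f (at x) v))"

text \<open>Only meant for open \<^term>\<open>S\<close>, since derivatives are taken in the full neighbourhood filter.\<close>

definition smooth_on :: "'a::real_normed_vector set \<Rightarrow> ('a \<Rightarrow> 'b::real_normed_vector) \<Rightarrow> bool" where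
  "smooth_on S f \<longleftrightarrow> (\<forall>k. Ck_on k S f)"

definition partial :: "'n::finite \<Rightarrow> (real^'n \<Rightarrow> real) \<Rightarrow> real^'n \<Rightarrow> real" where
  "partial i f x = frechet_derivative f (at x) (axis i 1)"


section \<open>Smooth manifolds\<close>

text \<open>A chart is a pair of a domain and a coordinate map, whose values outside the domain
  are irrelevant.\<close>

type_synonym ('m, 'n) chart = "'m set \<times> ('m \<Rightarrow> real^'n)"

abbreviation dom_of :: "('m, 'n::finite) chart \<Rightarrow> 'm set" where
  "dom_of c \<equiv> fst c"

abbreviation map_of_chart :: "('m, 'n::finite) chart \<Rightarrow> 'm \<Rightarrow> real^'n" where
  "map_of_chart c \<equiv> snd c"

definition img_of :: "('m, 'n::finite) chart \<Rightarrow> (real^'n) set" where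
  "img_of c = map_of_chart c ` dom_of c"

definition overlap :: "('m, 'n::finite) chart \<Rightarrow> ('m, 'n) chart \<Rightarrow> (real^'n) set" where
  "overlap c c' = map_of_chart c ` (dom_of c \<inter> dom_of c')"

definition transition :: "('m, 'n::finite) chart \<Rightarrow> ('m, 'n) chart \<Rightarrow> real^'n \<Rightarrow> real^'n" where
  "transition c c' x = map_of_chart c' (inv_into (dom_of c) (map_of_chart c) x)"

abbreviation dtransition ::
    "('m, 'n::finite) chart \<Rightarrow> ('m, 'n) chart \<Rightarrow> real^'n \<Rightarrow> real^'n \<Rightarrow> real^'n" where
  "dtransition c c' x \<equiv> frechet_derivative (transition c c') (at x)"

definition smooth_manifold :: "'m topology \<Rightarrow> ('m, 'n::finite) chart set \<Rightarrow> bool" where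
  "smooth_manifold M A \<longleftrightarrow>
     Hausdorff_space M \<and> second_countable M \<and> connected_space M \<and>
     (\<forall>c\<in>A. openin M (dom_of c) \<and> open (img_of c) \<and>
        homeomorphic_map (subtopology M (dom_of c)) (top_of_set (img_of c)) (map_of_chart c)) \<and>
     (\<Union>c\<in>A. dom_of c) = topspace M \<and>
     (\<forall>c\<in>A. \<forall>c'\<in>A. smooth_on (overlap c c') (transition c c'))"


section \<open>Geometric objects\<close>

text \<open>
  Geometric objects on the manifold are given by their components in every chart of the atlas,
  as functions of the coordinates \<^term>\<open>x\<close> of the base point, subject to the usual
  transformation law. The tangent vector \<open>y\<^sup>i \<partial>/\<partial>x\<^sup>i\<close> at the point with coordinates \<^term>\<open>x\<close> in the
  chart \<^term>\<open>c\<close> is represented by the pair of \<^term>\<open>x\<close> and \<^term>\<open>y\<close>; a function on the tangent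
  bundle is thus a function of \<^term>\<open>c\<close>, \<^term>\<open>x\<close>, \<^term>\<open>y\<close>. Values at coordinates outside
  \<^term>\<open>img_of c\<close> are irrelevant.
\<close>

definition riemannian_metric ::
    "('m, 'n::finite) chart set \<Rightarrow> (('m, 'n) chart \<Rightarrow> real^'n \<Rightarrow> real^'n^'n) \<Rightarrow> bool" where
  "riemannian_metric A a \<longleftrightarrow>
     (\<forall>c\<in>A. smooth_on (img_of c) (a c)) \<and>
     (\<forall>c\<in>A. \<forall>x\<in>img_of c. transpose (a c x) = a c x \<and> (\<forall>y. y \<noteq> 0 \<longrightarrow> y \<bullet> (a c x *v y) > 0)) \<and>
     (\<forall>c\<in>A. \<forall>c'\<in>A. \<forall>x\<in>overlap c c'. \<forall>y z.
        y \<bullet> (a c x *v z) =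
        dtransition c c' x y \<bullet> (a c' (transition c c' x) *v dtransition c c' x z))"

definition one_form ::
    "('m, 'n::finite) chart set \<Rightarrow> (('m, 'n) chart \<Rightarrow> real^'n \<Rightarrow> real^'n) \<Rightarrow> bool" where
  "one_form A b \<longleftrightarrow>
     (\<forall>c\<in>A. smooth_on (img_of c) (b c)) \<and>
     (\<forall>c\<in>A. \<forall>c'\<in>A. \<forall>x\<in>overlap c c'. \<forall>y.
        b c x \<bullet> y = b c' (transition c c' x) \<bullet> dtransition c c' x y)"

definition riem_norm ::
    "(('m, 'n::finite) chart \<Rightarrow> real^'n \<Rightarrow> real^'n^'n) \<Rightarrow> ('m, 'n) chart \<Rightarrow> real^'n \<Rightarrow> real^'n \<Rightarrow> real" where
  "riem_norm a c x y = sqrt (y \<bullet> (a c x *v y))"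

definition form_length ::
    "(('m, 'n::finite) chart \<Rightarrow> real^'n \<Rightarrow> real^'n^'n) \<Rightarrow> (('m, 'n) chart \<Rightarrow> real^'n \<Rightarrow> real^'n) \<Rightarrow>
     ('m, 'n) chart \<Rightarrow> real^'n \<Rightarrow> real" where
  "form_length a b c x = sqrt (\<Sum>i\<in>UNIV. \<Sum>j\<in>UNIV. matrix_inv (a c x) $ i $ j * b c x $ i * b c x $ j)"

definition constant_length ::
    "('m, 'n::finite) chart set \<Rightarrow> (('m, 'n) chart \<Rightarrow> real^'n \<Rightarrow> real^'n^'n) \<Rightarrow>
     (('m, 'n) chart \<Rightarrow> real^'n \<Rightarrow> real^'n) \<Rightarrow> bool" where
  "constant_length A a b \<longleftrightarrow> (\<exists>l. \<forall>c\<in>A. \<forall>x\<in>img_of c. form_length a b c x = l)"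

definition christoffel ::
    "(('m, 'n::finite) chart \<Rightarrow> real^'n \<Rightarrow> real^'n^'n) \<Rightarrow>
     ('m, 'n) chart \<Rightarrow> real^'n \<Rightarrow> 'n \<Rightarrow> 'n \<Rightarrow> 'n \<Rightarrow> real" where
  "christoffel a c x k i j =
     1/2 * (\<Sum>l\<in>UNIV. matrix_inv (a c x) $ k $ l *
       (partial i (\<lambda>x. a c x $ j $ l) x + partial j (\<lambda>x. a c x $ i $ l) x
        - partial l (\<lambda>x. a c x $ i $ j) x))"

text \<open>\<open>b\<^bsub>i;j\<^esub>\<close>, with respect to the Levi-Civita connection\<close>

definition cov_deriv_form ::
    "(('m, 'n::finite) chart \<Rightarrow> real^'n \<Rightarrow> real^'n^'n) \<Rightarrow> (('m, 'n) chart \<Rightarrow> real^'n \<Rightarrow> real^'n) \<Rightarrow>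
     ('m, 'n) chart \<Rightarrow> real^'n \<Rightarrow> 'n \<Rightarrow> 'n \<Rightarrow> real" where
  "cov_deriv_form a b c x i j =
     partial j (\<lambda>x. b c x $ i) x - (\<Sum>k\<in>UNIV. christoffel a c x k i j * b c x $ k)"

definition killing_form ::
    "('m, 'n::finite) chart set \<Rightarrow> (('m, 'n) chart \<Rightarrow> real^'n \<Rightarrow> real^'n^'n) \<Rightarrow>
     (('m, 'n) chart \<Rightarrow> real^'n \<Rightarrow> real^'n) \<Rightarrow> bool" where
  "killing_form A a b \<longleftrightarrow>
     (\<forall>c\<in>A. \<forall>x\<in>img_of c. \<forall>i j.
        1/2 * (cov_deriv_form a b c x i j + cov_deriv_form a b c x j i) = 0)"


section \<open>Finsler metrics\<close>

definition fundamental_tensor ::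
    "(('m, 'n::finite) chart \<Rightarrow> real^'n \<Rightarrow> real^'n \<Rightarrow> real) \<Rightarrow>
     ('m, 'n) chart \<Rightarrow> real^'n \<Rightarrow> real^'n \<Rightarrow> real^'n^'n" where
  "fundamental_tensor F c x y =
     (\<chi> i j. 1/2 * partial j (\<lambda>y. partial i (\<lambda>y. (F c x y)\<^sup>2) y) y)"

definition finsler_metric ::
    "('m, 'n::finite) chart set \<Rightarrow> (('m, 'n) chart \<Rightarrow> real^'n \<Rightarrow> real^'n \<Rightarrow> real) \<Rightarrow> bool" where
  "finsler_metric A F \<longleftrightarrow>
     (\<forall>c\<in>A. smooth_on (img_of c \<times> (- {0})) (\<lambda>(x, y). F c x y)) \<and>
     (\<forall>c\<in>A. \<forall>x\<in>img_of c.
        (\<forall>y. F c x y \<ge> 0) \<and> (\<forall>y. F c x y = 0 \<longleftrightarrow> y = 0) \<and>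
        (\<forall>t>0. \<forall>y. F c x (t *\<^sub>R y) = t * F c x y) \<and>
        (\<forall>y. y \<noteq> 0 \<longrightarrow> (\<forall>v. v \<noteq> 0 \<longrightarrow> v \<bullet> (fundamental_tensor F c x y *v v) > 0))) \<and>
     (\<forall>c\<in>A. \<forall>c'\<in>A. \<forall>x\<in>overlap c c'. \<forall>y.
        F c x y = F c' (transition c c' x) (dtransition c c' x y))"

definition riemannian ::
    "('m, 'n::finite) chart set \<Rightarrow> (('m, 'n) chart \<Rightarrow> real^'n \<Rightarrow> real^'n \<Rightarrow> real) \<Rightarrow> bool" where
  "riemannian A F \<longleftrightarrow>
     (\<exists>h. riemannian_metric A h \<and> (\<forall>c\<in>A. \<forall>x\<in>img_of c. \<forall>y. F c x y = riem_norm h c x y))"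

text \<open>
  The condition \<open>\<parallel>\<beta>\<parallel>\<^sub>\<alpha> < b\<^sub>0\<close> makes \<open>s = \<beta>/\<alpha>\<close> range in the domain of \<^term>\<open>\<phi>\<close>; \<open>b\<^sub>0 = \<infinity>\<close> is allowed.
  The regularity of \<^term>\<open>\<phi>\<close> is the requirement that \<^term>\<open>F\<close> is a Finsler metric.
\<close>

definition alpha_beta_metric ::
    "('m, 'n::finite) chart set \<Rightarrow> (('m, 'n) chart \<Rightarrow> real^'n \<Rightarrow> real^'n^'n) \<Rightarrow>
     (('m, 'n) chart \<Rightarrow> real^'n \<Rightarrow> real^'n) \<Rightarrow> ereal \<Rightarrow> (real \<Rightarrow> real) \<Rightarrow>
     (('m, 'n) chart \<Rightarrow> real^'n \<Rightarrow> real^'n \<Rightarrow> real) \<Rightarrow> bool" where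
  "alpha_beta_metric A a b b\<^sub>0 \<phi> F \<longleftrightarrow>
     riemannian_metric A a \<and> one_form A b \<and>
     smooth_on {s. ereal \<bar>s\<bar> < b\<^sub>0} \<phi> \<and>
     (\<forall>c\<in>A. \<forall>x\<in>img_of c. ereal (form_length a b c x) < b\<^sub>0) \<and>
     (\<forall>c\<in>A. \<forall>x\<in>img_of c. \<forall>y.
        F c x y = riem_norm a c x y * \<phi> ((b c x \<bullet> y) / riem_norm a c x y)) \<and>
     finsler_metric A F"


section \<open>Generalized Berwald metrics\<close>

text \<open>
  A covariant derivative is given by its connection coefficients \<open>\<Gamma>\<^sup>k\<^sub>i\<^sub>j\<close>, where
  \<open>\<nabla>\<^bsub>\<partial>\<^sub>i\<^esub> \<partial>\<^sub>j = \<Gamma>\<^sup>k\<^sub>i\<^sub>j \<partial>\<^sub>k\<close>; it may have torsion. The last condition is the inhomogeneous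
  transformation law that makes \<open>\<nabla>\<close> independent of the chart.
\<close>

definition covariant_derivative ::
    "('m, 'n::finite) chart set \<Rightarrow>
     (('m, 'n) chart \<Rightarrow> real^'n \<Rightarrow> 'n \<Rightarrow> 'n \<Rightarrow> 'n \<Rightarrow> real) \<Rightarrow> bool" where
  "covariant_derivative A \<Gamma> \<longleftrightarrow>
     (\<forall>c\<in>A. \<forall>k i j. smooth_on (img_of c) (\<lambda>x. \<Gamma> c x k i j)) \<and>
     (\<forall>c\<in>A. \<forall>c'\<in>A. \<forall>x\<in>overlap c c'. \<forall>k i j.
        (\<Sum>p\<in>UNIV. \<Gamma> c x p i j * partial p (\<lambda>x. transition c c' x $ k) x) =
        partial i (\<lambda>x. partial j (\<lambda>x. transition c c' x $ k) x) x +
        (\<Sum>p\<in>UNIV. \<Sum>q\<in>UNIV. \<Gamma> c' (transition c c' x) k p q *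
           partial i (\<lambda>x. transition c c' x $ p) x * partial j (\<lambda>x. transition c c' x $ q) x))"

text \<open>Curves are parametrized by open intervals, which avoids one-sided derivatives.\<close>

definition smooth_curve ::
    "'m topology \<Rightarrow> ('m, 'n::finite) chart set \<Rightarrow> real \<Rightarrow> real \<Rightarrow> (real \<Rightarrow> 'm) \<Rightarrow> bool" where
  "smooth_curve M A t\<^sub>0 t\<^sub>1 \<gamma> \<longleftrightarrow>
     continuous_map (top_of_set {t\<^sub>0<..<t\<^sub>1}) M \<gamma> \<and>
     (\<forall>c\<in>A. smooth_on {t\<in>{t\<^sub>0<..<t\<^sub>1}. \<gamma> t \<in> dom_of c} (\<lambda>t. map_of_chart c (\<gamma> t)))"

text \<open>A vector field \<^term>\<open>V\<close> along a curve is given by its components \<^term>\<open>V t c\<close> in the charts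
  \<^term>\<open>c\<close> around \<^term>\<open>\<gamma> t\<close>.\<close>

definition parallel_along ::
    "('m, 'n::finite) chart set \<Rightarrow> (('m, 'n) chart \<Rightarrow> real^'n \<Rightarrow> 'n \<Rightarrow> 'n \<Rightarrow> 'n \<Rightarrow> real) \<Rightarrow>
     real \<Rightarrow> real \<Rightarrow> (real \<Rightarrow> 'm) \<Rightarrow> (real \<Rightarrow> ('m, 'n) chart \<Rightarrow> real^'n) \<Rightarrow> bool" where
  "parallel_along A \<Gamma> t\<^sub>0 t\<^sub>1 \<gamma> V \<longleftrightarrow>
     (\<forall>t\<in>{t\<^sub>0<..<t\<^sub>1}. \<forall>c\<in>A. \<forall>c'\<in>A. \<gamma> t \<in> dom_of c \<inter> dom_of c' \<longrightarrow>
        V t c' = dtransition c c' (map_of_chart c (\<gamma> t)) (V t c)) \<and>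
     (\<forall>t\<in>{t\<^sub>0<..<t\<^sub>1}. \<forall>c\<in>A. \<gamma> t \<in> dom_of c \<longrightarrow>
        ((\<lambda>t. V t c) has_vector_derivative
           (\<chi> k. - (\<Sum>i\<in>UNIV. \<Sum>j\<in>UNIV. \<Gamma> c (map_of_chart c (\<gamma> t)) k i j *
              vector_derivative (\<lambda>t. map_of_chart c (\<gamma> t)) (at t) $ i * V t c $ j))) (at t))"

definition parallel_translations_preserve ::
    "'m topology \<Rightarrow> ('m, 'n::finite) chart set \<Rightarrow>
     (('m, 'n) chart \<Rightarrow> real^'n \<Rightarrow> 'n \<Rightarrow> 'n \<Rightarrow> 'n \<Rightarrow> real) \<Rightarrow>
     (('m, 'n) chart \<Rightarrow> real^'n \<Rightarrow> real^'n \<Rightarrow> real) \<Rightarrow> bool" where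
  "parallel_translations_preserve M A \<Gamma> F \<longleftrightarrow>
     (\<forall>t\<^sub>0 t\<^sub>1 \<gamma> V. smooth_curve M A t\<^sub>0 t\<^sub>1 \<gamma> \<and> parallel_along A \<Gamma> t\<^sub>0 t\<^sub>1 \<gamma> V \<longrightarrow>
        (\<forall>s\<in>{t\<^sub>0<..<t\<^sub>1}. \<forall>t\<in>{t\<^sub>0<..<t\<^sub>1}. \<forall>c\<in>A. \<forall>c'\<in>A.
           \<gamma> s \<in> dom_of c \<and> \<gamma> t \<in> dom_of c' \<longrightarrow>
           F c (map_of_chart c (\<gamma> s)) (V s c) = F c' (map_of_chart c' (\<gamma> t)) (V t c')))"

definition generalized_berwald ::
    "'m topology \<Rightarrow> ('m, 'n::finite) chart set \<Rightarrow>
     (('m, 'n) chart \<Rightarrow> real^'n \<Rightarrow> real^'n \<Rightarrow> real) \<Rightarrow> bool" where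
  "generalized_berwald M A F \<longleftrightarrow>
     finsler_metric A F \<and>
     (\<exists>\<Gamma>. covariant_derivative A \<Gamma> \<and> parallel_translations_preserve M A \<Gamma> F)"


section \<open>S-curvature\<close>

definition spray_coeff ::
    "(('m, 'n::finite) chart \<Rightarrow> real^'n \<Rightarrow> real^'n \<Rightarrow> real) \<Rightarrow>
     ('m, 'n) chart \<Rightarrow> real^'n \<Rightarrow> real^'n \<Rightarrow> 'n \<Rightarrow> real" where
  "spray_coeff F c x y i =
     1/4 * (\<Sum>l\<in>UNIV. matrix_inv (fundamental_tensor F c x y) $ i $ l *
       ((\<Sum>k\<in>UNIV. partial k (\<lambda>x. partial l (\<lambda>y. (F c x y)\<^sup>2) y) x * y $ k)
        - partial l (\<lambda>x. (F c x y)\<^sup>2) x))"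

definition volume_density ::
    "(('m, 'n::finite) chart \<Rightarrow> real^'n \<Rightarrow> real^'n \<Rightarrow> real) \<Rightarrow> ('m, 'n) chart \<Rightarrow> real^'n \<Rightarrow> real" where
  "volume_density F c x = measure lborel (ball (0::real^'n) 1) / measure lborel {y. F c x y < 1}"

definition S_curvature ::
    "(('m, 'n::finite) chart \<Rightarrow> real^'n \<Rightarrow> real^'n \<Rightarrow> real) \<Rightarrow>
     ('m, 'n) chart \<Rightarrow> real^'n \<Rightarrow> real^'n \<Rightarrow> real" where
  "S_curvature F c x y =
     (\<Sum>i\<in>UNIV. partial i (\<lambda>y. spray_coeff F c x y i) y)
     - (\<Sum>i\<in>UNIV. y $ i * partial i (\<lambda>x. ln (volume_density F c x)) x)"

text \<open>The S-curvature lives on the slit tangent bundle, so \<open>y = 0\<close> is excluded.\<close>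

definition S_curvature_vanishes ::
    "('m, 'n::finite) chart set \<Rightarrow> (('m, 'n) chart \<Rightarrow> real^'n \<Rightarrow> real^'n \<Rightarrow> real) \<Rightarrow> bool" where
  "S_curvature_vanishes A F \<longleftrightarrow>
     (\<forall>c\<in>A. \<forall>x\<in>img_of c. \<forall>y. y \<noteq> 0 \<longrightarrow> S_curvature F c x y = 0)"

end

theory Submission
  imports Defs
begin

text \<open>
  Let the parallel translations of a connection \<open>\<nabla>\<close> with torsion \<open>T\<close> preserve \<open>F\<close>.

  Parallel translation along the lines of a chart identifies the tangent spaces by linear isometries
  of \<open>F\<close> (\<open>parallel_flow\<close>). Differentiating this invariance expresses the derivatives of \<open>F\<close> along the
  base by those along the fibre, so that the spray becomes the geodesic spray of \<open>\<nabla>\<close> plus a term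
  linear in the torsion, and the logarithmic derivative of the volume density becomes a trace of the
  connection coefficients. In the S-curvature all terms cancel except one (\<open>S_curvature_eq\<close>):
  \<open>- 1/2\<close> times the logarithmic derivative of \<open>det g\<close>, along the fibre, in the direction of the torsion
  term, where \<open>g\<close> is the fundamental tensor. In particular the S-curvature vanishes if \<open>F\<close> is
  Riemannian.

  For \<open>F = \<alpha> \<phi>(s)\<close> with \<open>s = \<beta>/\<alpha>\<close>, the infinitesimal invariance at a point \<open>x\<close> says that a combination
  of \<open>\<nabla>\<alpha>\<close> and \<open>\<nabla>\<beta>\<close>, with functions of \<open>s\<close> as coefficients, vanishes. By the symmetry of the norm
  under rotations about the dual vector \<open>b\<close> of \<open>\<beta>\<close> it splits into linear relations between two such
  functions, which force \<open>\<phi>\<^sup>2\<close> to be a quadratic polynomial without linear term on the range of \<open>s\<close>,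
  that is, \<open>F\<close> to be Euclidean at \<open>x\<close>, unless \<open>\<nabla>\<alpha> = 0\<close> and \<open>\<nabla>\<beta> = 0\<close> there (\<open>connection_metrical\<close>). Whether
  \<open>F\<close> is Euclidean at \<open>x\<close> depends only on the length of \<open>\<beta>\<close> at \<open>x\<close>. If it is not, the length is
  constant near \<open>x\<close> because \<open>\<nabla>\<close> preserves \<open>\<alpha>\<close> and \<open>\<beta>\<close>, and hence constant on the connected manifold
  (\<open>form_length_constant\<close>). So either \<open>F\<close> is Euclidean at all points, hence Riemannian
  (\<open>riemannian_if_quadratic\<close>), or \<open>\<beta>\<close> has constant length and \<open>\<nabla>\<close> preserves \<open>\<alpha>\<close> and \<open>\<beta>\<close> everywhere.

  In the second case \<open>det g\<close> is \<open>det \<alpha>\<close> times a function \<open>H\<close> of \<open>s\<close> (\<open>det_hess\<close>), and the S-curvature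
  is \<open>H'(s)\<close> times a combination of \<open>P(y, y)\<close> and \<open>P(y, b)\<close>, up to a nonzero factor, where
  \<open>P(y, z) = \<alpha>(T(y, b), z)\<close> (\<open>S_curvature_zero_iff\<close> and \<open>w_deviation\<close>). Since \<open>\<nabla>\<close> preserves \<open>\<alpha>\<close>
  and \<open>\<beta>\<close>, the form \<open>P\<close> is skew if and only if the Lie derivative of \<open>\<alpha>\<close> along \<open>b\<close> vanishes, which is
  Killing's equation (\<open>killing_at_iff\<close>). If \<open>P\<close> is skew, both terms vanish and so does the S-curvature.
  Conversely, a vanishing S-curvature makes \<open>P\<close> skew as soon as \<open>H'\<close> is not identically zero; and
  if it were, \<open>det g\<close> would be constant, which forces \<open>F\<close> to be Euclidean, by an elementary
  version of Deicke's theorem (\<open>quadratic_if_H_constant\<close>).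
\<close>

section \<open>Linear algebra\<close>

lemma has_derivative_vec_lambda:
  fixes f :: "'n::finite \<Rightarrow> 'a::real_normed_vector \<Rightarrow> 'b::real_normed_vector"
  assumes "\<And>i. (f i has_derivative f' i) (at x)"
  shows "((\<lambda>x. \<chi> i. f i x) has_derivative (\<lambda>h. \<chi> i. f' i h)) (at x)"
proof -
  have bl: "bounded_linear (f' i)" for i
    using assms has_derivative_bounded_linear by blast
  have lin: "bounded_linear (\<lambda>h. \<chi> i. f' i h)"
  proof (rule bounded_linear_intro[where K="\<Sum>i\<in>UNIV. onorm (f' i)"])
    show "norm (\<chi> i. f' i h) \<le> norm h * (\<Sum>i\<in>UNIV. onorm (f' i))" for h
    proof -
      have "norm (\<chi> i. f' i h) \<le> (\<Sum>i\<in>UNIV. norm (f' i h))"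
        by (simp add: norm_vec_def L2_set_le_sum)
      also have "\<dots> \<le> (\<Sum>i\<in>UNIV. onorm (f' i) * norm h)"
        by (intro sum_mono onorm bl)
      finally show ?thesis by (simp add: sum_distrib_left mult.commute)
    qed
  qed (simp_all add: vec_eq_iff linear_simps[OF bl])
  show ?thesis
    unfolding has_derivative_at_within
  proof (intro conjI lin vec_tendstoI)
    fix i
    have "((\<lambda>y. ((f i y - f i x) - f' i (y - x)) /\<^sub>R norm (y - x)) \<longlongrightarrow> 0) (at x)"
      using assms[of i] unfolding has_derivative_at_within by blast
    then show "((\<lambda>y. (((\<chi> i. f i y) - (\<chi> i. f i x) - (\<chi> i. f' i (y - x))) /\<^sub>R norm (y - x)) $ i) \<longlongrightarrow> 0 $ i) (at x)"
      by simp
  qed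
qed

lemma bounded_bilinear_matrix_vector_mult:
  "bounded_bilinear ((*v) :: real^'n^'m \<Rightarrow> real^'n \<Rightarrow> real^'m)"
proof -
  have "bilinear ((*v) :: real^'n^'m \<Rightarrow> real^'n \<Rightarrow> real^'m)"
    unfolding bilinear_def
    by (auto intro!: linearI simp: matrix_vector_mult_add_rdistrib vec.add scaleR_matrix_vector_assoc
        matrix_vector_mult_scaleR)
  then show ?thesis by (simp add: bilinear_conv_bounded_bilinear)
qed

lemma bounded_linear_entry: "bounded_linear (\<lambda>A::real^'n^'m. A $ i $ j)"
  using bounded_linear_compose[OF bounded_linear_vec_nth bounded_linear_vec_nth] by blast

lemma matrix_inv_mult:
  fixes A :: "real^'n^'n"
  assumes "invertible A"
  shows "A ** matrix_inv A = mat 1" "matrix_inv A ** A = mat 1"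
  using assms unfolding invertible_def matrix_inv_def by (metis (mono_tags, lifting) someI_ex)+

lemma matrix_inv_mult_vec:
  fixes A :: "real^'n^'n"
  assumes "invertible A"
  shows "A *v (matrix_inv A *v b) = b" "matrix_inv A *v (A *v b) = b"
  by (simp_all add: matrix_vector_mul_assoc matrix_inv_mult[OF assms])

lemma positive_definite_invertible:
  fixes A :: "real^'n^'n"
  assumes "\<And>v. v \<noteq> 0 \<Longrightarrow> v \<bullet> (A *v v) > 0"
  shows "invertible A"
proof -
  have "\<forall>x. A *v x = 0 \<longrightarrow> x = 0"
    using assms by (metis inner_zero_right less_irrefl)
  then obtain B where "B ** A = mat 1" using matrix_left_invertible_ker[of A] by blast
  then show ?thesis using invertible_left_inverse by blast
qed

lemma inner_matrix_symmetric:
  fixes A :: "real^'n^'n"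
  assumes "transpose A = A"
  shows "y \<bullet> (A *v z) = z \<bullet> (A *v y)"
  using assms by (metis dot_lmul_matrix inner_commute vector_transpose_matrix)

lemma det_differentiable:
  fixes A :: "'a::real_normed_vector \<Rightarrow> real^'n^'n"
  assumes "\<And>i j. (\<lambda>x. A x $ i $ j) differentiable (at x)"
  shows "(\<lambda>x. det (A x)) differentiable (at x)"
proof -
  obtain A' where A': "\<And>i j. ((\<lambda>x. A x $ i $ j) has_derivative A' i j) (at x)"
    using assms unfolding differentiable_def by metis
  have "(\<lambda>x. \<Prod>i\<in>UNIV. A x $ i $ p i) differentiable (at x)" for p
    using has_derivative_prod[where I=UNIV and f="\<lambda>i x. A x $ i $ p i", OF A'] differentiableI by blast
  then show ?thesis unfolding det_def by (intro differentiable_sum differentiable_mult) auto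
qed

text \<open>By Cramer's rule, the solution of a linear system depends differentiably on the system; the
  value of the derivative then follows by differentiating the system.\<close>

lemma has_derivative_matrix_inv_vec:
  fixes A :: "'a::real_normed_vector \<Rightarrow> real^'n^'n" and b :: "'a \<Rightarrow> real^'n"
  assumes U: "open U" "x \<in> U" and inv: "\<And>y. y \<in> U \<Longrightarrow> invertible (A y)"
    and A: "(A has_derivative A') (at x)" and b: "(b has_derivative b') (at x)"
  shows "((\<lambda>y. matrix_inv (A y) *v b y) has_derivative
          (\<lambda>h. matrix_inv (A x) *v (b' h - A' h *v (matrix_inv (A x) *v b x)))) (at x)"
proof -
  let ?X = "\<lambda>y. matrix_inv (A y) *v b y"
  let ?C = "\<lambda>y. \<chi> k. det (\<chi> i j. if j = k then b y $ i else A y $ i $ j) / det (A y)"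
  have dA: "(\<lambda>y. A y $ i $ j) differentiable (at x)" for i j
    by (rule differentiableI, rule bounded_linear.has_derivative[OF bounded_linear_entry A])
  have db: "(\<lambda>y. b y $ i) differentiable (at x)" for i
    by (rule differentiableI, rule bounded_linear.has_derivative[OF bounded_linear_vec_nth b])
  have dC: "(\<lambda>y. det (\<chi> i j. if j = k then b y $ i else A y $ i $ j) / det (A y)) differentiable (at x)" for k
  proof (intro differentiable_divide det_differentiable)
    show "(\<lambda>xa. (\<chi> i j. if j = k then b xa $ i else A xa $ i $ j) $ i $ j) differentiable (at x)" for i j
      using dA[of i j] db[of i] by (cases "j = k") simp_all
    show "det (A x) \<noteq> 0" using inv[OF U(2)] by (simp add: invertible_det_nz)
  qed (rule dA)
  define D where "D = (\<lambda>k. frechet_derivative (\<lambda>y. det (\<chi> i j. if j = k then b y $ i else A y $ i $ j) / det (A y)) (at x))"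
  have C: "(?C has_derivative (\<lambda>h. \<chi> k. D k h)) (at x)"
    unfolding D_def by (rule has_derivative_vec_lambda, rule frechet_derivative_works[THEN iffD1], rule dC)
  have eq: "?C y = ?X y" if "y \<in> U" for y
    using cramer[of "A y" "?X y" "b y"] inv[OF that]
    by (simp add: invertible_det_nz matrix_inv_mult_vec)
  have X: "(?X has_derivative (\<lambda>h. \<chi> k. D k h)) (at x)"
    by (rule has_derivative_transform_within_open[OF C U]) (rule eq)
  have "((\<lambda>y. A y *v ?X y) has_derivative (\<lambda>h. A x *v (\<chi> k. D k h) + A' h *v ?X x)) (at x)"
    using bounded_bilinear.FDERIV[OF bounded_bilinear_matrix_vector_mult A X] by simp
  moreover have "((\<lambda>y. A y *v ?X y) has_derivative b') (at x)"
    by (rule has_derivative_transform_within_open[OF b U]) (simp add: inv matrix_inv_mult_vec)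
  ultimately have eq': "(\<lambda>h. A x *v (\<chi> k. D k h) + A' h *v ?X x) = b'"
    by (rule has_derivative_unique)
  have "(\<chi> k. D k h) = matrix_inv (A x) *v (b' h - A' h *v ?X x)" for h
  proof -
    have "b' h - A' h *v ?X x = A x *v (\<chi> k. D k h)"
      using fun_cong[OF eq', of h] by (simp add: algebra_simps)
    then show ?thesis by (simp only: matrix_inv_mult_vec(2)[OF inv[OF U(2)]])
  qed
  with X show ?thesis by simp
qed

text \<open>In the Leibniz formula only the identity permutation contributes to first order, since any other
  permutation picks at least two entries off the diagonal.\<close>

lemma DERIV_det_at_mat_1:
  fixes A :: "real \<Rightarrow> real^'n^'n"
  assumes "A t = mat 1" and D: "\<And>i j. ((\<lambda>t. A t $ i $ j) has_real_derivative N $ i $ j) (at t)"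
  shows "((\<lambda>t. det (A t)) has_real_derivative trace N) (at t)"
proof -
  let ?P = "{p. p permutes (UNIV :: 'n set)}"
  let ?Q = "\<lambda>i p. \<Prod>j\<in>UNIV - {i}. A t $ j $ p j"
  have fin: "finite ?P" by (rule finite_permutations) simp
  have *: "((\<lambda>t. \<Prod>i\<in>UNIV. A t $ i $ p i) has_derivative
       (\<lambda>h. \<Sum>i\<in>UNIV. N $ i $ p i * h * ?Q i p)) (at t)" for p
    by (rule has_derivative_prod) (use D in \<open>simp add: has_field_derivative_def\<close>)
  have "((\<lambda>t. det (A t)) has_derivative
       (\<lambda>h. \<Sum>p\<in>?P. of_int (sign p) * (\<Sum>i\<in>UNIV. N $ i $ p i * h * ?Q i p))) (at t)"
    unfolding det_def by (intro has_derivative_sum has_derivative_mult_right *)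
  also have "(\<lambda>h. \<Sum>p\<in>?P. of_int (sign p) * (\<Sum>i\<in>UNIV. N $ i $ p i * h * ?Q i p)) = (*) (trace N)"
  proof
    fix h
    \<comment> \<open>a permutation that fixes all points but one is the identity\<close>
    have 0: "?Q i p = 0" if p: "p permutes UNIV" "p \<noteq> id" for p and i :: 'n
    proof -
      have "\<exists>j. j \<noteq> i \<and> p j \<noteq> j"
      proof (rule ccontr)
        assume "\<not> ?thesis"
        then have fx: "\<And>j. j \<noteq> i \<Longrightarrow> p j = j" by blast
        then have "p i = i" using permutes_inj[OF p(1)] by (metis injD)
        with fx have "p = id" by (metis eq_id_iff)
        with p(2) show False by blast
      qed
      then obtain j where "j \<noteq> i" "p j \<noteq> j" by blast
      then show ?thesis by (intro prod_zero) (auto intro!: bexI[of _ j] simp: assms(1) mat_def)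
    qed
    have "(\<Sum>p\<in>?P. of_int (sign p) * (\<Sum>i\<in>UNIV. N $ i $ p i * h * ?Q i p))
        = (\<Sum>p\<in>{id}. of_int (sign p) * (\<Sum>i\<in>UNIV. N $ i $ p i * h * ?Q i p))"
      by (rule sum.mono_neutral_right[OF fin]) (auto simp: 0 permutes_id)
    also have "\<dots> = trace N * h"
      by (simp add: sign_id assms(1) mat_def trace_def sum_distrib_right)
    finally show "(\<Sum>p\<in>?P. of_int (sign p) * (\<Sum>i\<in>UNIV. N $ i $ p i * h * ?Q i p)) = trace N * h" .
  qed
  finally show ?thesis by (simp add: has_field_derivative_def)
qed

lemma DERIV_det:
  fixes A :: "real \<Rightarrow> real^'n^'n"
  assumes inv: "invertible (A t)" and D: "\<And>i j. ((\<lambda>t. A t $ i $ j) has_real_derivative N $ i $ j) (at t)"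
  shows "((\<lambda>t. det (A t)) has_real_derivative det (A t) * trace (matrix_inv (A t) ** N)) (at t)"
proof -
  let ?B = "matrix_inv (A t)"
  have "((\<lambda>s. det (?B ** A s)) has_real_derivative trace (?B ** N)) (at t)"
  proof (rule DERIV_det_at_mat_1)
    show "?B ** A t = mat 1" by (rule matrix_inv_mult[OF inv])
    show "((\<lambda>s. (?B ** A s) $ i $ j) has_real_derivative (?B ** N) $ i $ j) (at t)" for i j
      unfolding matrix_matrix_mult_def by (auto intro!: DERIV_sum DERIV_cmult D)
  qed
  from DERIV_cmult[OF this, of "det (A t)"]
  have "((\<lambda>s. det (A t ** (?B ** A s))) has_real_derivative det (A t) * trace (?B ** N)) (at t)"
    by (simp add: det_mul mult.assoc)
  then show ?thesis by (simp add: matrix_mul_assoc matrix_inv_mult[OF inv])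
qed

definition outer :: "real^'n \<Rightarrow> real^'m \<Rightarrow> real^'m^'n" where
  "outer u v = (\<chi> i j. u $ i * v $ j)"

lemma outer_nth [simp]: "outer u v $ i $ j = u $ i * v $ j"
  by (simp add: outer_def)

lemma outer_mult_vec: "outer u v *v z = (v \<bullet> z) *\<^sub>R u"
  by (simp add: vec_eq_iff matrix_vector_mult_def inner_vec_def sum_distrib_left sum_distrib_right mult_ac)

lemma matrix_mult_outer: "A ** outer u v = outer (A *v u) v"
  by (simp add: vec_eq_iff matrix_matrix_mult_def matrix_vector_mult_def sum_distrib_right mult.assoc)

lemma outer_mult_matrix: "outer u v ** A = outer u (transpose A *v v)"
  by (auto simp: vec_eq_iff matrix_matrix_mult_def matrix_vector_mult_def sum_distrib_left
      transpose_def intro!: sum.cong)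

lemma matrix_mult_add_right: "(A + B) ** C = A ** C + B ** C" for A B :: "real^'n^'m"
  by (simp add: vec_eq_iff matrix_matrix_mult_def distrib_right sum.distrib)

lemma outer_mult_outer: "outer u v ** outer u' v' = (v \<bullet> u') *\<^sub>R outer u v'"
  by (simp add: matrix_mult_outer outer_mult_vec) (simp add: vec_eq_iff mult.assoc)

lemma bounded_bilinear_outer: "bounded_bilinear (outer :: real^'n \<Rightarrow> real^'m \<Rightarrow> _)"
proof -
  have "bilinear (outer :: real^'n \<Rightarrow> real^'m \<Rightarrow> _)"
    unfolding bilinear_def by (auto intro!: linearI simp: vec_eq_iff algebra_simps)
  then show ?thesis by (simp add: bilinear_conv_bounded_bilinear)
qed

text \<open>An orthogonal change of basis makes the rank one term live in a single row.\<close>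

lemma det_mat_1_plus_outer: "det (mat 1 + outer u v) = 1 + u \<bullet> v" for u v :: "real^'n"
proof (cases "u = 0")
  case True
  have "outer 0 v = (0 :: real^'n^'n)" by (simp add: vec_eq_iff)
  then show ?thesis using True by simp
next
  case False
  define k :: 'n where "k = undefined"
  obtain Q where Q: "orthogonal_matrix Q" "Q *v axis k 1 = u /\<^sub>R norm u"
    using orthogonal_matrix_exists_basis[of "u /\<^sub>R norm u" k] False by auto
  let ?T = "transpose Q"
  have TQ: "?T ** Q = mat 1" "Q ** ?T = mat 1" using Q(1) by (simp_all add: orthogonal_matrix_def)
  have Tu: "?T *v u = norm u *\<^sub>R axis k 1"
  proof -
    have "u = norm u *\<^sub>R (Q *v axis k 1)" using Q(2) False by simp
    then have "?T *v u = norm u *\<^sub>R (?T *v (Q *v axis k 1))"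
      using matrix_vector_mult_scaleR[of ?T "norm u" "Q *v axis k 1"] by simp
    then show ?thesis by (simp add: matrix_vector_mul_assoc TQ)
  qed
  define x where "x = axis k 1 + norm u *\<^sub>R (?T *v v)"
  have row: "row i (mat 1) = axis i (1::real)" for i :: 'n
    by (simp add: vec_eq_iff row_def mat_def axis_def)
  have expand: "(\<Sum>i\<in>UNIV. x $ i *s axis i 1) = x"
    by (rule basis_expansion)
  have "det (mat 1 + outer u v) = det (?T ** (mat 1 + outer u v) ** Q)"
    using det_mul[of ?T Q] by (simp add: det_mul TQ det_I)
  also have "?T ** (mat 1 + outer u v) ** Q = mat 1 + outer (?T *v u) (?T *v v)"
    by (simp add: matrix_add_ldistrib matrix_mult_add_right TQ matrix_mult_outer outer_mult_matrix)
  also have "\<dots> = (\<chi> i. if i = k then \<Sum>i\<in>UNIV. x $ i *s row i (mat 1) else row i (mat 1))"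
    unfolding Tu row expand by (auto simp: vec_eq_iff x_def mat_def axis_def)
  also have "det \<dots> = x $ k"
    by (simp add: cramer_lemma_transpose det_I)
  also have "x $ k = 1 + (norm u *\<^sub>R axis k 1) \<bullet> (?T *v v)"
    by (simp add: x_def inner_axis')
  also have "(norm u *\<^sub>R axis k 1) \<bullet> (?T *v v) = (?T *v u) \<bullet> (?T *v v)"
    by (simp only: Tu)
  also have "\<dots> = u \<bullet> v"
    by (simp add: transpose_matrix_vector dot_lmul_matrix)
       (metis TQ(2) matrix_vector_mul_assoc matrix_vector_mul_lid transpose_matrix_vector)
  finally show ?thesis .
qed

text \<open>The assumption makes the first summand invertible, so that the matrix factors into two rank one
  perturbations of the identity.\<close>

lemma det_mat_1_plus_two_outer:
  fixes u v p q :: "real^'n"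
  assumes "1 + p \<bullet> u \<noteq> 0"
  shows "det (mat 1 + outer u p + outer v q) = (1 + p \<bullet> u) * (1 + q \<bullet> v) - (q \<bullet> u) * (p \<bullet> v)"
proof -
  define c where "c = p \<bullet> v / (1 + p \<bullet> u)"
  define w where "w = v - c *\<^sub>R u"
  have pw: "p \<bullet> w = c"
    using assms by (simp add: w_def c_def inner_diff_right field_simps)
  have "mat 1 + outer u p + outer v q = (mat 1 + outer u p) ** (mat 1 + outer w q)"
    by (simp add: matrix_add_ldistrib matrix_mult_add_right outer_mult_outer pw)
       (simp add: w_def vec_eq_iff algebra_simps)
  then have "det (mat 1 + outer u p + outer v q) = (1 + u \<bullet> p) * (1 + w \<bullet> q)"
    by (simp add: det_mul det_mat_1_plus_outer)
  also have "(1 + u \<bullet> p) * (w \<bullet> q) = (1 + p \<bullet> u) * (q \<bullet> v) - (q \<bullet> u) * (p \<bullet> v)"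
    using assms by (simp add: w_def c_def inner_diff_left inner_commute[of v q] inner_commute[of u q] inner_commute[of u p]) (simp add: field_simps)
  then have "(1 + u \<bullet> p) * (1 + w \<bullet> q) = (1 + p \<bullet> u) * (1 + q \<bullet> v) - (q \<bullet> u) * (p \<bullet> v)"
    by (simp add: algebra_simps inner_commute)
  finally show ?thesis .
qed

section \<open>Volumes of linear images\<close>

text \<open>Both sides are multiplicative in the map, so it suffices to treat elementary maps, for which
  the images of boxes are explicit.\<close>

lemma measure_linear_image_finite:
  fixes f :: "real^'n \<Rightarrow> real^'n"
  assumes "linear f" "S \<in> lmeasurable"
  shows "f ` S \<in> lmeasurable \<and> measure lebesgue (f ` S) = \<bar>det (matrix f)\<bar> * measure lebesgue S"
proof -
  let ?Q = "\<lambda>f::real^'n \<Rightarrow> real^'n. \<lambda>S. f ` S \<in> lmeasurable \<and>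
     measure lebesgue (f ` S) = \<bar>det (matrix f)\<bar> * measure lebesgue S"
  have "\<forall>S\<in>lmeasurable. ?Q f S"
  proof (rule induct_linear_elementary[OF \<open>linear f\<close>]; intro ballI)
    fix f g :: "real^'n \<Rightarrow> real^'n" and S :: "(real^'n) set"
    assume lin: "linear f" "linear g" and f: "\<forall>S\<in>lmeasurable. ?Q f S" and g: "\<forall>S\<in>lmeasurable. ?Q g S"
      and S: "S \<in> lmeasurable"
    then have gS: "?Q g S" by blast
    then have "?Q f (g ` S)" using f by blast
    then show "?Q (f \<circ> g) S"
      using gS by (simp add: image_comp matrix_compose[OF lin(2,1)] det_mul abs_mult)
  next
    fix f :: "real^'n \<Rightarrow> real^'n" and i and S :: "(real^'n) set"
    assume lin: "linear f" and 0: "\<And>x. f x $ i = 0" and S: "S \<in> lmeasurable"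
    have "\<not> surj f"
      using 0 by (metis axis_nth surjD zero_neq_one)
    then have "\<not> inj f" using lin linear_injective_imp_surjective by blast
    then have "negligible (f ` S)" "det (matrix f) = 0"
      using lin negligible_linear_singular_image det_nz_iff_inj by blast+
    then show "?Q f S" by (simp add: negligible_iff_measure)
  next
    fix c :: "'n \<Rightarrow> real" and S :: "(real^'n) set"
    assume S: "S \<in> lmeasurable"
    have "matrix (\<lambda>x::real^'n. \<chi> i. c i * x $ i) = (\<chi> i j. if i = j then c i else 0)"
      by (simp add: vec_eq_iff matrix_def axis_def)
    then have "det (matrix (\<lambda>x::real^'n. \<chi> i. c i * x $ i)) = prod c UNIV"
      by (simp add: det_diagonal)
    then show "?Q (\<lambda>x. \<chi> i. c i * x $ i) S"
      using measurable_stretch[OF S] measure_stretch[OF S] by simp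
  next
    fix m n :: 'n and S :: "(real^'n) set"
    assume mn: "m \<noteq> n" and S: "S \<in> lmeasurable"
    let ?p = "Transposition.transpose m n"
    let ?h = "\<lambda>x::real^'n. \<chi> i. x $ ?p i"
    have lin: "linear ?h" by (rule linearI) (simp_all add: vec_eq_iff)
    have hh: "?h (?h x) = x" for x by (simp add: vec_eq_iff)
    have box: "?h ` cbox a b = cbox (?h a) (?h b)" for a b
    proof -
      have sub: "?h x \<in> cbox (?h a) (?h b)" if "x \<in> cbox a b" for x a b
        using that by (simp add: mem_box_cart)
      show ?thesis
      proof (intro subset_antisym image_subsetI sub subsetI)
        fix x assume "x \<in> cbox (?h a) (?h b)"
        then have "?h x \<in> cbox a b" using sub[of x "?h a" "?h b"] by (simp only: hh)
        then show "x \<in> ?h ` cbox a b" using hh[of x, symmetric] by (rule rev_image_eqI)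
      qed
    qed
    have "measure lebesgue (?h ` cbox a b) = 1 * measure lebesgue (cbox a b)" for a b
    proof (cases "cbox a b = {}")
      case False
      have "(\<Prod>i\<in>UNIV. b $ ?p i - a $ ?p i) = (\<Prod>i\<in>UNIV. b $ i - a $ i)"
        by (rule prod.reindex_bij_witness[of _ ?p ?p]) auto
      moreover have "cbox (?h a) (?h b) \<noteq> {}" using False unfolding box[of a b, symmetric] by simp
      ultimately show ?thesis using False by (simp add: box content_cbox_cart)
    qed simp
    from measure_linear_sufficient[OF lin S this]
    have *: "?h ` S \<in> lmeasurable" "measure lebesgue (?h ` S) = measure lebesgue S" by auto
    have "matrix ?h ** matrix ?h = mat 1"
      using hh by (simp add: matrix_compose[OF lin lin, symmetric] comp_def matrix_id_mat_1[unfolded id_def])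
    then have "det (matrix ?h) * det (matrix ?h) = 1" by (metis det_mul det_I)
    then have "\<bar>det (matrix ?h)\<bar> = 1" unfolding square_eq_1_iff by auto
    then show "?Q ?h S" using * by simp
  next
    fix m n :: 'n and S :: "(real^'n) set"
    assume mn: "m \<noteq> n" and S: "S \<in> lmeasurable"
    let ?h = "\<lambda>x::real^'n. \<chi> i. if i = m then x $ m + x $ n else x $ i"
    have lin: "linear ?h" by (rule linearI) (auto simp: vec_eq_iff algebra_simps)
    have "measure lebesgue (?h ` cbox a b) = 1 * measure lebesgue (cbox a b)" for a b
    proof (cases "cbox a b = {}")
      case False
      \<comment> \<open>the volume of a sheared box is known for boxes on one side of a hyperplane; translate\<close>
      let ?v = "\<chi> i. if i = n then - a $ n else 0"
      have ne: "cbox (?v + a) (?v + b) \<noteq> {}" using False by (simp add: cbox_translation)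
      have "?h ` cbox a b = (+) (?h (- ?v)) ` ?h ` cbox (?v + a) (?v + b)"
        unfolding cbox_translation image_comp comp_def
        by (rule image_cong[OF refl]) (auto simp: vec_eq_iff)
      then have "measure lebesgue (?h ` cbox a b) = measure lebesgue (?h ` cbox (?v + a) (?v + b))"
        by (simp add: measure_translation)
      also have "\<dots> = measure lebesgue (cbox (?v + a) (?v + b))"
        by (rule measure_shear_interval[OF mn ne]) simp
      also have "\<dots> = measure lebesgue (cbox a b)"
        by (simp only: cbox_translation measure_translation)
      finally show ?thesis by simp
    qed simp
    from measure_linear_sufficient[OF lin S this]
    have *: "?h ` S \<in> lmeasurable" "measure lebesgue (?h ` S) = measure lebesgue S" by auto
    have "matrix ?h = (\<chi> k. if k = m then row m (mat 1) + 1 *s row n (mat 1) else row k (mat 1))"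
      by (auto simp: vec_eq_iff matrix_def row_def mat_def axis_def)
    then have "det (matrix ?h) = 1" using det_row_operation[OF mn, of "mat 1" 1] by simp
    then show "?Q ?h S" using * by simp
  qed
  then show ?thesis using assms(2) by blast
qed

section \<open>Differential calculus\<close>

text \<open>Second differences see the mixed second derivative, and they are symmetric in the two
  directions.\<close>

lemma second_difference_limit:
  fixes f :: "'a::real_normed_vector \<Rightarrow> real"
  assumes U: "open U" "x \<in> U" and f: "\<And>z. z \<in> U \<Longrightarrow> (f has_derivative f' z) (at z)"
    and D: "((\<lambda>z. f' z u) has_derivative D) (at x)"
  shows "((\<lambda>t. (f (x + t *\<^sub>R u + t *\<^sub>R v) - f (x + t *\<^sub>R u) - f (x + t *\<^sub>R v) + f x) / t\<^sup>2)
           \<longlongrightarrow> D v) (at_right 0)"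
proof (rule tendstoI)
  fix e :: real assume "e > 0"
  define K where "K = norm u + norm v + 1"
  have K: "K > 0" by (simp add: K_def add_nonneg_pos)
  define e' where "e' = e / (3 * K)"
  have e': "e' > 0" using \<open>e > 0\<close> K by (simp add: e'_def)
  obtain d1 where d1: "d1 > 0" "ball x d1 \<subseteq> U" using U open_contains_ball by blast
  obtain d2 where d2: "d2 > 0"
    "\<And>y. norm (y - x) < d2 \<Longrightarrow> norm (f' y u - f' x u - D (y - x)) \<le> e' * norm (y - x)"
    using D e' unfolding has_derivative_at_alt by blast
  have linD: "bounded_linear D" using D has_derivative_bounded_linear by blast
  define d where "d = min d1 d2 / K"
  have "d > 0" using d1 d2 K by (simp add: d_def)
  have "dist ((f (x + t *\<^sub>R u + t *\<^sub>R v) - f (x + t *\<^sub>R u) - f (x + t *\<^sub>R v) + f x) / t\<^sup>2) (D v) < e"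
    if t: "0 < t" "t < d" for t
  proof -
    have tK: "t * K < min d1 d2" using t K by (simp add: d_def field_simps)
    have nrm: "norm (s *\<^sub>R u + r *\<^sub>R v) \<le> t * K" if "0 \<le> s" "s \<le> t" "0 \<le> r" "r \<le> t" for s r
    proof -
      have "norm (s *\<^sub>R u + r *\<^sub>R v) \<le> s * norm u + r * norm v"
        using that by (metis norm_triangle_le norm_scaleR abs_of_nonneg order_refl)
      also have "\<dots> \<le> t * norm u + t * norm v" using that by (intro add_mono mult_right_mono) auto
      also have "\<dots> \<le> t * K" using t by (simp add: K_def algebra_simps)
      finally show ?thesis .
    qed
    have inU: "x + s *\<^sub>R u + r *\<^sub>R v \<in> U" if "0 \<le> s" "s \<le> t" "0 \<le> r" "r \<le> t" for s r
      using nrm[OF that] tK d1(2) by (auto simp: subset_iff dist_norm add.assoc norm_minus_commute)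
    define g where "g = (\<lambda>s. f (x + s *\<^sub>R u + t *\<^sub>R v) - f (x + s *\<^sub>R u))"
    define g' where "g' = (\<lambda>s. f' (x + s *\<^sub>R u + t *\<^sub>R v) u - f' (x + s *\<^sub>R u) u)"
    have g: "(g has_real_derivative g' s) (at s)" if s: "0 \<le> s" "s \<le> t" for s
    proof -
      have p: "((\<lambda>s. f (x + s *\<^sub>R u + r *\<^sub>R v)) has_real_derivative f' (x + s *\<^sub>R u + r *\<^sub>R v) u) (at s)"
        if r: "0 \<le> r" "r \<le> t" for r
      proof -
        have fz: "(f has_derivative f' (x + s *\<^sub>R u + r *\<^sub>R v)) (at (x + s *\<^sub>R u + r *\<^sub>R v))"
          by (rule f[OF inU[OF s r]])
        have "((\<lambda>s. x + s *\<^sub>R u + r *\<^sub>R v) has_derivative (\<lambda>h. h *\<^sub>R u)) (at s)"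
          by (auto intro!: derivative_eq_intros)
        from has_derivative_compose[OF this fz]
        have "((\<lambda>s. f (x + s *\<^sub>R u + r *\<^sub>R v)) has_derivative (\<lambda>h. f' (x + s *\<^sub>R u + r *\<^sub>R v) (h *\<^sub>R u))) (at s)" .
        then show ?thesis
          using linear_simps(5)[OF has_derivative_bounded_linear[OF fz]]
          by (simp add: has_field_derivative_def mult_commute_abs)
      qed
      show ?thesis unfolding g_def g'_def
        using DERIV_diff[OF p[of t] p[of 0]] t by simp
    qed
    obtain s where s: "0 < s" "s < t" "g t - g 0 = (t - 0) * g' s"
      using MVT2[OF \<open>0 < t\<close>, of g g'] g by auto
    have b1: "\<bar>f' (x + s *\<^sub>R u + t *\<^sub>R v) u - f' x u - D (s *\<^sub>R u + t *\<^sub>R v)\<bar> \<le> e' * (t * K)"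
    proof -
      have n: "norm (s *\<^sub>R u + t *\<^sub>R v) \<le> t * K" using nrm[of s t] s by simp
      then have "norm (x + s *\<^sub>R u + t *\<^sub>R v - x) < d2" using tK by (simp add: add.assoc)
      from d2(2)[OF this] have "\<bar>f' (x + s *\<^sub>R u + t *\<^sub>R v) u - f' x u - D (s *\<^sub>R u + t *\<^sub>R v)\<bar>
         \<le> e' * norm (s *\<^sub>R u + t *\<^sub>R v)" by (simp add: add.assoc)
      also have "\<dots> \<le> e' * (t * K)" using n e' by simp
      finally show ?thesis .
    qed
    have b2: "\<bar>f' (x + s *\<^sub>R u) u - f' x u - D (s *\<^sub>R u)\<bar> \<le> e' * (t * K)"
    proof -
      have n: "norm (s *\<^sub>R u) \<le> t * K" using nrm[of s 0] s t by simp
      then have "norm (x + s *\<^sub>R u - x) < d2" using tK by simp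
      from d2(2)[OF this] have "\<bar>f' (x + s *\<^sub>R u) u - f' x u - D (s *\<^sub>R u)\<bar>
         \<le> e' * norm (s *\<^sub>R u)" by simp
      also have "\<dots> \<le> e' * (t * K)" using n e' by (intro mult_left_mono) simp_all
      finally show ?thesis .
    qed
    have Ds: "D (s *\<^sub>R u + t *\<^sub>R v) = D (s *\<^sub>R u) + t * D v"
      using linear_simps(1,5)[OF linD] by simp
    have g's: "\<bar>g' s - t * D v\<bar> \<le> 2 * (e' * (t * K))"
      using b1 b2 unfolding g'_def Ds by linarith
    have "f (x + t *\<^sub>R u + t *\<^sub>R v) - f (x + t *\<^sub>R u) - f (x + t *\<^sub>R v) + f x = t * g' s"
      using s(3) by (simp add: g_def)
    then have "(f (x + t *\<^sub>R u + t *\<^sub>R v) - f (x + t *\<^sub>R u) - f (x + t *\<^sub>R v) + f x) / t\<^sup>2 - D v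
       = (g' s - t * D v) / t"
      using t by (simp add: field_simps power2_eq_square)
    then have "dist ((f (x + t *\<^sub>R u + t *\<^sub>R v) - f (x + t *\<^sub>R u) - f (x + t *\<^sub>R v) + f x) / t\<^sup>2) (D v)
       = \<bar>g' s - t * D v\<bar> / t"
      using t by (simp add: dist_real_def abs_divide)
    also have "\<dots> \<le> 2 * (e' * (t * K)) / t" using g's t by (intro divide_right_mono) simp_all
    also have "\<dots> = 2 * e' * K" using t by simp
    also have "\<dots> < e" using \<open>e > 0\<close> K by (simp add: e'_def)
    finally show ?thesis .
  qed
  then show "\<forall>\<^sub>F t in at_right 0. dist ((f (x + t *\<^sub>R u + t *\<^sub>R v) - f (x + t *\<^sub>R u) - f (x + t *\<^sub>R v) + f x) / t\<^sup>2) (D v) < e"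
    using \<open>d > 0\<close> eventually_at_right_field by blast
qed

lemma mixed_derivatives_commute:
  fixes f :: "'a::real_normed_vector \<Rightarrow> real"
  assumes U: "open U" "x \<in> U" and f: "\<And>z. z \<in> U \<Longrightarrow> (f has_derivative f' z) (at z)"
    and D: "((\<lambda>z. f' z u) has_derivative D) (at x)" and E: "((\<lambda>z. f' z v) has_derivative E) (at x)"
  shows "D v = E u"
proof -
  have "(\<lambda>t. (f (x + t *\<^sub>R u + t *\<^sub>R v) - f (x + t *\<^sub>R u) - f (x + t *\<^sub>R v) + f x) / t\<^sup>2)
      = (\<lambda>t. (f (x + t *\<^sub>R v + t *\<^sub>R u) - f (x + t *\<^sub>R v) - f (x + t *\<^sub>R u) + f x) / t\<^sup>2)"
    by (simp add: add.commute add.left_commute algebra_simps)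
  then show ?thesis
    using tendsto_unique[OF _ second_difference_limit[OF U f D, of v] ]
      second_difference_limit[OF U f E, of u] by (simp add: trivial_limit_at_right_real)
qed

text \<open>The mean value theorem along each ray upgrades directional derivatives.\<close>

lemma has_derivative_if_directional:
  fixes f :: "'a::real_inner \<Rightarrow> real" and w :: "'a \<Rightarrow> 'a"
  assumes U: "open U" "x \<in> U"
    and D: "\<And>z v. z \<in> U \<Longrightarrow> ((\<lambda>t. f (z + t *\<^sub>R v)) has_real_derivative w z \<bullet> v) (at 0)"
    and w: "isCont w x"
  shows "(f has_derivative (\<lambda>h. w x \<bullet> h)) (at x)"
  unfolding has_derivative_at_alt
proof (intro conjI allI impI)
  show "bounded_linear ((\<bullet>) (w x))" by (rule bounded_linear_inner_right)
  fix e :: real assume "e > 0"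
  obtain d1 where d1: "d1 > 0" "ball x d1 \<subseteq> U" using U open_contains_ball by blast
  obtain d2 where d2: "d2 > 0" "\<And>z. dist z x < d2 \<Longrightarrow> dist (w z) (w x) < e"
    using w \<open>e > 0\<close> unfolding continuous_at_eps_delta by blast
  have "norm (f y - f x - w x \<bullet> (y - x)) \<le> e * norm (y - x)" if y: "norm (y - x) < min d1 d2" for y
  proof -
    let ?h = "y - x"
    have near: "dist (x + t *\<^sub>R ?h) x < min d1 d2" if "0 \<le> t" "t \<le> 1" for t
    proof -
      have "dist (x + t *\<^sub>R ?h) x = t * norm ?h" using that by (simp add: dist_norm)
      also have "\<dots> \<le> norm ?h" using that by (simp add: mult_left_le_one_le)
      finally show ?thesis using y by simp
    qed
    have g: "((\<lambda>t. f (x + t *\<^sub>R ?h)) has_real_derivative w (x + t *\<^sub>R ?h) \<bullet> ?h) (at t)"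
      if t: "0 \<le> t" "t \<le> 1" for t
    proof -
      have "x + t *\<^sub>R ?h \<in> U" using near[OF t] d1(2) by (auto simp: dist_commute)
      from D[OF this, of ?h]
      have "((\<lambda>s. f (x + (t + s) *\<^sub>R ?h)) has_real_derivative w (x + t *\<^sub>R ?h) \<bullet> ?h) (at 0)"
        by (simp add: scaleR_add_left add.assoc)
      then show ?thesis
        using DERIV_shift[of "\<lambda>t. f (x + t *\<^sub>R ?h)" _ 0 t] by (simp add: add.commute)
    qed
    obtain t where t: "0 < t" "t < 1" "f (x + 1 *\<^sub>R ?h) - f (x + 0 *\<^sub>R ?h) = (1 - 0) * (w (x + t *\<^sub>R ?h) \<bullet> ?h)"
      using MVT2[of 0 1 "\<lambda>t. f (x + t *\<^sub>R ?h)" "\<lambda>t. w (x + t *\<^sub>R ?h) \<bullet> ?h"] g by auto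
    have "f y - f x - w x \<bullet> ?h = (w (x + t *\<^sub>R ?h) - w x) \<bullet> ?h"
      using t(3) by (simp add: inner_diff_left)
    then have "norm (f y - f x - w x \<bullet> ?h) \<le> norm (w (x + t *\<^sub>R ?h) - w x) * norm ?h"
      by (simp add: Cauchy_Schwarz_ineq2)
    also have "\<dots> \<le> e * norm ?h"
      using d2(2)[of "x + t *\<^sub>R ?h"] near[of t] t by (intro mult_right_mono) (auto simp: dist_norm)
    finally show ?thesis .
  qed
  then show "\<exists>d>0. \<forall>y. norm (y - x) < d \<longrightarrow> norm (f y - f x - w x \<bullet> (y - x)) \<le> e * norm (y - x)"
    using d1(1) d2(1) by (metis min_less_iff_conj)
qed

section \<open>Calculus of smooth functions\<close>

lemma frechet_derivative_eq:
  assumes "(f has_derivative f') (at x)"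
  shows "frechet_derivative f (at x) = f'"
  using frechet_derivative_at[OF assms] by simp

text \<open>The derivatives of a function on an open set depend on its values there only; this is what
  allows derivatives to be replaced by the formulas for them in the inductions below.\<close>

lemma Ck_on_cong:
  assumes "open S" "\<And>x. x \<in> S \<Longrightarrow> f x = g x" "Ck_on k S f"
  shows "Ck_on k S g"
  using assms(2,3)
proof (induction k arbitrary: f g)
  case 0
  then show ?case by (metis Ck_on.simps(1) continuous_on_cong)
next
  case (Suc k)
  have D: "(g has_derivative frechet_derivative f (at x)) (at x)" if "x \<in> S" for x
  proof (rule has_derivative_transform_within_open[OF _ \<open>open S\<close> that])
    show "(f has_derivative frechet_derivative f (at x)) (at x)"
      using Suc.prems(2) that frechet_derivative_works by auto
  qed (use Suc.prems in auto)
  have "Ck_on k S (\<lambda>x. frechet_derivative g (at x) v)" for v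
    by (rule Suc.IH[of "\<lambda>x. frechet_derivative f (at x) v"])
       (use Suc.prems in \<open>auto simp: frechet_derivative_eq[OF D]\<close>)
  then show ?case using D by (auto intro: differentiableI)
qed

lemma Ck_on_Suc_imp: "Ck_on (Suc k) S f \<Longrightarrow> Ck_on k S f"
proof (induction k arbitrary: f)
  case 0
  then show ?case
    by (auto intro!: continuous_at_imp_continuous_on differentiable_imp_continuous_within)
next
  case (Suc k)
  from Suc.prems have 1: "\<forall>x\<in>S. f differentiable (at x)"
    and 2: "\<And>v. Ck_on (Suc k) S (\<lambda>x. frechet_derivative f (at x) v)"
    by (simp_all del: Ck_on.simps(2) add: Ck_on.simps(2)[of "Suc k"])
  show ?case using 1 Suc.IH[OF 2] by simp
qed

lemma Ck_on_bounded_linear: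
  assumes L: "bounded_linear L" and S: "open S" and "Ck_on k S f"
  shows "Ck_on k S (\<lambda>x. L (f x))"
  using assms(3)
proof (induction k arbitrary: f)
  case 0
  then show ?case using bounded_linear.continuous_on[OF L] by simp
next
  case (Suc k)
  have D: "((\<lambda>x. L (f x)) has_derivative (\<lambda>v. L (frechet_derivative f (at x) v))) (at x)" if "x \<in> S" for x
    by (rule bounded_linear.has_derivative[OF L]) (use Suc.prems that frechet_derivative_works in auto)
  have "Ck_on k S (\<lambda>x. frechet_derivative (\<lambda>x. L (f x)) (at x) v)" for v
    by (rule Ck_on_cong[OF S, of "\<lambda>x. L (frechet_derivative f (at x) v)"])
       (use Suc in \<open>auto simp: frechet_derivative_eq[OF D]\<close>)
  then show ?case using D by (auto intro: differentiableI)
qed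

lemma Ck_on_add:
  assumes S: "open S" and "Ck_on k S f" "Ck_on k S g"
  shows "Ck_on k S (\<lambda>x. f x + g x)"
  using assms(2,3)
proof (induction k arbitrary: f g)
  case 0
  then show ?case by (simp add: continuous_on_add)
next
  case (Suc k)
  have D: "((\<lambda>x. f x + g x) has_derivative
      (\<lambda>v. frechet_derivative f (at x) v + frechet_derivative g (at x) v)) (at x)" if "x \<in> S" for x
    by (intro has_derivative_add frechet_derivative_works[THEN iffD1]) (use Suc.prems that in auto)
  have "Ck_on k S (\<lambda>x. frechet_derivative (\<lambda>x. f x + g x) (at x) v)" for v
    by (rule Ck_on_cong[OF S, of "\<lambda>x. frechet_derivative f (at x) v + frechet_derivative g (at x) v"])
       (use Suc in \<open>auto simp: frechet_derivative_eq[OF D]\<close>)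
  then show ?case using D by (auto intro: differentiableI)
qed

lemma Ck_on_bounded_bilinear:
  assumes B: "bounded_bilinear B" and S: "open S" and "Ck_on k S f" "Ck_on k S g"
  shows "Ck_on k S (\<lambda>x. B (f x) (g x))"
  using assms(3,4)
proof (induction k arbitrary: f g)
  case 0
  then show ?case by (simp add: bounded_bilinear.continuous_on[OF B])
next
  case (Suc k)
  let ?f = "\<lambda>x. frechet_derivative f (at x)" and ?g = "\<lambda>x. frechet_derivative g (at x)"
  have D: "((\<lambda>x. B (f x) (g x)) has_derivative (\<lambda>v. B (f x) (?g x v) + B (?f x v) (g x))) (at x)"
    if "x \<in> S" for x
    by (intro bounded_bilinear.FDERIV[OF B] frechet_derivative_works[THEN iffD1])
       (use Suc.prems that in auto)
  have "Ck_on k S (\<lambda>x. frechet_derivative (\<lambda>x. B (f x) (g x)) (at x) v)" for v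
  proof (rule Ck_on_cong[OF S])
    show "Ck_on k S (\<lambda>x. B (f x) (?g x v) + B (?f x v) (g x))"
      using Suc.prems by (intro Ck_on_add[OF S] Suc.IH) (auto intro: Ck_on_Suc_imp)
  qed (simp add: frechet_derivative_eq[OF D])
  then show ?case using D by (auto intro: differentiableI)
qed

lemma Ck_on_affine:
  assumes L: "bounded_linear L" and T: "open T" "\<And>t. t \<in> T \<Longrightarrow> p + L t \<in> S" and "Ck_on k S f"
  shows "Ck_on k T (\<lambda>t. f (p + L t))"
  using assms(4)
proof (induction k arbitrary: f)
  case 0
  then have "continuous_on S f" by simp
  then have "continuous_on T (f \<circ> (\<lambda>t. p + L t))"
    by (intro continuous_on_compose continuous_intros bounded_linear.continuous_on[OF L])
       (auto elim!: continuous_on_subset intro: T(2))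
  then show ?case by (simp add: comp_def)
next
  case (Suc k)
  have D: "((\<lambda>t. f (p + L t)) has_derivative (\<lambda>v. frechet_derivative f (at (p + L t)) (L v))) (at t)"
    if "t \<in> T" for t
  proof (rule has_derivative_compose[of "\<lambda>t. p + L t"])
    show "((\<lambda>t. p + L t) has_derivative L) (at t)"
      using bounded_linear.has_derivative[OF L has_derivative_ident] by (auto intro!: derivative_eq_intros)
    show "(f has_derivative frechet_derivative f (at (p + L t))) (at (p + L t))"
      using Suc.prems T(2)[OF that] frechet_derivative_works by auto
  qed
  have "Ck_on k T (\<lambda>t. frechet_derivative (\<lambda>t. f (p + L t)) (at t) v)" for v
    by (rule Ck_on_cong[OF T(1), of "\<lambda>t. frechet_derivative f (at (p + L t)) (L v)"])
       (use Suc in \<open>auto simp: frechet_derivative_eq[OF D]\<close>)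
  then show ?case using D by (auto intro: differentiableI)
qed

lemma smooth_on_differentiable: "smooth_on S f \<Longrightarrow> x \<in> S \<Longrightarrow> f differentiable (at x)"
  unfolding smooth_on_def by (metis Ck_on.simps(2))

lemma smooth_on_has_derivative:
  "smooth_on S f \<Longrightarrow> x \<in> S \<Longrightarrow> (f has_derivative frechet_derivative f (at x)) (at x)"
  using smooth_on_differentiable frechet_derivative_works by blast

lemma smooth_on_continuous_on: "smooth_on S f \<Longrightarrow> continuous_on S f"
  unfolding smooth_on_def by (metis Ck_on.simps(1))

lemma smooth_on_frechet_derivative:
  "smooth_on S f \<Longrightarrow> smooth_on S (\<lambda>x. frechet_derivative f (at x) v)"
  unfolding smooth_on_def by (metis Ck_on.simps(2))

lemma smooth_on_cong: "open S \<Longrightarrow> (\<And>x. x \<in> S \<Longrightarrow> f x = g x) \<Longrightarrow> smooth_on S f \<Longrightarrow> smooth_on S g"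
  unfolding smooth_on_def using Ck_on_cong by blast

lemma smooth_on_bounded_linear:
  "bounded_linear L \<Longrightarrow> open S \<Longrightarrow> smooth_on S f \<Longrightarrow> smooth_on S (\<lambda>x. L (f x))"
  unfolding smooth_on_def by (simp add: Ck_on_bounded_linear)

lemma smooth_on_add:
  "open S \<Longrightarrow> smooth_on S f \<Longrightarrow> smooth_on S g \<Longrightarrow> smooth_on S (\<lambda>x. f x + g x)"
  unfolding smooth_on_def by (simp add: Ck_on_add)

lemma smooth_on_bounded_bilinear:
  "bounded_bilinear B \<Longrightarrow> open S \<Longrightarrow> smooth_on S f \<Longrightarrow> smooth_on S g \<Longrightarrow> smooth_on S (\<lambda>x. B (f x) (g x))"
  unfolding smooth_on_def by (simp add: Ck_on_bounded_bilinear)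

lemma smooth_on_affine:
  "bounded_linear L \<Longrightarrow> open T \<Longrightarrow> (\<And>t. t \<in> T \<Longrightarrow> p + L t \<in> S) \<Longrightarrow> smooth_on S f \<Longrightarrow>
    smooth_on T (\<lambda>t. f (p + L t))"
  unfolding smooth_on_def using Ck_on_affine by blast

lemma smooth_on_mixed_derivatives_commute:
  fixes f :: "'a::real_normed_vector \<Rightarrow> real"
  assumes "open S" "smooth_on S f" "x \<in> S"
  shows "frechet_derivative (\<lambda>z. frechet_derivative f (at z) u) (at x) v =
         frechet_derivative (\<lambda>z. frechet_derivative f (at z) v) (at x) u"
  by (rule mixed_derivatives_commute[OF assms(1,3), of f "\<lambda>z. frechet_derivative f (at z)"])
     (use assms smooth_on_has_derivative smooth_on_frechet_derivative in blast)+

text \<open>Restricting a function of a pair to a slice turns its partial derivative into a derivative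
  of the joint function.\<close>

lemma frechet_derivative_slice:
  assumes "f differentiable (at (x, y))"
  shows "((\<lambda>y. f (x, y)) has_derivative (\<lambda>h. frechet_derivative f (at (x, y)) (0, h))) (at y)"
    and "((\<lambda>x. f (x, y)) has_derivative (\<lambda>h. frechet_derivative f (at (x, y)) (h, 0))) (at x)"
proof -
  have f: "(f has_derivative frechet_derivative f (at (x, y))) (at (x, y))"
    using assms frechet_derivative_works by blast
  have 1: "((\<lambda>y. (x, y)) has_derivative (\<lambda>h. (0, h))) (at y)"
    by (auto intro!: derivative_eq_intros)
  show "((\<lambda>y. f (x, y)) has_derivative (\<lambda>h. frechet_derivative f (at (x, y)) (0, h))) (at y)"
    by (rule has_derivative_compose[OF 1 f])
  have 2: "((\<lambda>x. (x, y)) has_derivative (\<lambda>h. (h, 0))) (at x)"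
    by (auto intro!: derivative_eq_intros)
  show "((\<lambda>x. f (x, y)) has_derivative (\<lambda>h. frechet_derivative f (at (x, y)) (h, 0))) (at x)"
    by (rule has_derivative_compose[OF 2 f])
qed

lemma partial_eq: "(f has_derivative f') (at x) \<Longrightarrow> partial i f x = f' (axis i 1)"
  by (simp add: partial_def frechet_derivative_eq)

section \<open>Linear differential equations\<close>

text \<open>The Picard iterates form a series dominated by a geometric one. The length of the interval
  depends on the equation only, so that it serves all initial values at once.\<close>

lemma linear_ode_local_solution:
  fixes N :: "real \<Rightarrow> real^'n^'n"
  assumes "d > 0" and N: "continuous_on {-d..d} N"
  shows "\<exists>e>0. e \<le> d \<and> (\<forall>y. \<exists>V. V 0 = y \<and>
    (\<forall>t\<in>{-e<..<e}. (V has_vector_derivative N t *v V t) (at t)))"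
proof -
  have bb: "bounded_bilinear ((*v) :: real^'n^'n \<Rightarrow> real^'n \<Rightarrow> real^'n)"
    by (rule bounded_bilinear_matrix_vector_mult)
  obtain C where C: "C > 0" "\<And>(A::real^'n^'n) v. norm (A *v v) \<le> norm A * norm v * C"
    using bounded_bilinear.pos_bounded[OF bb] by blast
  have "bounded (N ` {-d..d})" by (intro compact_imp_bounded compact_continuous_image N) simp
  then obtain B where B: "B > 0" "\<And>t. t \<in> {-d..d} \<Longrightarrow> norm (N t) \<le> B"
    unfolding bounded_pos by auto
  define K where "K = B * C"
  have K: "K > 0" "\<And>t v. t \<in> {-d..d} \<Longrightarrow> norm (N t *v v) \<le> K * norm v"
  proof -
    show "K > 0" using B C by (simp add: K_def)
    show "norm (N t *v v) \<le> K * norm v" if "t \<in> {-d..d}" for t v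
    proof -
      have "norm (N t *v v) \<le> norm (N t) * norm v * C" by (rule C(2))
      also have "\<dots> \<le> B * norm v * C" using B(2)[OF that] C(1) by (intro mult_right_mono) auto
      finally show ?thesis by (simp add: K_def mult_ac)
    qed
  qed
  define e where "e = min d (1 / (2 * K))"
  have e: "e > 0" "e \<le> d" "K * e \<le> 1/2" using \<open>d > 0\<close> K by (auto simp: e_def min_def field_simps)
  let ?I = "{-e..e}"
  have Id: "?I \<subseteq> {-d..d}" using e by auto
  have "\<exists>V. V 0 = y \<and> (\<forall>t\<in>{-e<..<e}. (V has_vector_derivative N t *v V t) (at t))" for y
  proof -
    define P where "P = (\<lambda>n u. (n = 0 \<longrightarrow> u = (\<lambda>_. y)) \<and> continuous_on ?I u \<and> (\<forall>t\<in>?I. norm (u t) \<le> norm y * (1/2)^n))"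
    define Q where "Q = (\<lambda>(n::nat) u w. w 0 = 0 \<and> (\<forall>t\<in>?I. (w has_vector_derivative N t *v u t) (at t within ?I)))"
    have step: "\<exists>w. P (Suc n) w \<and> Q n u w" if u: "P n u" for u n
    proof -
      have "continuous_on ?I (\<lambda>t. N t *v u t)"
        using u bounded_bilinear.continuous_on[OF bb continuous_on_subset[OF N Id]] by (simp add: P_def)
      then obtain w where w: "\<And>t. t \<in> ?I \<Longrightarrow> (w has_vector_derivative N t *v u t) (at t within ?I)"
        using antiderivative_continuous by blast
      define w' where "w' = (\<lambda>t. w t - w 0)"
      have w': "(w' has_vector_derivative N t *v u t) (at t within ?I)" if "t \<in> ?I" for t
        unfolding w'_def using has_vector_derivative_diff[OF w[OF that] has_vector_derivative_const] by simp
      have bound: "norm (w' t) \<le> norm y * (1/2)^Suc n" if t: "t \<in> ?I" for t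
      proof -
        have "norm (w' t - w' 0) \<le> (K * (norm y * (1/2)^n)) * norm (t - 0)"
        proof (rule differentiable_bound[of ?I w' "\<lambda>s h. h *\<^sub>R (N s *v u s)"])
          show "onorm (\<lambda>h. h *\<^sub>R (N s *v u s)) \<le> K * (norm y * (1/2)^n)" if "s \<in> ?I" for s
          proof -
            have "norm (N s *v u s) \<le> K * norm (u s)" using K(2) Id that by blast
            also have "\<dots> \<le> K * (norm y * (1/2)^n)" using u that K(1) by (simp add: P_def)
            finally show ?thesis by (auto intro!: onorm_le simp: mult.commute[of _ "\<bar>_\<bar>"] mult_left_mono)
          qed
        qed (use w' t e in \<open>auto simp: has_vector_derivative_def\<close>)
        also have "\<dots> \<le> (K * (norm y * (1/2)^n)) * e"
          using t K(1) by (intro mult_left_mono) auto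
        also have "\<dots> = (K * e) * (norm y * (1/2)^n)" by simp
        also have "\<dots> \<le> 1/2 * (norm y * (1/2)^n)" by (intro mult_right_mono e) simp
        finally show ?thesis by (simp add: w'_def)
      qed
      have "continuous_on ?I w'"
        unfolding continuous_on_eq_continuous_within
        using w' has_vector_derivative_continuous by blast
      then have "P (Suc n) w' \<and> Q n u w'" using bound w' by (simp add: P_def Q_def w'_def)
      then show ?thesis by blast
    qed
    have "\<exists>u. P 0 u" by (rule exI[of _ "\<lambda>_. y"]) (simp add: P_def)
    then obtain u where u: "\<And>n. P n (u n)" "\<And>n. Q n (u n) (u (Suc n))"
      using dependent_nat_choice[of P Q] step by metis
    have un: "norm (u n t) \<le> norm y * (1/2)^n" if "t \<in> ?I" for n t using u(1) that by (simp add: P_def)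
    have geo: "summable (\<lambda>n. norm y * (1/2)^n)" by (intro summable_mult summable_geometric) simp
    have sm: "summable (\<lambda>n. u n t)" if "t \<in> ?I" for t
      by (rule summable_comparison_test'[OF geo]) (use un that in auto)
    define V where "V = (\<lambda>t. \<Sum>n. u n t)"
    have tail: "norm (V t - (\<Sum>i<n. u i t)) \<le> 2 * norm y * (1/2)^n" if t: "t \<in> ?I" for t n
    proof -
      have "V t - (\<Sum>i<n. u i t) = (\<Sum>i. u (i + n) t)"
        unfolding V_def using suminf_minus_initial_segment[OF sm[OF t], of n] by simp
      also have "norm \<dots> \<le> (\<Sum>i. norm y * (1/2)^n * (1/2)^i)"
      proof (rule norm_suminf_le)
        show "norm (u (i + n) t) \<le> norm y * (1/2)^n * (1/2)^i" for i
          using un[OF t, of "i + n"] by (simp add: power_add mult_ac)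
        show "summable (\<lambda>i. norm y * (1/2)^n * (1/2::real)^i)"
          by (intro summable_mult summable_geometric) simp
      qed
      also have "\<dots> = 2 * norm y * (1/2)^n"
        by (subst suminf_mult) (auto simp: suminf_geometric summable_geometric)
      finally show ?thesis .
    qed
    have "\<exists>g. \<forall>t\<in>?I. (\<lambda>n. u (Suc n) t) sums g t \<and> (g has_derivative (\<lambda>h. h *\<^sub>R (N t *v V t))) (at t within ?I)"
    proof (rule has_derivative_series[where f' = "\<lambda>n t h. h *\<^sub>R (N t *v u n t)" and x=0])
      show "(u (Suc n) has_derivative (\<lambda>h. h *\<^sub>R (N t *v u n t))) (at t within ?I)" if "t \<in> ?I" for n t
        using u(2)[of n] that by (simp add: Q_def has_vector_derivative_def)
      show "(\<lambda>n. u (Suc n) 0) sums 0" using u(2) by (simp add: Q_def)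
      fix r :: real assume "r > 0"
      have "(\<lambda>n. K * (2 * norm y * (1/2)^n)) \<longlonglongrightarrow> K * (2 * norm y * 0)"
        by (intro tendsto_intros LIMSEQ_power_zero) simp
      then have "\<forall>\<^sub>F n in sequentially. K * (2 * norm y * (1/2)^n) < r"
        using \<open>r > 0\<close> order_tendstoD(2) by fastforce
      then show "\<forall>\<^sub>F n in sequentially. \<forall>t\<in>?I. \<forall>h.
          norm ((\<Sum>i<n. h *\<^sub>R (N t *v u i t)) - h *\<^sub>R (N t *v V t)) \<le> r * norm h"
      proof eventually_elim
        case (elim n)
        show ?case
        proof (intro ballI allI)
          fix t h assume t: "t \<in> ?I"
          have "(\<Sum>i<n. h *\<^sub>R (N t *v u i t)) - h *\<^sub>R (N t *v V t) = - (h *\<^sub>R (N t *v (V t - (\<Sum>i<n. u i t))))"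
            by (simp add: vec.diff vec.sum scaleR_sum_right scaleR_diff_right)
          then have "norm ((\<Sum>i<n. h *\<^sub>R (N t *v u i t)) - h *\<^sub>R (N t *v V t))
              = \<bar>h\<bar> * norm (N t *v (V t - (\<Sum>i<n. u i t)))" by simp
          also have "\<dots> \<le> \<bar>h\<bar> * (K * norm (V t - (\<Sum>i<n. u i t)))"
            using K(2) t Id by (intro mult_left_mono) auto
          also have "\<dots> \<le> \<bar>h\<bar> * (K * (2 * norm y * (1/2)^n))"
            using tail[OF t] K(1) by (intro mult_left_mono) auto
          also have "\<dots> \<le> \<bar>h\<bar> * r" using elim by (intro mult_left_mono) auto
          finally show "norm ((\<Sum>i<n. h *\<^sub>R (N t *v u i t)) - h *\<^sub>R (N t *v V t)) \<le> r * norm h"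
            by (simp add: mult.commute)
        qed
      qed
    qed (use e in auto)
    then obtain g where g: "\<And>t. t \<in> ?I \<Longrightarrow> (\<lambda>n. u (Suc n) t) sums g t"
      "\<And>t. t \<in> ?I \<Longrightarrow> (g has_derivative (\<lambda>h. h *\<^sub>R (N t *v V t))) (at t within ?I)" by blast
    have u0: "u 0 = (\<lambda>_. y)" using u(1)[of 0] by (simp add: P_def)
    have Vg: "V t = y + g t" if "t \<in> ?I" for t
    proof -
      have "(\<lambda>n. u n t) sums (g t + u 0 t)" by (rule sums_Suc[OF g(1)[OF that]])
      then show ?thesis by (simp add: V_def u0 sums_iff)
    qed
    have g0: "g 0 = 0"
    proof -
      have "(\<lambda>n. u (Suc n) 0) sums 0" using u(2) by (simp add: Q_def)
      then show ?thesis using g(1)[of 0] e sums_unique2 by fastforce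
    qed
    have "(V has_vector_derivative N t *v V t) (at t)" if t: "t \<in> {-e<..<e}" for t
    proof -
      have "t \<in> interior ?I" using t by (simp add: interior_atLeastAtMost_real)
      then have "at t within ?I = at t" by (rule at_within_interior)
      then have "((\<lambda>t. y + g t) has_derivative (\<lambda>h. h *\<^sub>R (N t *v V t))) (at t)"
        using g(2)[of t] t by (auto intro!: derivative_eq_intros)
      then have "(V has_derivative (\<lambda>h. h *\<^sub>R (N t *v V t))) (at t)"
        by (rule has_derivative_transform_within_open[of _ _ _ _ "{-e<..<e}"]) (use t Vg in auto)
      then show ?thesis by (simp add: has_vector_derivative_def)
    qed
    moreover have "V 0 = y" using Vg[of 0] g0 e by simp
    ultimately show ?thesis by blast
  qed
  then show ?thesis using e by blast
qed

section \<open>Charts and changes of charts\<close>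

abbreviation inv_chart :: "('m, 'n::finite) chart \<Rightarrow> real^'n \<Rightarrow> 'm" where
  "inv_chart c \<equiv> inv_into (dom_of c) (map_of_chart c)"

lemma chart_openin: "smooth_manifold M A \<Longrightarrow> c \<in> A \<Longrightarrow> openin M (dom_of c)"
  by (simp add: smooth_manifold_def)

lemma chart_open_img: "smooth_manifold M A \<Longrightarrow> c \<in> A \<Longrightarrow> open (img_of c)"
  by (simp add: smooth_manifold_def)

lemma chart_homeomorphic_map:
  "smooth_manifold M A \<Longrightarrow> c \<in> A \<Longrightarrow>
     homeomorphic_map (subtopology M (dom_of c)) (top_of_set (img_of c)) (map_of_chart c)"
  by (simp add: smooth_manifold_def)

lemma chart_topspace:
  assumes "smooth_manifold M A" "c \<in> A"
  shows "topspace (subtopology M (dom_of c)) = dom_of c"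
  using openin_subset[OF chart_openin[OF assms]] by (auto simp: topspace_subtopology)

lemma chart_inj_on:
  assumes "smooth_manifold M A" "c \<in> A"
  shows "inj_on (map_of_chart c) (dom_of c)"
  using homeomorphic_imp_injective_map[OF chart_homeomorphic_map[OF assms]]
  by (simp only: chart_topspace[OF assms])

lemma inv_chart_map:
  "smooth_manifold M A \<Longrightarrow> c \<in> A \<Longrightarrow> p \<in> dom_of c \<Longrightarrow> inv_chart c (map_of_chart c p) = p"
  by (simp add: chart_inj_on)

lemma map_inv_chart: "x \<in> img_of c \<Longrightarrow> map_of_chart c (inv_chart c x) = x"
  by (simp add: img_of_def f_inv_into_f)

lemma inv_chart_dom: "x \<in> img_of c \<Longrightarrow> inv_chart c x \<in> dom_of c"
  by (simp add: img_of_def inv_into_into)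

lemma open_map_of_chart:
  assumes "smooth_manifold M A" "c \<in> A" "openin M U"
  shows "open (map_of_chart c ` (dom_of c \<inter> U))"
proof -
  have "openin (subtopology M (dom_of c)) (dom_of c \<inter> U)"
    using assms(3) openin_subtopology_Int2 by blast
  then have "openin (top_of_set (img_of c)) (map_of_chart c ` (dom_of c \<inter> U))"
    using homeomorphic_imp_open_map[OF chart_homeomorphic_map[OF assms(1,2)]] by (simp add: open_map_def)
  then show ?thesis using chart_open_img[OF assms(1,2)] openin_open_trans by blast
qed

lemma open_vimage_chart:
  assumes "smooth_manifold M A" "c \<in> A" "open U"
  shows "openin M {p \<in> dom_of c. map_of_chart c p \<in> U}"
proof -
  have "openin (top_of_set (img_of c)) (img_of c \<inter> U)" using assms(3) by auto
  then have "openin (subtopology M (dom_of c)) {p \<in> dom_of c. map_of_chart c p \<in> img_of c \<inter> U}"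
    using openin_continuous_map_preimage[OF homeomorphic_imp_continuous_map[OF chart_homeomorphic_map[OF assms(1,2)]]]
    by (simp only: chart_topspace[OF assms(1,2)])
  moreover have "{p \<in> dom_of c. map_of_chart c p \<in> img_of c \<inter> U} = {p \<in> dom_of c. map_of_chart c p \<in> U}"
    by (auto simp: img_of_def)
  ultimately show ?thesis
    using openin_trans_full[OF _ chart_openin[OF assms(1,2)]] by simp
qed

lemma open_overlap: "smooth_manifold M A \<Longrightarrow> c \<in> A \<Longrightarrow> c' \<in> A \<Longrightarrow> open (overlap c c')"
  unfolding overlap_def by (rule open_map_of_chart[OF _ _ chart_openin])

lemma overlap_iff:
  "smooth_manifold M A \<Longrightarrow> c \<in> A \<Longrightarrow> x \<in> overlap c c' \<longleftrightarrow> x \<in> img_of c \<and> inv_chart c x \<in> dom_of c'"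
  using inv_chart_map[of M A c] map_inv_chart[of x c] by (auto simp: overlap_def img_of_def)

lemma transition_map:
  "smooth_manifold M A \<Longrightarrow> c \<in> A \<Longrightarrow> p \<in> dom_of c \<Longrightarrow> transition c c' (map_of_chart c p) = map_of_chart c' p"
  by (simp add: transition_def inv_chart_map)

lemma smooth_transition: "smooth_manifold M A \<Longrightarrow> c \<in> A \<Longrightarrow> c' \<in> A \<Longrightarrow> smooth_on (overlap c c') (transition c c')"
  by (simp add: smooth_manifold_def)

lemma dtransition_self:
  assumes "smooth_manifold M A" "c \<in> A" "x \<in> img_of c"
  shows "dtransition c c x v = v"
proof -
  have "(transition c c has_derivative (\<lambda>h. h)) (at x)"
    by (rule has_derivative_transform_within_open[OF has_derivative_ident chart_open_img[OF assms(1,2)] assms(3)])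
       (simp add: transition_def map_inv_chart)
  then show ?thesis by (simp add: frechet_derivative_eq)
qed

lemma dtransition_chain:
  assumes M: "smooth_manifold M A" and c: "c \<in> A" "c' \<in> A" "c'' \<in> A"
    and p: "p \<in> dom_of c" "p \<in> dom_of c'" "p \<in> dom_of c''"
  shows "dtransition c c'' (map_of_chart c p) v =
    dtransition c' c'' (map_of_chart c' p) (dtransition c c' (map_of_chart c p) v)"
proof -
  let ?x = "map_of_chart c p" and ?U = "map_of_chart c ` (dom_of c \<inter> (dom_of c' \<inter> dom_of c''))"
  have "(transition c c' has_derivative dtransition c c' ?x) (at ?x)"
    by (rule smooth_on_has_derivative[OF smooth_transition[OF M c(1,2)]]) (use p in \<open>auto simp: overlap_def\<close>)
  moreover have "(transition c' c'' has_derivative dtransition c' c'' (map_of_chart c' p)) (at (transition c c' ?x))"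
    using smooth_on_has_derivative[OF smooth_transition[OF M c(2,3)], of "map_of_chart c' p"] p
    by (auto simp: overlap_def transition_map[OF M c(1) p(1)])
  ultimately have "((\<lambda>x. transition c' c'' (transition c c' x)) has_derivative
     (\<lambda>v. dtransition c' c'' (map_of_chart c' p) (dtransition c c' ?x v))) (at ?x)"
    by (rule has_derivative_compose)
  moreover have "open ?U" "?x \<in> ?U"
    using p by (auto intro!: open_map_of_chart[OF M c(1)] chart_openin[OF M] c)
  ultimately have "(transition c c'' has_derivative
     (\<lambda>v. dtransition c' c'' (map_of_chart c' p) (dtransition c c' ?x v))) (at ?x)"
    by (rule has_derivative_transform_within_open) (auto simp: transition_map[OF M] c)
  then show ?thesis by (simp add: frechet_derivative_eq)
qed

lemma dtransition_inverse:
  assumes "smooth_manifold M A" "c \<in> A" "c' \<in> A" "p \<in> dom_of c" "p \<in> dom_of c'"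
  shows "dtransition c c' (map_of_chart c p) (dtransition c' c (map_of_chart c' p) v) = v"
  using dtransition_chain[OF assms(1,3,2,3,5,4,5), of v] dtransition_self[OF assms(1,3), of "map_of_chart c' p" v]
    assms(5) by (simp add: img_of_def)


section \<open>The parallel flow along coordinate segments\<close>

text \<open>The endomorphism \<open>y \<mapsto> \<Gamma>(v, y)\<close> of the tangent space.\<close>

definition connection_matrix ::
    "(('m, 'n::finite) chart \<Rightarrow> real^'n \<Rightarrow> 'n \<Rightarrow> 'n \<Rightarrow> 'n \<Rightarrow> real) \<Rightarrow>
     ('m, 'n) chart \<Rightarrow> real^'n \<Rightarrow> real^'n \<Rightarrow> real^'n^'n" where
  "connection_matrix \<Gamma> c x v = (\<chi> k j. \<Sum>i\<in>UNIV. \<Gamma> c x k i j * v $ i)"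

lemma smooth_curve_segment:
  assumes M: "smooth_manifold M A" and c: "c \<in> A"
    and seg: "\<And>t. t \<in> {-e<..<e} \<Longrightarrow> x + t *\<^sub>R v \<in> img_of c"
  shows "smooth_curve M A (-e) e (\<lambda>t. inv_chart c (x + t *\<^sub>R v))"
  unfolding smooth_curve_def
proof (intro conjI ballI)
  obtain g where g: "homeomorphic_maps (subtopology M (dom_of c)) (top_of_set (img_of c)) (map_of_chart c) g"
    using chart_homeomorphic_map[OF M c] homeomorphic_map_maps by blast
  have ginv: "g z = inv_chart c z" if z: "z \<in> img_of c" for z
  proof -
    have "g (map_of_chart c (inv_chart c z)) = inv_chart c z"
      using g inv_chart_dom[OF z] chart_topspace[OF M c] unfolding homeomorphic_maps_def by blast
    then show ?thesis by (simp add: map_inv_chart[OF z])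
  qed
  have "continuous_map (top_of_set {-e<..<e}) (top_of_set (img_of c)) (\<lambda>t. x + t *\<^sub>R v)"
    using seg by (auto simp: continuous_map_in_subtopology intro!: continuous_intros)
  moreover have "continuous_map (top_of_set (img_of c)) M g"
    using g unfolding homeomorphic_maps_def continuous_map_in_subtopology by blast
  ultimately have "continuous_map (top_of_set {-e<..<e}) M (g \<circ> (\<lambda>t. x + t *\<^sub>R v))"
    by (rule continuous_map_compose)
  then show "continuous_map (top_of_set {-e<..<e}) M (\<lambda>t. inv_chart c (x + t *\<^sub>R v))"
    by (rule continuous_map_eq) (use seg ginv in auto)
next
  fix c' assume c': "c' \<in> A"
  have eq: "{t \<in> {-e<..<e}. inv_chart c (x + t *\<^sub>R v) \<in> dom_of c'} = {-e<..<e} \<inter> (\<lambda>t. x + t *\<^sub>R v) -` overlap c c'"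
    using seg by (auto simp: overlap_iff[OF M c, of _ c'])
  have "open ({-e<..<e} \<inter> (\<lambda>t. x + t *\<^sub>R v) -` overlap c c')"
    by (intro open_Int open_greaterThanLessThan open_vimage open_overlap[OF M c c'] continuous_intros)
  then have "smooth_on ({-e<..<e} \<inter> (\<lambda>t. x + t *\<^sub>R v) -` overlap c c') (\<lambda>t. transition c c' (x + t *\<^sub>R v))"
    by (intro smooth_on_affine[OF bounded_linear_scaleR_left _ _ smooth_transition[OF M c c']]) auto
  then show "smooth_on {t \<in> {-e<..<e}. inv_chart c (x + t *\<^sub>R v) \<in> dom_of c'}
     (\<lambda>t. map_of_chart c' (inv_chart c (x + t *\<^sub>R v)))"
    unfolding eq transition_def .
qed

text \<open>The transformation law of the connection coefficients turns a solution of the equation of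
  parallel transport in one chart into a parallel vector field in all charts.\<close>

lemma parallel_along_segment:
  assumes M: "smooth_manifold M A" and \<Gamma>: "covariant_derivative A \<Gamma>" and c: "c \<in> A"
    and seg: "\<And>t. t \<in> {-e<..<e} \<Longrightarrow> x + t *\<^sub>R v \<in> img_of c"
    and W: "\<And>t. t \<in> {-e<..<e} \<Longrightarrow>
      (W has_vector_derivative - (connection_matrix \<Gamma> c (x + t *\<^sub>R v) v *v W t)) (at t)"
  shows "parallel_along A \<Gamma> (-e) e (\<lambda>t. inv_chart c (x + t *\<^sub>R v))
    (\<lambda>t c'. dtransition c c' (x + t *\<^sub>R v) (W t))"
  unfolding parallel_along_def
proof (intro conjI ballI impI)
  fix t c1 c2 assume t: "t \<in> {-e<..<e}" and c12: "c1 \<in> A" "c2 \<in> A"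
    and p: "inv_chart c (x + t *\<^sub>R v) \<in> dom_of c1 \<inter> dom_of c2"
  show "dtransition c c2 (x + t *\<^sub>R v) (W t) =
    dtransition c1 c2 (map_of_chart c1 (inv_chart c (x + t *\<^sub>R v))) (dtransition c c1 (x + t *\<^sub>R v) (W t))"
    using dtransition_chain[OF M c c12, of "inv_chart c (x + t *\<^sub>R v)" "W t"] p inv_chart_dom[OF seg[OF t]]
    by (simp add: map_inv_chart[OF seg[OF t]])
next
  fix t c' assume t: "t \<in> {-e<..<e}" and c': "c' \<in> A" and p: "inv_chart c (x + t *\<^sub>R v) \<in> dom_of c'"
  let ?T = "transition c c'"
  define z where "z = x + t *\<^sub>R v"
  let ?O = "overlap c c'"
  have z: "z \<in> ?O" using p overlap_iff[OF M c] seg[OF t] by (simp add: z_def)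
  have O: "open ?O" by (rule open_overlap[OF M c c'])
  have sm: "smooth_on ?O ?T" by (rule smooth_transition[OF M c c'])
  have line: "((\<lambda>t. x + t *\<^sub>R v) has_vector_derivative v) (at t)"
    by (auto intro!: derivative_eq_intros simp: has_vector_derivative_def)
  have dT: "(?T has_derivative dtransition c c' y) (at y)" if "y \<in> ?O" for y
    by (rule smooth_on_has_derivative[OF sm that])
  have lin: "bounded_linear (dtransition c c' y)" if "y \<in> ?O" for y
    using dT[OF that] has_derivative_bounded_linear by blast
  define J where "J = (\<lambda>j y. dtransition c c' y (axis j 1))"
  have expand: "dtransition c c' y w = (\<Sum>j\<in>UNIV. w $ j *\<^sub>R J j y)" if "y \<in> ?O" for y w
  proof -
    have "dtransition c c' y (\<Sum>j\<in>UNIV. w $ j *\<^sub>R axis j 1) = (\<Sum>j\<in>UNIV. w $ j *\<^sub>R J j y)"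
      using lin[OF that] by (simp add: J_def linear_sum linear_simps(5) bounded_linear.linear)
    then show ?thesis using basis_expansion[of w] by (simp add: scalar_mult_eq_scaleR)
  qed
  have dJ: "(J j has_derivative frechet_derivative (J j) (at z)) (at z)" for j
    unfolding J_def by (rule smooth_on_has_derivative[OF smooth_on_frechet_derivative[OF sm] z])
  have p1: "partial j (\<lambda>x. ?T x $ k) y = J j y $ k" if "y \<in> ?O" for j k y
    unfolding J_def by (rule partial_eq[OF bounded_linear.has_derivative[OF bounded_linear_vec_nth dT[OF that]]])
  have p2: "partial i (\<lambda>x. partial j (\<lambda>x. ?T x $ k) x) z = frechet_derivative (J j) (at z) (axis i 1) $ k" for i j k
  proof (rule partial_eq)
    show "((\<lambda>x. partial j (\<lambda>x. ?T x $ k) x) has_derivative (\<lambda>h. frechet_derivative (J j) (at z) h $ k)) (at z)"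
      by (rule has_derivative_transform_within_open[OF
            bounded_linear.has_derivative[OF bounded_linear_vec_nth dJ] O z]) (simp add: p1)
  qed
  have dJv: "frechet_derivative (J j) (at z) v = (\<Sum>i\<in>UNIV. v $ i *\<^sub>R frechet_derivative (J j) (at z) (axis i 1))" for j
  proof -
    have "linear (frechet_derivative (J j) (at z))"
      using dJ has_derivative_bounded_linear bounded_linear.linear by blast
    then have "frechet_derivative (J j) (at z) (\<Sum>i\<in>UNIV. v $ i *\<^sub>R axis i 1) =
       (\<Sum>i\<in>UNIV. v $ i *\<^sub>R frechet_derivative (J j) (at z) (axis i 1))"
      by (simp add: linear_sum linear_scale)
    then show ?thesis using basis_expansion[of v] by (simp add: scalar_mult_eq_scaleR)
  qed
  define W' where "W' = - (connection_matrix \<Gamma> c z v *v W t)"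
  have Wt: "(W has_derivative (\<lambda>h. h *\<^sub>R W')) (at t)"
    using W[OF t] by (simp add: W'_def z_def has_vector_derivative_def)
  have line': "((\<lambda>t. x + t *\<^sub>R v) has_derivative (\<lambda>h. h *\<^sub>R v)) (at t)"
    using line by (simp add: has_vector_derivative_def)
  have J_line: "((\<lambda>s. J j (x + s *\<^sub>R v)) has_derivative (\<lambda>h. h *\<^sub>R frechet_derivative (J j) (at z) v)) (at t)" for j
    using has_derivative_compose[OF line' dJ[of j, unfolded z_def]]
      linear_simps(5)[OF has_derivative_bounded_linear[OF dJ[of j]]] by (simp add: z_def)
  have "((\<lambda>s. \<Sum>j\<in>UNIV. W s $ j *\<^sub>R J j (x + s *\<^sub>R v)) has_derivative
     (\<lambda>h. \<Sum>j\<in>UNIV. W t $ j *\<^sub>R (h *\<^sub>R frechet_derivative (J j) (at z) v) + (h *\<^sub>R W') $ j *\<^sub>R J j z)) (at t)"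
    unfolding z_def
    by (intro has_derivative_sum has_derivative_scaleR bounded_linear.has_derivative[OF bounded_linear_vec_nth Wt]
        J_line[unfolded z_def])
  then have V1: "((\<lambda>s. \<Sum>j\<in>UNIV. W s $ j *\<^sub>R J j (x + s *\<^sub>R v)) has_vector_derivative
     (\<Sum>j\<in>UNIV. W t $ j *\<^sub>R frechet_derivative (J j) (at z) v + W' $ j *\<^sub>R J j z)) (at t)"
    by (simp add: has_vector_derivative_def scaleR_sum_right scaleR_add_right mult.commute)
  have V: "((\<lambda>s. dtransition c c' (x + s *\<^sub>R v) (W s)) has_vector_derivative
     (\<Sum>j\<in>UNIV. W t $ j *\<^sub>R frechet_derivative (J j) (at z) v + W' $ j *\<^sub>R J j z)) (at t)"
  proof (rule has_vector_derivative_transform_within_open[OF V1])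
    show "open ((\<lambda>t. x + t *\<^sub>R v) -` ?O)" by (intro open_vimage O continuous_intros)
    show "t \<in> (\<lambda>t. x + t *\<^sub>R v) -` ?O" using z by (simp add: z_def)
  qed (simp add: expand)
  have vel: "vector_derivative (\<lambda>t. map_of_chart c' (inv_chart c (x + t *\<^sub>R v))) (at t) = dtransition c c' z v"
  proof -
    have "((\<lambda>t. ?T (x + t *\<^sub>R v)) has_vector_derivative dtransition c c' z v) (at t)"
      using has_derivative_compose[OF line' dT[OF z, unfolded z_def]] linear_simps(5)[OF lin[OF z]]
      by (simp add: z_def has_vector_derivative_def)
    then show ?thesis unfolding transition_def by (rule vector_derivative_at)
  qed
  have law: "(\<Sum>p\<in>UNIV. \<Gamma> c z p i j * J p z $ k) = frechet_derivative (J j) (at z) (axis i 1) $ k +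
        (\<Sum>p\<in>UNIV. \<Sum>q\<in>UNIV. \<Gamma> c' (?T z) k p q * J i z $ p * J j z $ q)" for i j k
  proof -
    have "(\<Sum>p\<in>UNIV. \<Gamma> c z p i j * partial p (\<lambda>x. ?T x $ k) z) =
        partial i (\<lambda>x. partial j (\<lambda>x. ?T x $ k) x) z +
        (\<Sum>p\<in>UNIV. \<Sum>q\<in>UNIV. \<Gamma> c' (?T z) k p q *
           partial i (\<lambda>x. ?T x $ p) z * partial j (\<lambda>x. ?T x $ q) z)"
      using \<Gamma> c c' z unfolding covariant_derivative_def by blast
    then show ?thesis by (simp only: p1[OF z] p2)
  qed
  have main: "(\<Sum>j\<in>UNIV. W t $ j *\<^sub>R frechet_derivative (J j) (at z) v + W' $ j *\<^sub>R J j z) $ k =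
     - (\<Sum>p\<in>UNIV. \<Sum>q\<in>UNIV. \<Gamma> c' (?T z) k p q * dtransition c c' z v $ p * dtransition c c' z (W t) $ q)" for k
  proof -
    have "(\<Sum>j\<in>UNIV. W' $ j * J j z $ k) = - (\<Sum>p\<in>UNIV. (\<Sum>j\<in>UNIV. (\<Sum>i\<in>UNIV. \<Gamma> c z p i j * v $ i) * W t $ j) * J p z $ k)"
      by (simp add: W'_def connection_matrix_def matrix_vector_mult_def sum_negf)
    also have "\<dots> = - (\<Sum>p\<in>UNIV. \<Sum>j\<in>UNIV. \<Sum>i\<in>UNIV. v $ i * W t $ j * (\<Gamma> c z p i j * J p z $ k))"
      by (simp add: sum_distrib_left sum_distrib_right mult_ac)
    also have "(\<Sum>p\<in>UNIV. \<Sum>j\<in>UNIV. \<Sum>i\<in>UNIV. v $ i * W t $ j * (\<Gamma> c z p i j * J p z $ k))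
       = (\<Sum>j\<in>UNIV. \<Sum>p\<in>UNIV. \<Sum>i\<in>UNIV. v $ i * W t $ j * (\<Gamma> c z p i j * J p z $ k))"
      by (rule sum.swap)
    also have "\<dots> = (\<Sum>j\<in>UNIV. \<Sum>i\<in>UNIV. \<Sum>p\<in>UNIV. v $ i * W t $ j * (\<Gamma> c z p i j * J p z $ k))"
      by (rule sum.cong[OF refl], rule sum.swap)
    also have "\<dots> = (\<Sum>j\<in>UNIV. \<Sum>i\<in>UNIV. v $ i * W t $ j * (\<Sum>p\<in>UNIV. \<Gamma> c z p i j * J p z $ k))"
      by (simp add: sum_distrib_left)
    finally have 1: "(\<Sum>j\<in>UNIV. W' $ j * J j z $ k) =
      - (\<Sum>j\<in>UNIV. \<Sum>i\<in>UNIV. v $ i * W t $ j * (\<Sum>p\<in>UNIV. \<Gamma> c z p i j * J p z $ k))" .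
    have 2: "(\<Sum>j\<in>UNIV. W t $ j * frechet_derivative (J j) (at z) v $ k)
      = (\<Sum>j\<in>UNIV. \<Sum>i\<in>UNIV. v $ i * W t $ j * frechet_derivative (J j) (at z) (axis i 1) $ k)"
      by (simp add: dJv sum_distrib_left mult_ac)
    have 3: "(\<Sum>p\<in>UNIV. \<Sum>q\<in>UNIV. \<Gamma> c' (?T z) k p q * dtransition c c' z v $ p * dtransition c c' z (W t) $ q)
      = (\<Sum>j\<in>UNIV. \<Sum>i\<in>UNIV. v $ i * W t $ j * (\<Sum>p\<in>UNIV. \<Sum>q\<in>UNIV. \<Gamma> c' (?T z) k p q * J i z $ p * J j z $ q))"
    proof -
      have "(\<Sum>p\<in>UNIV. \<Sum>q\<in>UNIV. \<Gamma> c' (?T z) k p q * dtransition c c' z v $ p * dtransition c c' z (W t) $ q)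
        = (\<Sum>p\<in>UNIV. \<Sum>q\<in>UNIV. \<Sum>i\<in>UNIV. \<Sum>j\<in>UNIV. v $ i * W t $ j * (\<Gamma> c' (?T z) k p q * J i z $ p * J j z $ q))"
        by (simp add: expand[OF z] sum_distrib_left sum_distrib_right mult_ac)
      also have "\<dots> = (\<Sum>p\<in>UNIV. \<Sum>q\<in>UNIV. \<Sum>j\<in>UNIV. \<Sum>i\<in>UNIV. v $ i * W t $ j * (\<Gamma> c' (?T z) k p q * J i z $ p * J j z $ q))"
        by (rule sum.cong[OF refl], rule sum.cong[OF refl], rule sum.swap)
      also have "\<dots> = (\<Sum>p\<in>UNIV. \<Sum>j\<in>UNIV. \<Sum>q\<in>UNIV. \<Sum>i\<in>UNIV. v $ i * W t $ j * (\<Gamma> c' (?T z) k p q * J i z $ p * J j z $ q))"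
        by (rule sum.cong[OF refl], rule sum.swap)
      also have "\<dots> = (\<Sum>j\<in>UNIV. \<Sum>p\<in>UNIV. \<Sum>q\<in>UNIV. \<Sum>i\<in>UNIV. v $ i * W t $ j * (\<Gamma> c' (?T z) k p q * J i z $ p * J j z $ q))"
        by (rule sum.swap)
      also have "\<dots> = (\<Sum>j\<in>UNIV. \<Sum>p\<in>UNIV. \<Sum>i\<in>UNIV. \<Sum>q\<in>UNIV. v $ i * W t $ j * (\<Gamma> c' (?T z) k p q * J i z $ p * J j z $ q))"
        by (rule sum.cong[OF refl], rule sum.cong[OF refl], rule sum.swap)
      also have "\<dots> = (\<Sum>j\<in>UNIV. \<Sum>i\<in>UNIV. \<Sum>p\<in>UNIV. \<Sum>q\<in>UNIV. v $ i * W t $ j * (\<Gamma> c' (?T z) k p q * J i z $ p * J j z $ q))"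
        by (rule sum.cong[OF refl], rule sum.swap)
      finally show ?thesis by (simp add: sum_distrib_left)
    qed
    show ?thesis
      unfolding 3 by (simp add: sum.distrib 1 2 law distrib_left)
  qed
  show "((\<lambda>t. dtransition c c' (x + t *\<^sub>R v) (W t)) has_vector_derivative
    (\<chi> k. - (\<Sum>i\<in>UNIV. \<Sum>j\<in>UNIV. \<Gamma> c' (map_of_chart c' (inv_chart c (x + t *\<^sub>R v))) k i j *
      vector_derivative (\<lambda>t. map_of_chart c' (inv_chart c (x + t *\<^sub>R v))) (at t) $ i *
      dtransition c c' (x + t *\<^sub>R v) (W t) $ j))) (at t)"
  proof -
    have "(\<chi> k. - (\<Sum>i\<in>UNIV. \<Sum>j\<in>UNIV. \<Gamma> c' (map_of_chart c' (inv_chart c (x + t *\<^sub>R v))) k i j *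
      vector_derivative (\<lambda>t. map_of_chart c' (inv_chart c (x + t *\<^sub>R v))) (at t) $ i *
      dtransition c c' (x + t *\<^sub>R v) (W t) $ j)) =
      (\<Sum>j\<in>UNIV. W t $ j *\<^sub>R frechet_derivative (J j) (at z) v + W' $ j *\<^sub>R J j z)"
      unfolding vel by (simp only: vec_eq_iff vec_lambda_beta main) (simp add: z_def transition_def)
    then show ?thesis using V by simp
  qed
qed

text \<open>Parallel translation along a coordinate segment, as a differentiable family of matrices. This is
  the only place where the preservation of \<open>F\<close> by parallel translations enters.\<close>

lemma parallel_flow:
  assumes M: "smooth_manifold M A" and \<Gamma>: "covariant_derivative A \<Gamma>"
    and F: "parallel_translations_preserve M A \<Gamma> F" and c: "c \<in> A" and x: "x \<in> img_of c"
  obtains e \<Phi> where "e > 0" "\<Phi> 0 = mat 1"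
    "\<And>k j. ((\<lambda>t. \<Phi> t $ k $ j) has_real_derivative - (connection_matrix \<Gamma> c x v $ k $ j)) (at 0)"
    "\<And>t y. t \<in> {-e<..<e} \<Longrightarrow> F c (x + t *\<^sub>R v) (\<Phi> t *v y) = F c x y"
proof -
  have "isCont (\<lambda>t. x + t *\<^sub>R v) 0" by (intro continuous_intros)
  then have "\<forall>\<^sub>F t in at 0. x + t *\<^sub>R v \<in> img_of c"
    using topological_tendstoD[OF _ chart_open_img[OF M c], of "\<lambda>t. x + t *\<^sub>R v" x "at 0"] x
    by (simp add: isCont_def)
  then obtain d0 where d0: "d0 > 0" "\<And>t. t \<noteq> 0 \<Longrightarrow> dist t 0 < d0 \<Longrightarrow> x + t *\<^sub>R v \<in> img_of c"
    unfolding eventually_at by auto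
  define d where "d = d0 / 2"
  have d: "d > 0" "\<And>t. t \<in> {-d..d} \<Longrightarrow> x + t *\<^sub>R v \<in> img_of c"
  proof -
    show "d > 0" using d0 by (simp add: d_def)
    show "x + t *\<^sub>R v \<in> img_of c" if "t \<in> {-d..d}" for t
    proof (cases "t = 0")
      case False
      then show ?thesis using that d0 by (auto simp: d_def dist_real_def)
    qed (use x in simp)
  qed
  let ?N = "\<lambda>t. - connection_matrix \<Gamma> c (x + t *\<^sub>R v) v"
  have sm: "smooth_on (img_of c) (\<lambda>x. \<Gamma> c x k i j)" for k i j
    using \<Gamma> c by (simp add: covariant_derivative_def)
  have "continuous_on {-d..d} (\<lambda>t. \<Gamma> c (x + t *\<^sub>R v) k i j)" for k i j
    by (rule continuous_on_compose2[OF smooth_on_continuous_on[OF sm]]) (use d in \<open>auto intro!: continuous_intros\<close>)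
  then have "continuous_on {-d..d} ?N"
    unfolding connection_matrix_def by (intro continuous_intros)
  from linear_ode_local_solution[OF d(1) this] obtain e where e: "e > 0" "e \<le> d"
    and "\<forall>y. \<exists>V. V 0 = y \<and> (\<forall>t\<in>{-e<..<e}. (V has_vector_derivative ?N t *v V t) (at t))" by blast
  then obtain V where V: "\<And>y. V y 0 = y"
    "\<And>y t. t \<in> {-e<..<e} \<Longrightarrow> (V y has_vector_derivative ?N t *v V y t) (at t)" by metis
  define \<Phi> where "\<Phi> = (\<lambda>t. \<chi> k j. V (axis j 1) t $ k)"
  have seg: "x + t *\<^sub>R v \<in> img_of c" if "t \<in> {-e<..<e}" for t using d(2) e that by auto
  have \<Phi>y: "\<Phi> t *v y = (\<Sum>j\<in>UNIV. y $ j *\<^sub>R V (axis j 1) t)" for t y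
    by (simp add: \<Phi>_def vec_eq_iff matrix_vector_mult_def mult.commute)
  have \<Phi>0: "\<Phi> 0 = mat 1" by (auto simp: \<Phi>_def vec_eq_iff V mat_def axis_def)
  have W: "((\<lambda>t. \<Phi> t *v y) has_vector_derivative - (connection_matrix \<Gamma> c (x + t *\<^sub>R v) v *v (\<Phi> t *v y))) (at t)"
    if t: "t \<in> {-e<..<e}" for t y
  proof -
    have "((\<lambda>t. \<Sum>j\<in>UNIV. y $ j *\<^sub>R V (axis j 1) t) has_vector_derivative
       (\<Sum>j\<in>UNIV. y $ j *\<^sub>R (?N t *v V (axis j 1) t))) (at t)"
      by (intro has_vector_derivative_sum)
         (use bounded_linear.has_vector_derivative[OF bounded_linear_scaleR_right V(2)[OF t]] in blast)
    also have "(\<Sum>j\<in>UNIV. y $ j *\<^sub>R (?N t *v V (axis j 1) t)) = ?N t *v (\<Phi> t *v y)"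
      by (simp add: \<Phi>y vec.sum matrix_vector_mult_scaleR)
    also have "?N t *v (\<Phi> t *v y) = - (connection_matrix \<Gamma> c (x + t *\<^sub>R v) v *v (\<Phi> t *v y))"
      by (simp add: vec_eq_iff matrix_vector_mult_def sum_negf)
    finally show ?thesis by (simp add: \<Phi>y)
  qed
  show thesis
  proof (rule that[of e \<Phi>])
    show "e > 0" "\<Phi> 0 = mat 1" by (fact e(1), fact \<Phi>0)
  next
    fix k j
    have "((\<lambda>t. V (axis j 1) t $ k) has_vector_derivative (?N 0 *v V (axis j 1) 0) $ k) (at 0)"
      by (rule bounded_linear.has_vector_derivative[OF bounded_linear_vec_nth V(2)]) (use e in simp)
    then show "((\<lambda>t. \<Phi> t $ k $ j) has_real_derivative - (connection_matrix \<Gamma> c x v $ k $ j)) (at 0)"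
      by (simp add: \<Phi>_def V(1) matrix_vector_mul_component inner_axis has_real_derivative_iff_has_vector_derivative)
  next
    fix t y assume t: "t \<in> {-e<..<e}"
    let ?\<gamma> = "\<lambda>t. inv_chart c (x + t *\<^sub>R v)" and ?V = "\<lambda>t c'. dtransition c c' (x + t *\<^sub>R v) (\<Phi> t *v y)"
    have 0: "(0::real) \<in> {-e<..<e}" using e by simp
    have "smooth_curve M A (-e) e ?\<gamma>" by (rule smooth_curve_segment[OF M c seg])
    moreover have "parallel_along A \<Gamma> (-e) e ?\<gamma> ?V" by (rule parallel_along_segment[OF M \<Gamma> c seg W])
    ultimately have "F c (map_of_chart c (?\<gamma> t)) (?V t c) = F c (map_of_chart c (?\<gamma> 0)) (?V 0 c)"
      using F t 0 c inv_chart_dom[OF seg[OF t]] inv_chart_dom[OF seg[OF 0]]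
      unfolding parallel_translations_preserve_def by blast
    then show "F c (x + t *\<^sub>R v) (\<Phi> t *v y) = F c x y"
      using x by (simp add: map_inv_chart[OF seg[OF t]] map_inv_chart dtransition_self[OF M c] seg[OF t] \<Phi>0)
  qed
qed

section \<open>Finsler metrics invariant under a linear flow\<close>

lemma homogeneous_bounds:
  fixes f :: "'a::euclidean_space \<Rightarrow> real"
  assumes cont: "continuous_on (-{0}) f" and pos: "\<And>y. y \<noteq> 0 \<Longrightarrow> f y > 0" and zero: "f 0 = 0"
    and hom: "\<And>t y. t > 0 \<Longrightarrow> f (t *\<^sub>R y) = t * f y"
  obtains m K where "m > 0" "K > 0" "\<And>y. m * norm y \<le> f y" "\<And>y. f y \<le> K * norm y"
proof -
  let ?S = "sphere (0::'a) 1"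
  have S: "compact ?S" "?S \<noteq> {}" by auto
  have cS: "continuous_on ?S f" by (rule continuous_on_subset[OF cont]) auto
  obtain p where p: "p \<in> ?S" "\<And>y. y \<in> ?S \<Longrightarrow> f p \<le> f y" using continuous_attains_inf[OF S cS] by blast
  obtain q where q: "q \<in> ?S" "\<And>y. y \<in> ?S \<Longrightarrow> f y \<le> f q" using continuous_attains_sup[OF S cS] by blast
  have unit: "f y = norm y * f (y /\<^sub>R norm y)" "y /\<^sub>R norm y \<in> ?S" if "y \<noteq> 0" for y
    using hom[of "norm y" "y /\<^sub>R norm y"] that by auto
  show thesis
  proof (rule that[of "f p" "f q"])
    show "f p > 0" "f q > 0" using p(1) q(1) by (auto intro!: pos)
    show "f p * norm y \<le> f y" for y
      using unit[of y] p(2)[of "y /\<^sub>R norm y"] by (cases "y = 0") (auto simp: zero mult.commute mult_left_mono)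
    show "f y \<le> f q * norm y" for y
      using unit[of y] q(2)[of "y /\<^sub>R norm y"] by (cases "y = 0") (auto simp: zero mult.commute mult_left_mono)
  qed
qed

text \<open>A Finsler metric seen in one chart, together with linear isometries between the tangent spaces
  along every line, of which only the derivative at the starting point is prescribed. This first
  order information determines the horizontal derivatives of the metric and of its fibre
  derivatives, as well as the derivative of the volume density.\<close>

locale flow_invariant_finsler =
  fixes F :: "('m, 'n::finite) chart \<Rightarrow> real^'n \<Rightarrow> real^'n \<Rightarrow> real" and c :: "('m, 'n) chart"
    and \<Gamma> :: "('m, 'n) chart \<Rightarrow> real^'n \<Rightarrow> 'n \<Rightarrow> 'n \<Rightarrow> 'n \<Rightarrow> real"
  assumes open_img: "open (img_of c)"
    and smooth_F: "smooth_on (img_of c \<times> (- {0})) (\<lambda>(x, y). F c x y)"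
    and F_nonneg: "x \<in> img_of c \<Longrightarrow> F c x y \<ge> 0"
    and F_eq_0: "x \<in> img_of c \<Longrightarrow> F c x y = 0 \<longleftrightarrow> y = 0"
    and F_hom: "x \<in> img_of c \<Longrightarrow> t > 0 \<Longrightarrow> F c x (t *\<^sub>R y) = t * F c x y"
    and g_pos: "x \<in> img_of c \<Longrightarrow> y \<noteq> 0 \<Longrightarrow> v \<noteq> 0 \<Longrightarrow> v \<bullet> (fundamental_tensor F c x y *v v) > 0"
    and cont_\<Gamma>: "continuous_on (img_of c) (\<lambda>x. \<Gamma> c x k i j)"
    and flow: "x \<in> img_of c \<Longrightarrow> \<exists>e \<Phi>. e > 0 \<and> \<Phi> 0 = mat 1 \<and>
      (\<forall>k j. ((\<lambda>t. \<Phi> t $ k $ j) has_real_derivative - (connection_matrix \<Gamma> c x v $ k $ j)) (at 0)) \<and>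
      (\<forall>t y. t \<in> {-e<..<e} \<longrightarrow> F c (x + t *\<^sub>R v) (\<Phi> t *v y) = F c x y)"
begin

abbreviation g where "g x y \<equiv> fundamental_tensor F c x y"
abbreviation C where "C x v \<equiv> connection_matrix \<Gamma> c x v"

definition L :: "(real^'n) \<times> (real^'n) \<Rightarrow> real" where "L z = (F c (fst z) (snd z))\<^sup>2"

definition L1 :: "'n \<Rightarrow> (real^'n) \<times> (real^'n) \<Rightarrow> real" where
  "L1 l z = frechet_derivative L (at z) (0, axis l 1)"

abbreviation slit :: "((real^'n) \<times> (real^'n)) set" where "slit \<equiv> img_of c \<times> (- {0})"

lemma open_slit: "open slit" by (intro open_Times open_img) auto

lemma smooth_L: "smooth_on slit L"
proof (rule smooth_on_cong[OF open_slit])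
  show "smooth_on slit (\<lambda>z. (case z of (x, y) \<Rightarrow> F c x y) * (case z of (x, y) \<Rightarrow> F c x y))"
    by (rule smooth_on_bounded_bilinear[OF bounded_bilinear_mult open_slit smooth_F smooth_F])
qed (auto simp: L_def power2_eq_square)

lemma smooth_L1: "smooth_on slit (L1 l)"
  unfolding L1_def by (rule smooth_on_frechet_derivative[OF smooth_L])

lemma L_has_derivative: "z \<in> slit \<Longrightarrow> (L has_derivative frechet_derivative L (at z)) (at z)"
  by (rule smooth_on_has_derivative[OF smooth_L])

lemma L1_has_derivative: "z \<in> slit \<Longrightarrow> (L1 l has_derivative frechet_derivative (L1 l) (at z)) (at z)"
  by (rule smooth_on_has_derivative[OF smooth_L1])

lemma partial_y: "x \<in> img_of c \<Longrightarrow> y \<noteq> 0 \<Longrightarrow> partial l (\<lambda>y. (F c x y)\<^sup>2) y = L1 l (x, y)"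
  using partial_eq[OF frechet_derivative_slice(1)[OF smooth_on_differentiable[OF smooth_L]], of x y l]
  by (simp add: L1_def L_def)

lemma partial_x: "x \<in> img_of c \<Longrightarrow> y \<noteq> 0 \<Longrightarrow>
    partial l (\<lambda>x. (F c x y)\<^sup>2) x = frechet_derivative L (at (x, y)) (axis l 1, 0)"
  using partial_eq[OF frechet_derivative_slice(2)[OF smooth_on_differentiable[OF smooth_L]], of x y l]
  by (simp add: L_def)

lemma partial_xy:
  assumes "x \<in> img_of c" "y \<noteq> 0"
  shows "partial k (\<lambda>x. partial l (\<lambda>y. (F c x y)\<^sup>2) y) x = frechet_derivative (L1 l) (at (x, y)) (axis k 1, 0)"
proof (rule partial_eq)
  show "((\<lambda>x. partial l (\<lambda>y. (F c x y)\<^sup>2) y) has_derivative (\<lambda>h. frechet_derivative (L1 l) (at (x, y)) (h, 0))) (at x)"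
    by (rule has_derivative_transform_within_open[OF
          frechet_derivative_slice(2)[OF smooth_on_differentiable[OF smooth_L1]] open_img assms(1)])
       (use assms in \<open>auto simp: partial_y\<close>)
qed

lemma L1_y_derivative:
  assumes "x \<in> img_of c" "y \<noteq> 0"
  shows "((\<lambda>y. L1 l (x, y)) has_derivative (\<lambda>h. frechet_derivative (L1 l) (at (x, y)) (0, h))) (at y)"
  by (rule frechet_derivative_slice(1)[OF smooth_on_differentiable[OF smooth_L1]]) (use assms in simp)

lemma g_nth:
  assumes "x \<in> img_of c" "y \<noteq> 0"
  shows "g x y $ i $ j = 1/2 * frechet_derivative (L1 i) (at (x, y)) (0, axis j 1)"
proof -
  have "((\<lambda>y. partial i (\<lambda>y. (F c x y)\<^sup>2) y) has_derivative (\<lambda>h. frechet_derivative (L1 i) (at (x, y)) (0, h))) (at y)"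
    by (rule has_derivative_transform_within_open[OF L1_y_derivative[OF assms], of "-{0}"])
       (use assms in \<open>auto simp: partial_y\<close>)
  then show ?thesis by (simp add: fundamental_tensor_def partial_eq)
qed

lemma linear_pair_expand:
  fixes f :: "(real^'n) \<times> (real^'n) \<Rightarrow> real"
  assumes "bounded_linear f"
  shows "f (0, w) = (\<Sum>j\<in>UNIV. w $ j * f (0, axis j 1))" "f (w, 0) = (\<Sum>j\<in>UNIV. w $ j * f (axis j 1, 0))"
    "f (v, w) = f (v, 0) + f (0, w)"
proof -
  interpret bounded_linear f by fact
  have *: "(\<Sum>j\<in>UNIV. w $ j *\<^sub>R axis j (1::real)) = w"
    using basis_expansion[of w] by (simp add: scalar_mult_eq_scaleR)
  have 1: "(\<Sum>j\<in>UNIV. w $ j *\<^sub>R (0, axis j 1)) = (0::real^'n, w)"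
    and 2: "(\<Sum>j\<in>UNIV. w $ j *\<^sub>R (axis j 1, 0)) = (w, 0::real^'n)"
    using * by (simp_all add: prod_eq_iff fst_sum snd_sum)
  show "f (0, w) = (\<Sum>j\<in>UNIV. w $ j * f (0, axis j 1))"
    unfolding 1[symmetric] by (simp add: sum scaleR del: scaleR_Pair)
  show "f (w, 0) = (\<Sum>j\<in>UNIV. w $ j * f (axis j 1, 0))"
    unfolding 2[symmetric] by (simp add: sum scaleR del: scaleR_Pair)
  show "f (v, w) = f (v, 0) + f (0, w)" using add[of "(v, 0)" "(0, w)"] by simp
qed

lemma bounded_linear_L: "z \<in> slit \<Longrightarrow> bounded_linear (frechet_derivative L (at z))"
  using L_has_derivative has_derivative_bounded_linear by blast

lemma bounded_linear_L1: "z \<in> slit \<Longrightarrow> bounded_linear (frechet_derivative (L1 l) (at z))"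
  using L1_has_derivative has_derivative_bounded_linear by blast

lemma dL_y: "z \<in> slit \<Longrightarrow> frechet_derivative L (at z) (0, w) = (\<Sum>m\<in>UNIV. w $ m * L1 m z)"
  unfolding L1_def by (rule linear_pair_expand(1)[OF bounded_linear_L])

lemma dL1_y:
  assumes "x \<in> img_of c" "y \<noteq> 0"
  shows "frechet_derivative (L1 l) (at (x, y)) (0, w) = 2 * (g x y *v w) $ l"
  using linear_pair_expand(1)[OF bounded_linear_L1, of "(x, y)" l w] assms
  by (simp add: g_nth matrix_vector_mult_def sum_distrib_left mult_ac)

lemma g_symmetric:
  assumes "x \<in> img_of c" "y \<noteq> 0"
  shows "g x y $ i $ j = g x y $ j $ i"
  unfolding g_nth[OF assms] L1_def
  using smooth_on_mixed_derivatives_commute[OF open_slit smooth_L, of "(x, y)" "(0, axis i 1)" "(0, axis j 1)"] assms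
  by simp

lemma g_invertible: "x \<in> img_of c \<Longrightarrow> y \<noteq> 0 \<Longrightarrow> invertible (g x y)"
  by (rule positive_definite_invertible) (rule g_pos)

definition Dg :: "real^'n \<Rightarrow> real^'n \<Rightarrow> real^'n \<Rightarrow> real^'n^'n" where
  "Dg x y h = (\<chi> i j. 1/2 * frechet_derivative (\<lambda>z. frechet_derivative (L1 i) (at z) (0, axis j 1)) (at (x, y)) (0, h))"

lemma g_has_derivative:
  assumes "x \<in> img_of c" "y \<noteq> 0"
  shows "((\<lambda>y. g x y) has_derivative Dg x y) (at y)"
proof -
  have "((\<lambda>y. \<chi> i j. 1/2 * frechet_derivative (L1 i) (at (x, y)) (0, axis j 1)) has_derivative Dg x y) (at y)"
    unfolding Dg_def
  proof (intro has_derivative_vec_lambda has_derivative_mult_right)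
    fix i j
    show "((\<lambda>y. frechet_derivative (L1 i) (at (x, y)) (0, axis j 1)) has_derivative
       (\<lambda>h. frechet_derivative (\<lambda>z. frechet_derivative (L1 i) (at z) (0, axis j 1)) (at (x, y)) (0, h))) (at y)"
      by (rule frechet_derivative_slice(1)[OF smooth_on_differentiable[OF smooth_on_frechet_derivative[OF smooth_L1]]])
         (use assms in simp)
  qed
  then show ?thesis
    by (rule has_derivative_transform_within_open[of _ _ _ _ "-{0}"]) (use assms in \<open>auto simp: vec_eq_iff g_nth\<close>)
qed

lemma Dg_symmetric:
  assumes "x \<in> img_of c" "y \<noteq> 0"
  shows "Dg x y (axis i 1) $ l $ m = Dg x y (axis m 1) $ l $ i"
  unfolding Dg_def
  using smooth_on_mixed_derivatives_commute[OF open_slit smooth_L1[of l], of "(x, y)" "(0, axis m 1)" "(0, axis i 1)"] assms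
  by simp

lemma Dg_expand:
  assumes "x \<in> img_of c" "y \<noteq> 0"
  shows "Dg x y h = (\<Sum>i\<in>UNIV. h $ i *\<^sub>R Dg x y (axis i 1))"
proof -
  have "linear (Dg x y)" using g_has_derivative[OF assms] has_derivative_bounded_linear bounded_linear.linear by blast
  then have "Dg x y (\<Sum>i\<in>UNIV. h $ i *\<^sub>R axis i 1) = (\<Sum>i\<in>UNIV. h $ i *\<^sub>R Dg x y (axis i 1))"
    by (simp add: linear_sum linear_scale)
  then show ?thesis using basis_expansion[of h] by (simp add: scalar_mult_eq_scaleR)
qed

subsection \<open>Infinitesimal invariance\<close>

lemma flow_obtain:
  assumes x: "x \<in> img_of c"
  obtains e \<Phi> where "e > 0" "\<Phi> 0 = mat 1"
    "\<And>y. ((\<lambda>t. \<Phi> t *v y) has_derivative (\<lambda>h. h *\<^sub>R (- (C x v *v y)))) (at 0)"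
    "\<And>k j. ((\<lambda>t. \<Phi> t $ k $ j) has_real_derivative - (C x v $ k $ j)) (at 0)"
    "\<And>t. t \<in> {-e<..<e} \<Longrightarrow> x + t *\<^sub>R v \<in> img_of c"
    "\<And>t y. t \<in> {-e<..<e} \<Longrightarrow> F c (x + t *\<^sub>R v) (\<Phi> t *v y) = F c x y"
    "\<And>t y. t \<in> {-e<..<e} \<Longrightarrow> y \<noteq> 0 \<Longrightarrow> \<Phi> t *v y \<noteq> 0"
proof -
  obtain e0 \<Phi> where e0: "e0 > 0" and \<Phi>: "\<Phi> 0 = mat 1"
    "\<And>k j. ((\<lambda>t. \<Phi> t $ k $ j) has_real_derivative - (C x v $ k $ j)) (at 0)"
    "\<And>t y. t \<in> {-e0<..<e0} \<Longrightarrow> F c (x + t *\<^sub>R v) (\<Phi> t *v y) = F c x y"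
    using flow[OF x, of v] by blast
  have "open ((\<lambda>t. x + t *\<^sub>R v) -` img_of c)" by (intro open_vimage open_img continuous_intros)
  moreover have "0 \<in> (\<lambda>t. x + t *\<^sub>R v) -` img_of c" using x by simp
  ultimately obtain e1 where e1: "e1 > 0" "ball 0 e1 \<subseteq> (\<lambda>t. x + t *\<^sub>R v) -` img_of c"
    by (rule openE)
  define e where "e = min e0 e1"
  have sub: "t \<in> {-e0<..<e0}" "x + t *\<^sub>R v \<in> img_of c" if "t \<in> {-e<..<e}" for t
  proof -
    show "t \<in> {-e0<..<e0}" using that by (auto simp: e_def)
    have "t \<in> ball 0 e1" using that by (auto simp: e_def dist_real_def)
    then show "x + t *\<^sub>R v \<in> img_of c" using e1(2) by auto
  qed
  show thesis
  proof (rule that[of e \<Phi>])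
    show "e > 0" using e0 e1 by (simp add: e_def)
    show "((\<lambda>t. \<Phi> t *v y) has_derivative (\<lambda>h. h *\<^sub>R (- (C x v *v y)))) (at 0)" for y
    proof -
      have "((\<lambda>t. \<chi> k. \<Sum>j\<in>UNIV. \<Phi> t $ k $ j * y $ j) has_derivative
          (\<lambda>h. \<chi> k. \<Sum>j\<in>UNIV. (- (C x v $ k $ j) * h) * y $ j)) (at 0)"
        using \<Phi>(2) unfolding has_field_derivative_def
        by (intro has_derivative_vec_lambda has_derivative_sum has_derivative_mult_left)
      moreover have "(\<lambda>h. \<chi> k. \<Sum>j\<in>UNIV. (- (C x v $ k $ j) * h) * y $ j) = (\<lambda>h. h *\<^sub>R (- (C x v *v y)))"
        by (simp add: fun_eq_iff vec_eq_iff matrix_vector_mult_def sum_distrib_left sum_negf mult_ac)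
      ultimately show ?thesis by (simp add: matrix_vector_mult_def)
    qed
    show "\<Phi> t *v y \<noteq> 0" if t: "t \<in> {-e<..<e}" and y: "y \<noteq> 0" for t y
      using \<Phi>(3)[OF sub(1)[OF t], of y] F_eq_0[OF x, of y] F_eq_0[OF sub(2)[OF t], of 0] y by metis
  qed (use \<Phi> sub in auto)
qed

lemma horizontal_derivative_L:
  assumes x: "x \<in> img_of c" and y: "y \<noteq> 0"
  shows "frechet_derivative L (at (x, y)) (v, 0) = (\<Sum>m\<in>UNIV. (C x v *v y) $ m * L1 m (x, y))"
proof -
  obtain e \<Phi> where e: "e > 0" "\<Phi> 0 = mat 1"
    and d: "\<And>y. ((\<lambda>t. \<Phi> t *v y) has_derivative (\<lambda>h. h *\<^sub>R (- (C x v *v y)))) (at 0)"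
    and dij: "\<And>k j. ((\<lambda>t. \<Phi> t $ k $ j) has_real_derivative - (C x v $ k $ j)) (at 0)"
    and img: "\<And>t. t \<in> {-e<..<e} \<Longrightarrow> x + t *\<^sub>R v \<in> img_of c"
    and inv: "\<And>t y. t \<in> {-e<..<e} \<Longrightarrow> F c (x + t *\<^sub>R v) (\<Phi> t *v y) = F c x y"
    and nz: "\<And>t y. t \<in> {-e<..<e} \<Longrightarrow> y \<noteq> 0 \<Longrightarrow> \<Phi> t *v y \<noteq> 0"
    by (rule flow_obtain[OF x, of v]) (rule that)
  have z: "(x, y) \<in> slit" using x y by simp
  have p: "((\<lambda>t. (x + t *\<^sub>R v, \<Phi> t *v y)) has_derivative (\<lambda>h. (h *\<^sub>R v, h *\<^sub>R (- (C x v *v y))))) (at 0)"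
    by (intro has_derivative_Pair d) (auto intro!: derivative_eq_intros)
  have "(L has_derivative frechet_derivative L (at (x, y))) (at (x + 0 *\<^sub>R v, \<Phi> 0 *v y))"
    using L_has_derivative[OF z] e by simp
  from has_derivative_compose[OF p this]
  have "((\<lambda>t. L (x + t *\<^sub>R v, \<Phi> t *v y)) has_derivative
      (\<lambda>h. frechet_derivative L (at (x, y)) (h *\<^sub>R v, h *\<^sub>R (- (C x v *v y))))) (at 0)" .
  moreover have "((\<lambda>t. L (x + t *\<^sub>R v, \<Phi> t *v y)) has_derivative (\<lambda>h. 0)) (at 0)"
    by (rule has_derivative_transform_within_open[OF has_derivative_const[of "L (x, y)"], of "{-e<..<e}"])
       (use e inv in \<open>auto simp: L_def\<close>)
  ultimately have "(\<lambda>h. frechet_derivative L (at (x, y)) (h *\<^sub>R v, h *\<^sub>R (- (C x v *v y)))) = (\<lambda>h. 0)"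
    by (rule has_derivative_unique)
  from fun_cong[OF this, of 1] have "frechet_derivative L (at (x, y)) (v, - (C x v *v y)) = 0" by simp
  then show ?thesis
    using linear_pair_expand(3)[OF bounded_linear_L[OF z], of v "- (C x v *v y)"] dL_y[OF z, of "- (C x v *v y)"]
    by (simp add: sum_negf)
qed

text \<open>The invariance is differentiated along the fibre first, so that the mixed derivative comes out
  in the order in which the spray coefficients contain it.\<close>

lemma horizontal_derivative_L1:
  assumes x: "x \<in> img_of c" and y: "y \<noteq> 0"
  shows "frechet_derivative (L1 l) (at (x, y)) (v, 0) =
    2 * (g x y *v (C x v *v y)) $ l + (\<Sum>m\<in>UNIV. C x v $ m $ l * L1 m (x, y))"
proof -
  obtain e \<Phi> where e: "e > 0" "\<Phi> 0 = mat 1"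
    and d: "\<And>y. ((\<lambda>t. \<Phi> t *v y) has_derivative (\<lambda>h. h *\<^sub>R (- (C x v *v y)))) (at 0)"
    and dij: "\<And>k j. ((\<lambda>t. \<Phi> t $ k $ j) has_real_derivative - (C x v $ k $ j)) (at 0)"
    and img: "\<And>t. t \<in> {-e<..<e} \<Longrightarrow> x + t *\<^sub>R v \<in> img_of c"
    and inv: "\<And>t y. t \<in> {-e<..<e} \<Longrightarrow> F c (x + t *\<^sub>R v) (\<Phi> t *v y) = F c x y"
    and nz: "\<And>t y. t \<in> {-e<..<e} \<Longrightarrow> y \<noteq> 0 \<Longrightarrow> \<Phi> t *v y \<noteq> 0"
    by (rule flow_obtain[OF x, of v]) (rule that)
  have z: "(x, y) \<in> slit" using x y by simp
  have fibre: "(\<Sum>m\<in>UNIV. \<Phi> t $ m $ l * L1 m (x + t *\<^sub>R v, \<Phi> t *v y)) = L1 l (x, y)" if t: "t \<in> {-e<..<e}" for t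
  proof -
    let ?z = "(x + t *\<^sub>R v, \<Phi> t *v y)"
    have zt: "?z \<in> slit" using img[OF t] nz[OF t y] by simp
    have "((\<lambda>y. \<Phi> t *v y) has_derivative (\<lambda>h. \<Phi> t *v h)) (at y)"
      by (rule bounded_linear_imp_has_derivative) simp
    then have "((\<lambda>y. (x + t *\<^sub>R v, \<Phi> t *v y)) has_derivative (\<lambda>h. (0, \<Phi> t *v h))) (at y)"
      by (intro has_derivative_Pair has_derivative_const)
    from has_derivative_compose[OF this L_has_derivative[OF zt]]
    have "((\<lambda>y. L (x + t *\<^sub>R v, \<Phi> t *v y)) has_derivative (\<lambda>h. frechet_derivative L (at ?z) (0, \<Phi> t *v h))) (at y)" .
    moreover have "(\<lambda>y. L (x + t *\<^sub>R v, \<Phi> t *v y)) = (\<lambda>y. L (x, y))" using inv[OF t] by (simp add: L_def)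
    moreover have "((\<lambda>y. L (x, y)) has_derivative (\<lambda>h. frechet_derivative L (at (x, y)) (0, h))) (at y)"
      by (rule frechet_derivative_slice(1)[OF smooth_on_differentiable[OF smooth_L z]])
    ultimately have "(\<lambda>h. frechet_derivative L (at ?z) (0, \<Phi> t *v h)) = (\<lambda>h. frechet_derivative L (at (x, y)) (0, h))"
      using has_derivative_unique by metis
    from fun_cong[OF this, of "axis l 1"] show ?thesis
      unfolding dL_y[OF zt] by (simp add: L1_def matrix_vector_mul_component inner_axis)
  qed
  have p: "((\<lambda>t. (x + t *\<^sub>R v, \<Phi> t *v y)) has_derivative (\<lambda>h. (h *\<^sub>R v, h *\<^sub>R (- (C x v *v y))))) (at 0)"
    by (intro has_derivative_Pair d) (auto intro!: derivative_eq_intros)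
  have L1t: "((\<lambda>t. L1 m (x + t *\<^sub>R v, \<Phi> t *v y)) has_derivative
      (\<lambda>h. frechet_derivative (L1 m) (at (x, y)) (h *\<^sub>R v, h *\<^sub>R (- (C x v *v y))))) (at 0)" for m
  proof -
    have "(L1 m has_derivative frechet_derivative (L1 m) (at (x, y))) (at (x + 0 *\<^sub>R v, \<Phi> 0 *v y))"
      using L1_has_derivative[OF z] e by simp
    from has_derivative_compose[OF p this] show ?thesis .
  qed
  have "((\<lambda>t. \<Sum>m\<in>UNIV. \<Phi> t $ m $ l * L1 m (x + t *\<^sub>R v, \<Phi> t *v y)) has_derivative
     (\<lambda>h. \<Sum>m\<in>UNIV. \<Phi> 0 $ m $ l * frechet_derivative (L1 m) (at (x, y)) (h *\<^sub>R v, h *\<^sub>R (- (C x v *v y)))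
        + (- (C x v $ m $ l) * h) * L1 m (x + 0 *\<^sub>R v, \<Phi> 0 *v y))) (at 0)"
    by (intro has_derivative_sum has_derivative_mult L1t dij[unfolded has_field_derivative_def])
  moreover have "((\<lambda>t. \<Sum>m\<in>UNIV. \<Phi> t $ m $ l * L1 m (x + t *\<^sub>R v, \<Phi> t *v y)) has_derivative (\<lambda>h. 0)) (at 0)"
    by (rule has_derivative_transform_within_open[OF has_derivative_const[of "L1 l (x, y)"], of "{-e<..<e}"])
       (use e fibre in auto)
  ultimately have "(\<lambda>h. \<Sum>m\<in>UNIV. \<Phi> 0 $ m $ l * frechet_derivative (L1 m) (at (x, y)) (h *\<^sub>R v, h *\<^sub>R (- (C x v *v y)))
        + (- (C x v $ m $ l) * h) * L1 m (x + 0 *\<^sub>R v, \<Phi> 0 *v y)) = (\<lambda>h. 0)"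
    by (rule has_derivative_unique)
  from fun_cong[OF this, of 1]
  have "(\<Sum>m\<in>UNIV. mat 1 $ m $ l * frechet_derivative (L1 m) (at (x, y)) (v, - (C x v *v y)))
     = (\<Sum>m\<in>UNIV. C x v $ m $ l * L1 m (x, y))"
    by (simp add: e(2) sum_subtractf sum.distrib sum_negf)
  moreover have "mat 1 $ m $ l = (if m = l then 1 else (0::real))" for m :: 'n by (simp add: mat_def)
  ultimately have "(\<Sum>m\<in>UNIV. (if m = l then 1 else 0) * frechet_derivative (L1 m) (at (x, y)) (v, - (C x v *v y)))
     = (\<Sum>m\<in>UNIV. C x v $ m $ l * L1 m (x, y))" by simp
  then have "frechet_derivative (L1 l) (at (x, y)) (v, - (C x v *v y)) = (\<Sum>m\<in>UNIV. C x v $ m $ l * L1 m (x, y))"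
    by (simp add: if_distrib[of "\<lambda>c. c * _"] cong: if_cong)
  then show ?thesis
    using linear_pair_expand(3)[OF bounded_linear_L1[OF z], of l v "- (C x v *v y)"]
      dL1_y[OF x y, of l "- (C x v *v y)"] by (simp add: vec.neg)
qed

subsection \<open>The volume density\<close>

lemma continuous_F:
  assumes "x \<in> img_of c"
  shows "continuous_on (-{0}) (F c x)"
proof -
  have "continuous_on (-{0}) (\<lambda>y. (x, y))" by (intro continuous_intros)
  then have "continuous_on (-{0}) (\<lambda>y. case (x, y) of (x, y) \<Rightarrow> F c x y)"
    by (rule continuous_on_compose2[OF smooth_on_continuous_on[OF smooth_F]]) (use assms in auto)
  then show ?thesis by simp
qed

lemma unit_ball_lmeasurable:
  assumes x: "x \<in> img_of c"
  shows "{y. F c x y < 1} \<in> lmeasurable" "measure lebesgue {y. F c x y < 1} > 0"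
    "measure lborel {y. F c x y < 1} = measure lebesgue {y. F c x y < 1}"
proof -
  have pos: "F c x y > 0" if "y \<noteq> 0" for y using F_nonneg[OF x, of y] F_eq_0[OF x, of y] that by linarith
  obtain m K where mK: "m > 0" "K > 0" "\<And>y. m * norm y \<le> F c x y" "\<And>y. F c x y \<le> K * norm y"
    using homogeneous_bounds[OF continuous_F[OF x] pos] F_eq_0[OF x, of 0] F_hom[OF x] by blast
  have inner: "ball 0 (1/K) \<subseteq> {y. F c x y < 1}"
  proof
    fix y :: "real^'n" assume "y \<in> ball 0 (1/K)"
    then have "K * norm y < 1" using mK(2) by (simp add: field_simps)
    then show "y \<in> {y. F c x y < 1}" using mK(4)[of y] by simp
  qed
  have "open ((-{0}) \<inter> F c x -` {..<1})"
    by (rule continuous_open_preimage[OF continuous_F[OF x]]) auto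
  moreover have "{y. F c x y < 1} = ((-{0}) \<inter> F c x -` {..<1}) \<union> ball 0 (1/K)"
    using inner F_eq_0[OF x, of 0] mK(2) by auto
  ultimately have op: "open {y. F c x y < 1}" by auto
  have "{y. F c x y < 1} \<subseteq> cball 0 (1/m)"
  proof
    fix y assume "y \<in> {y. F c x y < 1}"
    then have "m * norm y < 1" using mK(3)[of y] by simp
    then show "y \<in> cball 0 (1/m)" using mK(1) by (simp add: field_simps)
  qed
  then have bd: "bounded {y. F c x y < 1}" using bounded_cball bounded_subset by blast
  show lm: "{y. F c x y < 1} \<in> lmeasurable" by (rule lmeasurable_open[OF bd op])
  show "measure lborel {y. F c x y < 1} = measure lebesgue {y. F c x y < 1}"
    using op by (simp add: measure_completion)
  have "measure lebesgue (ball (0::real^'n) (1/K)) > 0"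
    using mK(2) content_ball_pos[of "1/K" "0::real^'n"] by (simp add: measure_completion)
  also have "measure lebesgue (ball (0::real^'n) (1/K)) \<le> measure lebesgue {y. F c x y < 1}"
    by (rule measure_mono_fmeasurable[OF inner]) (use lm in auto)
  finally show "measure lebesgue {y. F c x y < 1} > 0" .
qed

text \<open>The flow maps unit balls onto unit balls, so their volumes are related by its determinant.\<close>

lemma partial_ln_volume_density:
  assumes x: "x \<in> img_of c"
  shows "partial i (\<lambda>x. ln (volume_density F c x)) x = (\<Sum>k\<in>UNIV. \<Gamma> c x k i k)"
proof -
  let ?w = "\<lambda>x. \<chi> i. \<Sum>k\<in>UNIV. \<Gamma> c x k i k"
  have "((\<lambda>x. ln (volume_density F c x)) has_derivative (\<lambda>h. ?w x \<bullet> h)) (at x)"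
  proof (rule has_derivative_if_directional[OF open_img x])
    show "isCont ?w x"
      using cont_\<Gamma> open_img x
      by (intro continuous_on_interior[of "img_of c"] continuous_on_vec_lambda continuous_on_sum)
         (auto simp: interior_open)
    fix z v assume z: "z \<in> img_of c"
    obtain e \<Phi> where e: "e > 0" "\<Phi> 0 = mat 1"
      and d: "\<And>y. ((\<lambda>t. \<Phi> t *v y) has_derivative (\<lambda>h. h *\<^sub>R (- (C z v *v y)))) (at 0)"
      and dij: "\<And>k j. ((\<lambda>t. \<Phi> t $ k $ j) has_real_derivative - (C z v $ k $ j)) (at 0)"
      and img: "\<And>t. t \<in> {-e<..<e} \<Longrightarrow> z + t *\<^sub>R v \<in> img_of c"
      and inv: "\<And>t y. t \<in> {-e<..<e} \<Longrightarrow> F c (z + t *\<^sub>R v) (\<Phi> t *v y) = F c z y"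
      and nz: "\<And>t y. t \<in> {-e<..<e} \<Longrightarrow> y \<noteq> 0 \<Longrightarrow> \<Phi> t *v y \<noteq> 0"
      by (rule flow_obtain[OF z, of v]) (rule that)
    have det: "((\<lambda>t. det (\<Phi> t)) has_real_derivative trace (- C z v)) (at 0)"
      by (rule DERIV_det_at_mat_1[where A=\<Phi> and t=0, OF e(2)]) (use dij in simp)
    have nzdet: "det (\<Phi> t) \<noteq> 0" if "t \<in> {-e<..<e}" for t
    proof -
      have "\<exists>B. B ** \<Phi> t = mat 1"
        using nz[OF that] by (subst matrix_left_invertible_ker) blast
      then show ?thesis by (metis invertible_det_nz invertible_left_inverse)
    qed
    let ?B = "\<lambda>x. {y. F c x y < 1}" and ?b = "measure lborel (ball (0::real^'n) 1)"
    have vol: "measure lborel (?B (z + t *\<^sub>R v)) = \<bar>det (\<Phi> t)\<bar> * measure lborel (?B z)" if t: "t \<in> {-e<..<e}" for t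
    proof -
      have inver: "invertible (\<Phi> t)" using nzdet[OF t] by (simp add: invertible_det_nz)
      have "?B (z + t *\<^sub>R v) = (*v) (\<Phi> t) ` ?B z"
      proof (intro subset_antisym subsetI image_subsetI)
        fix y assume "y \<in> ?B (z + t *\<^sub>R v)"
        moreover have y: "y = \<Phi> t *v (matrix_inv (\<Phi> t) *v y)" by (simp add: matrix_inv_mult_vec[OF inver])
        ultimately have "matrix_inv (\<Phi> t) *v y \<in> ?B z" using inv[OF t, of "matrix_inv (\<Phi> t) *v y"] by simp
        then show "y \<in> (*v) (\<Phi> t) ` ?B z" using y by blast
      qed (auto simp: inv[OF t])
      then have "measure lebesgue (?B (z + t *\<^sub>R v)) = \<bar>det (\<Phi> t)\<bar> * measure lebesgue (?B z)"
        using measure_linear_image_finite[OF matrix_vector_mul_linear unit_ball_lmeasurable(1)[OF z], of "\<Phi> t"]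
        by simp
      then show ?thesis by (simp add: unit_ball_lmeasurable(3)[OF z] unit_ball_lmeasurable(3)[OF img[OF t]])
    qed
    have b: "?b > 0" using content_ball_pos[of 1 "0::real^'n"] by simp
    have Bz: "measure lborel (?B z) > 0" using unit_ball_lmeasurable(2,3)[OF z] by simp
    have "\<forall>\<^sub>F t in at 0. det (\<Phi> t) > 0"
      using DERIV_isCont[OF det] e(2) order_tendstoD(1)[of "\<lambda>t. det (\<Phi> t)" "det (\<Phi> 0)" "at 0" 0]
      by (simp add: isCont_def det_I)
    then obtain e2 where e2: "e2 > 0" "\<And>t. t \<noteq> 0 \<Longrightarrow> dist t 0 < e2 \<Longrightarrow> det (\<Phi> t) > 0"
      unfolding eventually_at by auto
    have d1: "((\<lambda>t. ln (volume_density F c z) - ln (det (\<Phi> t))) has_real_derivative - trace (- C z v)) (at 0)"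
      by (rule derivative_eq_intros det refl)+ (simp_all add: e(2) det_I det)
    have eq1: "ln (volume_density F c z) - ln (det (\<Phi> t)) = ln (volume_density F c (z + t *\<^sub>R v))"
      if t: "dist t 0 < min e e2" for t
    proof -
      have p: "det (\<Phi> t) > 0" using e2(2)[of t] t e(2) by (cases "t = 0") (auto simp: det_I)
      have "t \<in> {-e<..<e}" using t by (auto simp: dist_real_def)
      from vol[OF this] p have "volume_density F c (z + t *\<^sub>R v) = volume_density F c z / det (\<Phi> t)"
        by (simp add: volume_density_def)
      moreover have "volume_density F c z > 0" using b Bz by (simp add: volume_density_def)
      ultimately show ?thesis using p by (simp add: ln_div)
    qed
    have "((\<lambda>t. ln (volume_density F c (z + t *\<^sub>R v))) has_real_derivative - trace (- C z v)) (at 0)"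
      by (rule has_field_derivative_transform_within[OF d1, of "min e e2"]) (use e e2 eq1 in auto)
    moreover have "- trace (- C z v) = ?w z \<bullet> v"
    proof -
      have "- trace (- C z v) = (\<Sum>k\<in>UNIV. \<Sum>i\<in>UNIV. \<Gamma> c z k i k * v $ i)"
        by (simp add: trace_def connection_matrix_def sum_negf)
      also have "\<dots> = (\<Sum>i\<in>UNIV. \<Sum>k\<in>UNIV. \<Gamma> c z k i k * v $ i)" by (rule sum.swap)
      finally show ?thesis by (simp add: inner_vec_def sum_distrib_right)
    qed
    ultimately show "((\<lambda>t. ln (volume_density F c (z + t *\<^sub>R v))) has_real_derivative ?w z \<bullet> v) (at 0)" by simp
  qed
  then show ?thesis by (simp add: partial_eq inner_axis)
qed

subsection \<open>The spray and the S-curvature\<close>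

definition torsion :: "real^'n \<Rightarrow> 'n \<Rightarrow> 'n \<Rightarrow> 'n \<Rightarrow> real" where
  "torsion x k i j = \<Gamma> c x k i j - \<Gamma> c x k j i"

text \<open>Since the connection may have torsion, its geodesics need not be those of \<^term>\<open>F\<close>. The vector
  \<open>deviation\<close> is twice the difference of the spray coefficients, and \<open>theta\<close> is the same with
  the index lowered by \<^term>\<open>g\<close>.\<close>

definition theta :: "real^'n \<Rightarrow> real^'n \<Rightarrow> real^'n" where
  "theta x y = (\<chi> l. 1/2 * (\<Sum>m\<in>UNIV. \<Sum>k\<in>UNIV. torsion x m k l * y $ k * L1 m (x, y)))"

definition deviation :: "real^'n \<Rightarrow> real^'n \<Rightarrow> real^'n" where
  "deviation x y = matrix_inv (g x y) *v theta x y"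

text \<open>Inserting the horizontal derivatives leaves the geodesic spray of the connection and a torsion
  term.\<close>

lemma spray_coeff_eq:
  assumes x: "x \<in> img_of c" and y: "y \<noteq> 0"
  shows "spray_coeff F c x y i = 1/2 * ((C x y *v y) $ i + deviation x y $ i)"
proof -
  let ?z = "(x, y)"
  have z: "?z \<in> slit" using x y by simp
  have rhs: "(\<Sum>k\<in>UNIV. partial k (\<lambda>x. partial l (\<lambda>y. (F c x y)\<^sup>2) y) x * y $ k) - partial l (\<lambda>x. (F c x y)\<^sup>2) x
     = 2 * (g x y *v (C x y *v y) + theta x y) $ l" for l
  proof -
    have "(\<Sum>k\<in>UNIV. partial k (\<lambda>x. partial l (\<lambda>y. (F c x y)\<^sup>2) y) x * y $ k)
      = frechet_derivative (L1 l) (at ?z) (y, 0)"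
      unfolding linear_pair_expand(2)[OF bounded_linear_L1[OF z], of l y] partial_xy[OF x y] by (simp add: mult.commute)
    also have "\<dots> = 2 * (g x y *v (C x y *v y)) $ l + (\<Sum>m\<in>UNIV. C x y $ m $ l * L1 m ?z)"
      by (rule horizontal_derivative_L1[OF x y])
    finally have 1: "(\<Sum>k\<in>UNIV. partial k (\<lambda>x. partial l (\<lambda>y. (F c x y)\<^sup>2) y) x * y $ k) = \<dots>" .
    have 2: "partial l (\<lambda>x. (F c x y)\<^sup>2) x = (\<Sum>m\<in>UNIV. (C x (axis l 1) *v y) $ m * L1 m ?z)"
      unfolding partial_x[OF x y] by (rule horizontal_derivative_L[OF x y])
    have "C x y $ m $ l - (C x (axis l 1) *v y) $ m = (\<Sum>k\<in>UNIV. torsion x m k l * y $ k)" for m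
      by (simp add: connection_matrix_def matrix_vector_mult_def torsion_def axis_def if_distrib[of "\<lambda>c. _ * c"]
          sum_subtractf left_diff_distrib cong: if_cong)
    then have "(\<Sum>m\<in>UNIV. C x y $ m $ l * L1 m ?z) - (\<Sum>m\<in>UNIV. (C x (axis l 1) *v y) $ m * L1 m ?z) = 2 * theta x y $ l"
      by (simp add: theta_def sum_subtractf[symmetric] left_diff_distrib[symmetric] sum_distrib_right)
    then show ?thesis unfolding 1 2 by simp
  qed
  define u where "u = g x y *v (C x y *v y) + theta x y"
  have "spray_coeff F c x y i = 1/4 * (\<Sum>l\<in>UNIV. matrix_inv (g x y) $ i $ l * (2 * u $ l))"
    unfolding spray_coeff_def rhs u_def ..
  also have "\<dots> = 1/2 * (matrix_inv (g x y) *v u) $ i"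
    by (simp add: matrix_vector_mult_def sum_distrib_left mult_ac)
  also have "matrix_inv (g x y) *v u = C x y *v y + deviation x y"
    unfolding u_def by (simp add: matrix_vector_right_distrib matrix_inv_mult_vec[OF g_invertible[OF x y]] deviation_def)
  finally show ?thesis by simp
qed

lemma linear_C: "linear (C x)"
  by (rule linearI) (simp_all add: connection_matrix_def vec_eq_iff distrib_left sum.distrib sum_distrib_left mult_ac)

definition Dtheta :: "real^'n \<Rightarrow> real^'n \<Rightarrow> real^'n \<Rightarrow> real^'n" where
  "Dtheta x y h = (\<chi> l. 1/2 * (\<Sum>m\<in>UNIV. \<Sum>k\<in>UNIV.
     torsion x m k l * y $ k * (2 * (g x y *v h) $ m) + torsion x m k l * h $ k * L1 m (x, y)))"

lemma theta_has_derivative: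
  assumes x: "x \<in> img_of c" and y: "y \<noteq> 0"
  shows "(theta x has_derivative Dtheta x y) (at y)"
proof -
  have "((\<lambda>y. L1 m (x, y)) has_derivative (\<lambda>h. 2 * (g x y *v h) $ m)) (at y)" for m
    using L1_y_derivative[OF x y, of m] by (simp add: dL1_y[OF x y])
  then show ?thesis
    unfolding theta_def Dtheta_def
    by (intro has_derivative_vec_lambda has_derivative_mult_right has_derivative_sum has_derivative_mult
        bounded_linear_imp_has_derivative bounded_linear_vec_nth)
qed

lemma deviation_has_derivative:
  assumes x: "x \<in> img_of c" and y: "y \<noteq> 0"
  shows "(deviation x has_derivative (\<lambda>h. matrix_inv (g x y) *v (Dtheta x y h - Dg x y h *v deviation x y))) (at y)"
  using has_derivative_matrix_inv_vec[OF _ _ _ g_has_derivative[OF x y] theta_has_derivative[OF x y], of "-{0}"]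
    y g_invertible[OF x] unfolding deviation_def by (simp add: open_Compl)

text \<open>Expanding the divergence of the spray, the terms without a derivative of \<^term>\<open>g\<close> cancel
  against the logarithmic derivative of the volume density, by the skew symmetry of the torsion.\<close>

theorem S_curvature_eq:
  assumes x: "x \<in> img_of c" and y: "y \<noteq> 0"
  shows "S_curvature F c x y = - 1/2 * trace (matrix_inv (g x y) ** Dg x y (deviation x y))"
proof -
  let ?G = "matrix_inv (g x y)" and ?X = "deviation x y"
  let ?D = "Dtheta x y"
  have inv: "invertible (g x y)" by (rule g_invertible[OF x y])
  have Gsym: "?G $ i $ l = ?G $ l $ i" for i l
  proof -
    have "transpose (g x y) = g x y" by (simp add: vec_eq_iff transpose_def g_symmetric[OF x y])
    moreover have "transpose ?G ** transpose (g x y) = mat 1"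
      by (simp add: matrix_transpose_mul[symmetric] matrix_inv_mult(1)[OF inv])
    ultimately have "(transpose ?G ** g x y) ** ?G = ?G" by simp
    then have "transpose ?G = ?G"
      unfolding matrix_mul_assoc[symmetric] by (simp add: matrix_inv_mult(1)[OF inv])
    then have "transpose ?G $ l $ i = ?G $ l $ i" by simp
    then show ?thesis by (simp add: transpose_def)
  qed
  have dC: "((\<lambda>y. C x y *v y) has_derivative (\<lambda>h. C x y *v h + C x h *v y)) (at y)"
    by (rule bounded_bilinear.FDERIV[OF bounded_bilinear_matrix_vector_mult])
       (simp_all add: bounded_linear_imp_has_derivative linear_C linear_conv_bounded_linear[symmetric])
  have dX: "(deviation x has_derivative (\<lambda>h. ?G *v (?D h - Dg x y h *v ?X))) (at y)"
    by (rule deviation_has_derivative[OF x y])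
  have pd: "partial i (\<lambda>y. spray_coeff F c x y i) y
    = 1/2 * ((C x y *v axis i 1 + C x (axis i 1) *v y) $ i + (?G *v (?D (axis i 1) - Dg x y (axis i 1) *v ?X)) $ i)" for i
  proof (rule partial_eq)
    have "((\<lambda>y. 1/2 * ((C x y *v y) $ i + deviation x y $ i)) has_derivative
       (\<lambda>h. 1/2 * ((C x y *v h + C x h *v y) $ i + (?G *v (?D h - Dg x y h *v ?X)) $ i))) (at y)"
      by (intro has_derivative_mult_right has_derivative_add bounded_linear.has_derivative[OF bounded_linear_vec_nth] dC dX)
    then show "((\<lambda>y. spray_coeff F c x y i) has_derivative
       (\<lambda>h. 1/2 * ((C x y *v h + C x h *v y) $ i + (?G *v (?D h - Dg x y h *v ?X)) $ i))) (at y)"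
      by (rule has_derivative_transform_within_open[of _ _ _ _ "-{0}"]) (use y in \<open>auto simp: spray_coeff_eq[OF x]\<close>)
  qed
  have div: "(\<Sum>i\<in>UNIV. partial i (\<lambda>y. spray_coeff F c x y i) y) =
     1/2 * ((\<Sum>i\<in>UNIV. (C x y *v axis i 1) $ i) + (\<Sum>i\<in>UNIV. (C x (axis i 1) *v y) $ i)
       + (\<Sum>i\<in>UNIV. (?G *v ?D (axis i 1)) $ i) - (\<Sum>i\<in>UNIV. (?G *v (Dg x y (axis i 1) *v ?X)) $ i))"
    unfolding pd sum_distrib_left[symmetric]
    by (simp add: sum.distrib sum_subtractf matrix_vector_mult_diff_distrib)
  have A2: "(\<Sum>i\<in>UNIV. (C x y *v axis i 1) $ i) = (\<Sum>i\<in>UNIV. \<Sum>k\<in>UNIV. \<Gamma> c x i k i * y $ k)"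
    by (simp add: matrix_vector_mul_component inner_axis connection_matrix_def)
  have A1: "(\<Sum>i\<in>UNIV. (C x (axis i 1) *v y) $ i) = (\<Sum>i\<in>UNIV. \<Sum>k\<in>UNIV. \<Gamma> c x i i k * y $ k)"
    by (simp add: connection_matrix_def matrix_vector_mult_def axis_def if_distrib[of "\<lambda>c. _ * c"] cong: if_cong)
  have gG: "(\<Sum>i\<in>UNIV. g x y $ m $ i * ?G $ i $ l) = (if m = l then 1 else 0)" for m l
  proof -
    have "(g x y ** ?G) $ m $ l = (if m = l then 1 else 0)" by (simp add: matrix_inv_mult[OF inv] mat_def)
    then show ?thesis by (simp add: matrix_matrix_mult_def)
  qed
  have skew: "(\<Sum>i\<in>UNIV. \<Sum>l\<in>UNIV. ?G $ i $ l * torsion x m i l) = 0" for m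
  proof -
    have "(\<Sum>i\<in>UNIV. \<Sum>l\<in>UNIV. ?G $ i $ l * torsion x m i l) = (\<Sum>l\<in>UNIV. \<Sum>i\<in>UNIV. ?G $ i $ l * torsion x m i l)"
      by (rule sum.swap)
    also have "\<dots> = (\<Sum>l\<in>UNIV. \<Sum>i\<in>UNIV. - (?G $ l $ i * torsion x m l i))"
    proof (intro sum.cong refl)
      show "?G $ i $ l * torsion x m i l = - (?G $ l $ i * torsion x m l i)" for i l
        using Gsym[of i l] by (simp add: torsion_def algebra_simps)
    qed
    finally show ?thesis by (simp add: sum_negf)
  qed
  have A3: "(\<Sum>i\<in>UNIV. (?G *v ?D (axis i 1)) $ i) = (\<Sum>l\<in>UNIV. \<Sum>k\<in>UNIV. torsion x l k l * y $ k)"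
  proof -
    have "(?G *v ?D (axis i 1)) $ i =
       (\<Sum>l\<in>UNIV. \<Sum>m\<in>UNIV. \<Sum>k\<in>UNIV. torsion x m k l * y $ k * (g x y $ m $ i * ?G $ i $ l))
       + 1/2 * (\<Sum>l\<in>UNIV. \<Sum>m\<in>UNIV. ?G $ i $ l * torsion x m i l * L1 m (x, y))" for i
    proof -
      have "?D (axis i 1) $ l = (\<Sum>m\<in>UNIV. \<Sum>k\<in>UNIV. torsion x m k l * y $ k * g x y $ m $ i)
          + 1/2 * (\<Sum>m\<in>UNIV. torsion x m i l * L1 m (x, y))" for l
      proof -
        have "(\<Sum>k\<in>UNIV. torsion x m k l * axis i 1 $ k * L1 m (x, y)) = torsion x m i l * L1 m (x, y)" for m
          by (simp add: axis_def if_distrib[of "\<lambda>c. _ * c"] if_distrib[of "\<lambda>c. c * _"] cong: if_cong)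
        moreover have "(g x y *v axis i 1) $ m = g x y $ m $ i" for m
          by (simp add: matrix_vector_mul_component inner_axis)
        moreover have "(\<Sum>m\<in>UNIV. \<Sum>k\<in>UNIV. torsion x m k l * y $ k * (2 * g x y $ m $ i))
          = 2 * (\<Sum>m\<in>UNIV. \<Sum>k\<in>UNIV. torsion x m k l * y $ k * g x y $ m $ i)"
          by (simp add: sum_distrib_left mult_ac)
        ultimately show ?thesis by (simp add: Dtheta_def sum.distrib)
      qed
      then show ?thesis
        unfolding matrix_vector_mult_def[of ?G]
        by (simp add: distrib_left sum.distrib sum_distrib_left mult_ac)
    qed
    then have "(\<Sum>i\<in>UNIV. (?G *v ?D (axis i 1)) $ i) =
       (\<Sum>i\<in>UNIV. \<Sum>l\<in>UNIV. \<Sum>m\<in>UNIV. \<Sum>k\<in>UNIV. torsion x m k l * y $ k * (g x y $ m $ i * ?G $ i $ l))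
       + 1/2 * (\<Sum>i\<in>UNIV. \<Sum>l\<in>UNIV. \<Sum>m\<in>UNIV. ?G $ i $ l * torsion x m i l * L1 m (x, y))"
      by (simp add: sum.distrib sum_distrib_left)
    also have "(\<Sum>i\<in>UNIV. \<Sum>l\<in>UNIV. \<Sum>m\<in>UNIV. ?G $ i $ l * torsion x m i l * L1 m (x, y))
       = (\<Sum>m\<in>UNIV. \<Sum>i\<in>UNIV. \<Sum>l\<in>UNIV. ?G $ i $ l * torsion x m i l * L1 m (x, y))"
    proof -
      have "(\<Sum>i\<in>UNIV. \<Sum>l\<in>UNIV. \<Sum>m\<in>UNIV. f i l m) = (\<Sum>i\<in>UNIV. \<Sum>m\<in>UNIV. \<Sum>l\<in>UNIV. f i l m)"
        for f :: "'n \<Rightarrow> 'n \<Rightarrow> 'n \<Rightarrow> real"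
        by (rule sum.cong[OF refl], rule sum.swap)
      also have "(\<Sum>i\<in>UNIV. \<Sum>m\<in>UNIV. \<Sum>l\<in>UNIV. f i l m) = (\<Sum>m\<in>UNIV. \<Sum>i\<in>UNIV. \<Sum>l\<in>UNIV. f i l m)"
        for f :: "'n \<Rightarrow> 'n \<Rightarrow> 'n \<Rightarrow> real"
        by (rule sum.swap)
      finally show ?thesis .
    qed
    also have "\<dots> = 0" by (simp add: sum_distrib_right[symmetric] skew)
    also have "(\<Sum>i\<in>UNIV. \<Sum>l\<in>UNIV. \<Sum>m\<in>UNIV. \<Sum>k\<in>UNIV. torsion x m k l * y $ k * (g x y $ m $ i * ?G $ i $ l))
       = (\<Sum>l\<in>UNIV. \<Sum>m\<in>UNIV. \<Sum>k\<in>UNIV. torsion x m k l * y $ k * (\<Sum>i\<in>UNIV. g x y $ m $ i * ?G $ i $ l))"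
    proof -
      have "(\<Sum>i\<in>UNIV. \<Sum>l\<in>UNIV. \<Sum>m\<in>UNIV. \<Sum>k\<in>UNIV. f i l m k) = (\<Sum>l\<in>UNIV. \<Sum>m\<in>UNIV. \<Sum>k\<in>UNIV. \<Sum>i\<in>UNIV. f i l m k)"
        for f :: "'n \<Rightarrow> 'n \<Rightarrow> 'n \<Rightarrow> 'n \<Rightarrow> real"
      proof -
        have "(\<Sum>i\<in>UNIV. \<Sum>l\<in>UNIV. \<Sum>m\<in>UNIV. \<Sum>k\<in>UNIV. f i l m k) = (\<Sum>l\<in>UNIV. \<Sum>i\<in>UNIV. \<Sum>m\<in>UNIV. \<Sum>k\<in>UNIV. f i l m k)"
          by (rule sum.swap)
        also have "\<dots> = (\<Sum>l\<in>UNIV. \<Sum>m\<in>UNIV. \<Sum>i\<in>UNIV. \<Sum>k\<in>UNIV. f i l m k)"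
          by (rule sum.cong[OF refl], rule sum.swap)
        also have "\<dots> = (\<Sum>l\<in>UNIV. \<Sum>m\<in>UNIV. \<Sum>k\<in>UNIV. \<Sum>i\<in>UNIV. f i l m k)"
          by (rule sum.cong[OF refl], rule sum.cong[OF refl], rule sum.swap)
        finally show ?thesis .
      qed
      then show ?thesis by (simp add: sum_distrib_left)
    qed
    also have "\<dots> = (\<Sum>l\<in>UNIV. \<Sum>m\<in>UNIV. if m = l then (\<Sum>k\<in>UNIV. torsion x m k l * y $ k) else 0)"
      unfolding gG by (intro sum.cong refl) auto
    also have "\<dots> = (\<Sum>l\<in>UNIV. \<Sum>k\<in>UNIV. torsion x l k l * y $ k)" by simp
    finally show ?thesis by simp
  qed
  have A4: "(\<Sum>i\<in>UNIV. (?G *v (Dg x y (axis i 1) *v ?X)) $ i) = trace (?G ** Dg x y ?X)"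
  proof -
    have "(Dg x y (axis i 1) *v ?X) $ l = Dg x y ?X $ l $ i" for i l
      unfolding Dg_expand[OF x y, of ?X] matrix_vector_mult_def
      by (simp add: Dg_symmetric[OF x y, of i] mult.commute)
    then show ?thesis by (simp add: trace_def matrix_matrix_mult_def matrix_vector_mult_def[of ?G])
  qed
  have vol: "(\<Sum>i\<in>UNIV. y $ i * partial i (\<lambda>x. ln (volume_density F c x)) x) = (\<Sum>i\<in>UNIV. \<Sum>k\<in>UNIV. \<Gamma> c x i k i * y $ k)"
  proof -
    have "(\<Sum>i\<in>UNIV. y $ i * partial i (\<lambda>x. ln (volume_density F c x)) x) = (\<Sum>i\<in>UNIV. \<Sum>k\<in>UNIV. \<Gamma> c x k i k * y $ i)"
      by (simp add: partial_ln_volume_density[OF x] sum_distrib_left mult.commute)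
    also have "\<dots> = (\<Sum>k\<in>UNIV. \<Sum>i\<in>UNIV. \<Gamma> c x k i k * y $ i)" by (rule sum.swap)
    finally show ?thesis .
  qed
  show ?thesis
    unfolding S_curvature_def div vol A1 A2 A3 A4
    by (simp add: torsion_def left_diff_distrib sum_subtractf diff_divide_distrib)
qed

text \<open>By Jacobi's formula the trace is the logarithmic derivative of the determinant, which for an
  (alpha, beta)-norm is an explicit function of one variable.\<close>

lemma S_curvature_det:
  assumes x: "x \<in> img_of c" and y: "y \<noteq> 0"
    and D: "((\<lambda>t. det (g x (y + t *\<^sub>R deviation x y))) has_real_derivative d) (at 0)"
  shows "S_curvature F c x y = - d / (2 * det (g x y))"
proof -
  let ?X = "deviation x y"
  have line: "((\<lambda>t. y + t *\<^sub>R ?X) has_derivative (\<lambda>h. h *\<^sub>R ?X)) (at 0)"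
    by (auto intro!: derivative_eq_intros)
  have lin: "linear (Dg x y)" using g_has_derivative[OF x y] has_derivative_bounded_linear bounded_linear.linear by blast
  have "((\<lambda>y. g x y) has_derivative Dg x y) (at (y + 0 *\<^sub>R ?X))" using g_has_derivative[OF x y] by simp
  from has_derivative_compose[OF line this]
  have gt: "((\<lambda>t. g x (y + t *\<^sub>R ?X)) has_derivative (\<lambda>h. Dg x y (h *\<^sub>R ?X))) (at 0)" .
  have "((\<lambda>t. g x (y + t *\<^sub>R ?X) $ i $ j) has_real_derivative Dg x y ?X $ i $ j) (at 0)" for i j
    using bounded_linear.has_derivative[OF bounded_linear_entry[of i j] gt]
    by (simp add: has_field_derivative_def linear_scale[OF lin] mult_commute_abs)
  from DERIV_det[where A="\<lambda>t. g x (y + t *\<^sub>R ?X)" and t=0, OF _ this]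
  have "((\<lambda>t. det (g x (y + t *\<^sub>R ?X))) has_real_derivative
     det (g x y) * trace (matrix_inv (g x y) ** Dg x y ?X)) (at 0)"
    using g_invertible[OF x y] by simp
  then have "d = det (g x y) * trace (matrix_inv (g x y) ** Dg x y ?X)" using D DERIV_unique by blast
  moreover have "det (g x y) \<noteq> 0" using g_invertible[OF x y] by (simp add: invertible_det_nz)
  ultimately show ?thesis by (simp add: S_curvature_eq[OF x y])
qed

end

section \<open>The profile function of an (alpha, beta)-norm\<close>

lemma isCont_eq_0_at_0:
  fixes f :: "real \<Rightarrow> real"
  assumes "isCont f 0" "r > 0" "\<And>s. \<bar>s\<bar> < r \<Longrightarrow> s \<noteq> 0 \<Longrightarrow> f s = 0"
  shows "f 0 = 0"
proof (rule tendsto_unique[of "at 0" f])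
  show "(f \<longlongrightarrow> f 0) (at 0)" using assms(1) by (simp add: isCont_def)
  have "\<forall>\<^sub>F s in at 0. f s = 0"
    unfolding eventually_at using assms(2,3) by (auto intro!: exI[of _ r] simp: dist_real_def)
  then show "(f \<longlongrightarrow> 0) (at 0)" by (rule tendsto_eventually)
qed simp

lemma DERIV_0_interval_const:
  fixes f :: "real \<Rightarrow> real"
  assumes "\<And>s. \<bar>s\<bar> < r \<Longrightarrow> (f has_real_derivative 0) (at s)" "\<bar>s\<bar> < r"
  shows "f s = f 0"
  by (rule DERIV_isconst3[of "-r" r]) (use assms in auto)

text \<open>The norm \<open>\<alpha> \<phi>(\<beta> / \<alpha>)\<close> is Euclidean for a one-form \<open>\<beta>\<close> of length \<open>r\<close> if \<open>\<phi>\<close> satisfies this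
  condition; the type of the norm thus depends on the point only through the length.\<close>

definition quadratic_up_to :: "(real \<Rightarrow> real) \<Rightarrow> real \<Rightarrow> bool" where
  "quadratic_up_to \<phi> r \<longleftrightarrow> (\<exists>\<kappa>. \<forall>s. \<bar>s\<bar> \<le> r \<longrightarrow> (\<phi> s)\<^sup>2 = (\<phi> 0)\<^sup>2 + \<kappa> * s\<^sup>2)"

lemma quadratic_up_to_mono: "quadratic_up_to \<phi> r \<Longrightarrow> r' \<le> r \<Longrightarrow> quadratic_up_to \<phi> r'"
  unfolding quadratic_up_to_def by (meson order_trans)

lemma quadratic_coefficient_unique:
  fixes \<phi> :: "real \<Rightarrow> real"
  assumes "\<And>s. \<bar>s\<bar> \<le> r \<Longrightarrow> (\<phi> s)\<^sup>2 = (\<phi> 0)\<^sup>2 + \<kappa> * s\<^sup>2" "\<And>s. \<bar>s\<bar> \<le> r' \<Longrightarrow> (\<phi> s)\<^sup>2 = (\<phi> 0)\<^sup>2 + \<kappa>' * s\<^sup>2"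
    and "r > 0" "r' > 0"
  shows "\<kappa> = \<kappa>'"
proof -
  have m: "min r r' > 0" "\<bar>min r r'\<bar> \<le> r" "\<bar>min r r'\<bar> \<le> r'" using assms(3,4) by auto
  have "\<kappa> * (min r r')\<^sup>2 = \<kappa>' * (min r r')\<^sup>2" using assms(1)[OF m(2)] assms(2)[OF m(3)] by linarith
  then show ?thesis using m(1) by simp
qed

locale radius =
  fixes r :: real
  assumes r_pos: "0 < r"
begin

definition W where "W s = r\<^sup>2 - s\<^sup>2"

lemma W_pos: "\<bar>s\<bar> < r \<Longrightarrow> W s > 0"
  using power2_strict_mono[of s r] by (simp add: W_def)

end

locale profile = radius r for r :: real +
  fixes \<phi> \<phi>1 \<phi>2 \<phi>3 :: "real \<Rightarrow> real" and \<rho> :: real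
  assumes r_less: "r < \<rho>"
    and d1: "\<bar>s\<bar> < \<rho> \<Longrightarrow> (\<phi> has_real_derivative \<phi>1 s) (at s)"
    and d2: "\<bar>s\<bar> < \<rho> \<Longrightarrow> (\<phi>1 has_real_derivative \<phi>2 s) (at s)"
    and d3: "\<bar>s\<bar> < \<rho> \<Longrightarrow> (\<phi>2 has_real_derivative \<phi>3 s) (at s)"
    and c3: "\<bar>s\<bar> < \<rho> \<Longrightarrow> isCont \<phi>3 s"
    and \<phi>_pos: "\<bar>s\<bar> \<le> r \<Longrightarrow> \<phi> s > 0"
begin

lemmas r = r_pos r_less

text \<open>The names describe the Hessian \<open>g\<close> of half the square of \<open>\<alpha> \<phi>(\<beta> / \<alpha>)\<close> at a vector \<open>y\<close> with
  \<open>\<beta>(y) = s \<alpha>(y)\<close>: on vectors orthogonal to \<open>y\<close> and to the dual of \<open>\<beta>\<close> it is \<^term>\<open>e s\<close> times \<open>\<alpha>\<^sup>2\<close>,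
  and \<^term>\<open>(\<phi> s)\<^sup>2 * N s\<close> is its determinant on the plane that these two span, relative to an
  orthonormal basis of \<open>\<alpha>\<close>.\<close>

definition e where "e s = \<phi> s * (\<phi> s - s * \<phi>1 s)"
definition e1 where "e1 s = \<phi> s * \<phi>1 s - s * ((\<phi>1 s)\<^sup>2 + \<phi> s * \<phi>2 s)"
definition e2 where "e2 s = - s * (3 * \<phi>1 s * \<phi>2 s + \<phi> s * \<phi>3 s)"
definition N where "N s = \<phi> s * (\<phi> s - s * \<phi>1 s + W s * \<phi>2 s)"
definition N1 where "N1 s = \<phi>1 s * (\<phi> s - s * \<phi>1 s + W s * \<phi>2 s) + \<phi> s * (W s * \<phi>3 s - 3 * s * \<phi>2 s)"

text \<open>Up to the factor \<^term>\<open>\<phi> s\<close>, the derivative of half the squared norm in the direction of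
  the vector dual to the one-form.\<close>

definition E where "E s = \<phi> s * s + \<phi>1 s * W s"

text \<open>The determinant of the fundamental tensor relative to the Riemannian metric, in dimension
  \<open>m + 2\<close>, and its derivative.\<close>

definition H where "H m s = e s ^ m * ((\<phi> s)\<^sup>2 * N s)"
definition H1 where "H1 m s = real m * e s ^ (m - 1) * e1 s * ((\<phi> s)\<^sup>2 * N s)
    + e s ^ m * (2 * \<phi> s * \<phi>1 s * N s + (\<phi> s)\<^sup>2 * N1 s)"

abbreviation quadratic :: bool where "quadratic \<equiv> quadratic_up_to \<phi> r"

lemma e_derivative: "\<bar>s\<bar> < \<rho> \<Longrightarrow> (e has_real_derivative e1 s) (at s)"
  unfolding e_def[abs_def] e1_def
  by (auto intro!: derivative_eq_intros d1 d2 simp: algebra_simps power2_eq_square)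

lemma e1_derivative: "\<bar>s\<bar> < \<rho> \<Longrightarrow> (e1 has_real_derivative e2 s) (at s)"
  unfolding e1_def[abs_def] e2_def
  by (auto intro!: derivative_eq_intros d1 d2 d3 simp: algebra_simps power2_eq_square)

lemma W_derivative: "(W has_real_derivative - 2 * s) (at s)"
  unfolding W_def[abs_def] by (auto intro!: derivative_eq_intros)

lemma N_derivative: "\<bar>s\<bar> < \<rho> \<Longrightarrow> (N has_real_derivative N1 s) (at s)"
  unfolding N_def[abs_def] N1_def
  by (rule DERIV_cong, (rule DERIV_mult' DERIV_add DERIV_diff DERIV_ident W_derivative d1 d2 d3 | assumption)+)
     (simp add: algebra_simps)

lemma H_derivative: "\<bar>s\<bar> < \<rho> \<Longrightarrow> (H m has_real_derivative H1 m s) (at s)"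
  unfolding H_def[abs_def] H1_def
  by (rule DERIV_cong, (rule DERIV_mult' DERIV_power d1 e_derivative N_derivative | assumption)+)
     (simp add: algebra_simps power2_eq_square)

lemma H1_isCont: "\<bar>s\<bar> < \<rho> \<Longrightarrow> isCont (H1 m) s"
proof -
  assume s: "\<bar>s\<bar> < \<rho>"
  note c = DERIV_isCont[OF d1[OF s]] DERIV_isCont[OF d2[OF s]] DERIV_isCont[OF d3[OF s]] c3[OF s]
    DERIV_isCont[OF e_derivative[OF s]] DERIV_isCont[OF e1_derivative[OF s]]
    DERIV_isCont[OF N_derivative[OF s]] DERIV_isCont[OF W_derivative]
  show ?thesis unfolding H1_def[abs_def] N1_def by (intro continuous_intros c)
qed

lemma quadratic_if_open:
  assumes "\<And>s. \<bar>s\<bar> < r \<Longrightarrow> (\<phi> s)\<^sup>2 = (\<phi> 0)\<^sup>2 + \<kappa> * s\<^sup>2"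
  shows quadratic
  unfolding quadratic_up_to_def
proof (intro exI allI impI)
  fix s :: real assume s: "\<bar>s\<bar> \<le> r"
  let ?f = "\<lambda>s. (\<phi> s)\<^sup>2 - (\<phi> 0)\<^sup>2 - \<kappa> * s\<^sup>2"
  have cl: "closure {-r<..<r} = {-r..r}" using r by (simp add: closure_greaterThanLessThan)
  have "continuous_on {-r..r} \<phi>"
    using r by (intro continuous_at_imp_continuous_on ballI DERIV_isCont[OF d1]) auto
  then have "continuous_on (closure {-r<..<r}) ?f" unfolding cl by (intro continuous_intros)
  moreover have "?f x = 0" if "x \<in> {-r<..<r}" for x
  proof -
    have "\<bar>x\<bar> < r" using that by auto
    from assms[OF this] show ?thesis by simp
  qed
  moreover have "s \<in> closure {-r<..<r}" unfolding cl using s by auto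
  ultimately have "?f s = 0" by (rule continuous_constant_on_closure[where f="?f"])
  then show "(\<phi> s)\<^sup>2 = (\<phi> 0)\<^sup>2 + \<kappa> * s\<^sup>2" by simp
qed

text \<open>Being Euclidean is a closed condition on the length: the coefficients for smaller lengths agree,
  and the relation passes to the limit.\<close>

lemma not_quadratic_smaller:
  assumes "\<not> quadratic"
  obtains r' where "r' < r" "\<not> quadratic_up_to \<phi> r'"
proof -
  have "\<exists>r'<r. \<not> quadratic_up_to \<phi> r'"
  proof (rule ccontr)
    assume "\<not> ?thesis"
    then have q: "quadratic_up_to \<phi> r'" if "r' < r" for r' using that by blast
    obtain \<kappa> where \<kappa>: "\<And>s. \<bar>s\<bar> \<le> r / 2 \<Longrightarrow> (\<phi> s)\<^sup>2 = (\<phi> 0)\<^sup>2 + \<kappa> * s\<^sup>2"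
      using q[of "r / 2"] r unfolding quadratic_up_to_def by auto
    have "(\<phi> s)\<^sup>2 = (\<phi> 0)\<^sup>2 + \<kappa> * s\<^sup>2" if s: "\<bar>s\<bar> < r" for s
    proof -
      define r' where "r' = max \<bar>s\<bar> (r / 2)"
      obtain \<kappa>' where \<kappa>': "\<And>s. \<bar>s\<bar> \<le> r' \<Longrightarrow> (\<phi> s)\<^sup>2 = (\<phi> 0)\<^sup>2 + \<kappa>' * s\<^sup>2"
        using q[of r'] r s unfolding quadratic_up_to_def r'_def by auto
      have "\<kappa> = \<kappa>'" by (rule quadratic_coefficient_unique[of "r / 2" \<phi> \<kappa> r' \<kappa>', OF \<kappa> \<kappa>']) (use r in \<open>auto simp: r'_def\<close>)
      then show ?thesis using \<kappa>'[of s] by (simp add: r'_def)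
    qed
    then have quadratic by (rule quadratic_if_open)
    then show False using assms by blast
  qed
  then show thesis using that by blast
qed

text \<open>The relation is a linear first order differential equation for the square of \<^term>\<open>\<phi>\<close>.\<close>

lemma quadratic_if_linear_relation:
  assumes pq: "p \<noteq> 0 \<or> q \<noteq> 0"
    and rel: "\<And>s. \<bar>s\<bar> < r \<Longrightarrow> s \<noteq> 0 \<Longrightarrow> p * s * e s + q * (\<phi> s * \<phi>1 s) = 0"
  shows quadratic
proof (cases "q = 0")
  case True
  have "e 0 = 0"
  proof (rule isCont_eq_0_at_0[OF _ r(1)])
    show "isCont e 0" by (rule DERIV_isCont[OF e_derivative]) (use r in simp)
    show "e s = 0" if "\<bar>s\<bar> < r" "s \<noteq> 0" for s using rel[OF that] True pq that by simp
  qed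
  then show ?thesis using \<phi>_pos[of 0] r by (simp add: e_def)
next
  case False
  define k where "k = p / q"
  have 0: "\<phi> 0 * \<phi>1 0 = 0"
  proof -
    have "p * 0 * e 0 + q * (\<phi> 0 * \<phi>1 0) = 0"
    proof (rule isCont_eq_0_at_0[OF _ r(1) rel])
      show "isCont (\<lambda>s. p * s * e s + q * (\<phi> s * \<phi>1 s)) 0"
        by (intro continuous_intros DERIV_isCont[OF d1] DERIV_isCont[OF d2] DERIV_isCont[OF e_derivative]) (use r in auto)
    qed
    then show ?thesis using False by simp
  qed
  have ode: "\<phi> s * \<phi>1 s * (1 - k * s\<^sup>2) = - k * s * (\<phi> s)\<^sup>2" if "\<bar>s\<bar> < r" for s
  proof (cases "s = 0")
    case s: False
    have "q * (k * s * e s + \<phi> s * \<phi>1 s) = 0" using rel[OF that s] False by (simp add: k_def algebra_simps)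
    then have "k * s * e s + \<phi> s * \<phi>1 s = 0" using False by simp
    then show ?thesis by (simp add: e_def algebra_simps power2_eq_square)
  qed (use 0 in simp)
  have nz: "1 - k * s\<^sup>2 \<noteq> 0" if "\<bar>s\<bar> < r" for s
  proof
    assume z: "1 - k * s\<^sup>2 = 0"
    then have "k * s = 0" using ode[OF that] \<phi>_pos[of s] that by auto
    then show False using z by (auto simp: power2_eq_square)
  qed
  have "(\<phi> s)\<^sup>2 = (\<phi> 0)\<^sup>2 + (- k * (\<phi> 0)\<^sup>2) * s\<^sup>2" if s: "\<bar>s\<bar> < r" for s
  proof -
    have "(\<phi> s)\<^sup>2 / (1 - k * s\<^sup>2) = (\<phi> 0)\<^sup>2 / (1 - k * 0\<^sup>2)"
    proof (rule DERIV_0_interval_const[where f="\<lambda>s. (\<phi> s)\<^sup>2 / (1 - k * s\<^sup>2)", OF _ s])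
      fix s :: real assume s: "\<bar>s\<bar> < r"
      have "((\<lambda>s. (\<phi> s)\<^sup>2 / (1 - k * s\<^sup>2)) has_real_derivative
         (2 * \<phi> s * \<phi>1 s * (1 - k * s\<^sup>2) - (\<phi> s)\<^sup>2 * (- (k * (2 * s)))) / ((1 - k * s\<^sup>2) * (1 - k * s\<^sup>2))) (at s)"
        using nz[OF s] s r by (auto intro!: derivative_eq_intros d1)
      moreover have "2 * \<phi> s * \<phi>1 s * (1 - k * s\<^sup>2) - (\<phi> s)\<^sup>2 * (- (k * (2 * s))) = 0"
        using ode[OF s] by (simp add: algebra_simps)
      ultimately show "((\<lambda>s. (\<phi> s)\<^sup>2 / (1 - k * s\<^sup>2)) has_real_derivative 0) (at s)" by simp
    qed
    then show ?thesis using nz[OF s] by (simp add: field_simps)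
  qed
  then show ?thesis by (rule quadratic_if_open)
qed

text \<open>With \<open>u = \<phi>\<^sup>2\<close> one has \<open>e = u - s u' / 2\<close>, and differentiating twice gives \<open>s u''' = 0\<close>.\<close>

lemma quadratic_if_e_constant:
  assumes e1: "\<And>s. \<bar>s\<bar> < r \<Longrightarrow> e1 s = 0"
  shows quadratic
proof -
  define u2 where "u2 s = (\<phi>1 s)\<^sup>2 + \<phi> s * \<phi>2 s" for s
  define u3 where "u3 s = 3 * \<phi>1 s * \<phi>2 s + \<phi> s * \<phi>3 s" for s
  have u2': "(u2 has_real_derivative u3 s) (at s)" if "\<bar>s\<bar> < r" for s
    unfolding u2_def[abs_def] u3_def using that r
    by (auto intro!: derivative_eq_intros d1 d2 d3 simp: algebra_simps power2_eq_square)
  have e2: "e2 s = 0" if "\<bar>s\<bar> < r" for s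
  proof -
    have "((\<lambda>_. 0) has_real_derivative e2 s) (at s)"
      by (rule has_field_derivative_transform_within_open[OF e1_derivative, of _ "{-r<..<r}"])
         (use that r e1 in auto)
    then show ?thesis using DERIV_unique DERIV_const by blast
  qed
  have u3: "u3 s = 0" if "\<bar>s\<bar> < r" for s
  proof (cases "s = 0")
    case True
    have "isCont u3 0"
      unfolding u3_def[abs_def]
      by (intro continuous_intros DERIV_isCont[OF d1] DERIV_isCont[OF d2] DERIV_isCont[OF d3] c3) (use r in auto)
    then have "u3 0 = 0"
      by (rule isCont_eq_0_at_0[OF _ r(1)]) (use e2 in \<open>auto simp: e2_def u3_def\<close>)
    then show ?thesis using True by simp
  qed (use e2[OF that] in \<open>auto simp: e2_def u3_def\<close>)
  have u2: "u2 s = u2 0" if "\<bar>s\<bar> < r" for s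
    by (rule DERIV_0_interval_const[OF _ that]) (use u2' u3 in metis)
  have "(\<phi> s)\<^sup>2 = (\<phi> 0)\<^sup>2 + u2 0 * s\<^sup>2" if s: "\<bar>s\<bar> < r" for s
  proof -
    have "(\<phi> s)\<^sup>2 - u2 0 * s\<^sup>2 = (\<phi> 0)\<^sup>2 - u2 0 * 0\<^sup>2"
    proof (rule DERIV_0_interval_const[where f="\<lambda>s. (\<phi> s)\<^sup>2 - u2 0 * s\<^sup>2", OF _ s])
      fix s :: real assume s: "\<bar>s\<bar> < r"
      have "((\<lambda>s. (\<phi> s)\<^sup>2 - u2 0 * s\<^sup>2) has_real_derivative 2 * \<phi> s * \<phi>1 s - u2 0 * (2 * s)) (at s)"
        using s r by (auto intro!: derivative_eq_intros d1)
      moreover have "2 * \<phi> s * \<phi>1 s - u2 0 * (2 * s) = 0"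
      proof -
        have "\<phi> s * \<phi>1 s = s * u2 s" using e1[OF s] by (simp add: e1_def u2_def)
        then show ?thesis by (simp add: u2[OF s])
      qed
      ultimately show "((\<lambda>s. (\<phi> s)\<^sup>2 - u2 0 * s\<^sup>2) has_real_derivative 0) (at s)" by simp
    qed
    then show ?thesis by simp
  qed
  then show ?thesis by (rule quadratic_if_open)
qed

end

text \<open>The two inequalities express the strong convexity of the norm in two directions.\<close>

locale convex_profile = profile +
  assumes posE: "\<bar>s\<bar> \<le> r \<Longrightarrow> r\<^sup>2 * e s - s * W s * e1 s > 0"
    and N_pos: "\<bar>s\<bar> < r \<Longrightarrow> N s > 0"
begin

text \<open>The function \<open>e s * sqrt (W s) / s\<close> is strictly decreasing on either side of the origin and
  vanishes at the end points.\<close>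

lemma e_pos:
  assumes s: "\<bar>s\<bar> \<le> r"
  shows "e s > 0"
proof -
  let ?\<psi> = "\<lambda>s. e s * sqrt (W s) / s"
  have d: "(?\<psi> has_real_derivative - (r\<^sup>2 * e x - x * W x * e1 x) / (x\<^sup>2 * sqrt (W x))) (at x)"
    if x: "\<bar>x\<bar> < r" "x \<noteq> 0" for x
  proof -
    have W: "W x > 0" by (rule W_pos[OF x(1)])
    have e': "(e has_real_derivative e1 x) (at x)" by (rule e_derivative) (use x r in simp)
    have "((\<lambda>s. sqrt (W s)) has_real_derivative inverse (sqrt (W x)) / 2 * (- 2 * x)) (at x)"
      by (rule DERIV_chain2[OF DERIV_real_sqrt[OF W] W_derivative])
    from DERIV_divide[OF DERIV_mult'[OF e' this] DERIV_ident x(2)]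
    have "(?\<psi> has_real_derivative
       ((e x * (inverse (sqrt (W x)) / 2 * (- 2 * x)) + e1 x * sqrt (W x)) * x - e x * sqrt (W x) * 1) / (x * x)) (at x)" .
    moreover have "((e x * (inverse (sqrt (W x)) / 2 * (- 2 * x)) + e1 x * sqrt (W x)) * x - e x * sqrt (W x) * 1) / (x * x)
       = - (r\<^sup>2 * e x - x * W x * e1 x) / (x\<^sup>2 * sqrt (W x))"
    proof -
      define w where "w = sqrt (W x)"
      have w: "w > 0" "W x = w\<^sup>2" "r\<^sup>2 = w\<^sup>2 + x\<^sup>2" using W by (simp_all add: w_def W_def)
      show ?thesis unfolding w_def[symmetric] w(2,3) using w(1) x(2)
        by (simp add: field_simps power2_eq_square)
    qed
    ultimately show ?thesis by simp
  qed
  have neg: "- (r\<^sup>2 * e x - x * W x * e1 x) / (x\<^sup>2 * sqrt (W x)) < 0" if x: "\<bar>x\<bar> < r" "x \<noteq> 0" for x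
    using posE[of x] W_pos[OF x(1)] x by (intro divide_neg_pos) auto
  have dec: "?\<psi> b < ?\<psi> a" if ab: "a < b" "-r \<le> a" "b \<le> r" "0 \<notin> {a..b}" for a b
  proof -
    have "continuous_on {a..b} ?\<psi>"
    proof (intro continuous_at_imp_continuous_on ballI)
      fix x assume "x \<in> {a..b}"
      then have "\<bar>x\<bar> < \<rho>" "x \<noteq> 0" using ab r by auto
      then show "isCont ?\<psi> x"
        by (intro continuous_intros DERIV_isCont[OF e_derivative] isCont_o2[OF DERIV_isCont[OF W_derivative]]) auto
    qed
    moreover have "?\<psi> differentiable (at x)" if "a < x" "x < b" for x
      using d[of x] that ab by (auto intro!: differentiableI simp: has_field_derivative_def)
    ultimately obtain l z where z: "a < z" "z < b" "(?\<psi> has_real_derivative l) (at z)" "?\<psi> b - ?\<psi> a = (b - a) * l"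
      using MVT[OF ab(1), of ?\<psi>] by blast
    have zr: "\<bar>z\<bar> < r" "z \<noteq> 0" using z ab by auto
    have "l < 0" using DERIV_unique[OF z(3) d[OF zr]] neg[OF zr] by simp
    then have "(b - a) * l < 0" using ab(1) by (simp add: mult_pos_neg)
    then show ?thesis using z(4) by linarith
  qed
  have W0: "W r = 0" "W (-r) = 0" by (simp_all add: W_def)
  consider "s = 0 \<or> \<bar>s\<bar> = r" | "0 < s" "s < r" | "-r < s" "s < 0" using s by linarith
  then show ?thesis
  proof cases
    case 1
    then have "s * W s = 0" by (auto simp: W_def)
    then have "r\<^sup>2 * e s > 0" using posE[OF s] by auto
    then show ?thesis using r by (simp add: zero_less_mult_iff)
  next
    case 2
    then have "?\<psi> s > 0" using dec[of s r] W0 by simp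
    then show ?thesis using 2 W_pos[of s] by (simp add: zero_less_divide_iff zero_less_mult_iff)
  next
    case 3
    then have "?\<psi> s < 0" using dec[of "-r" s] W0 by simp
    then show ?thesis using 3 W_pos[of s] by (simp add: divide_less_0_iff mult_less_0_iff zero_less_mult_iff)
  qed
qed

text \<open>This is Deicke's theorem for these norms: if the determinant of the Hessian is constant, the
  norm is Euclidean. A constant determinant gives an equation for the derivative of \<^term>\<open>e\<close> by which
  \<open>W\<^sup>3 e1\<^sup>2\<close> grows away from the origin; but this function vanishes at the end points.\<close>

lemma quadratic_if_H_constant:
  assumes H1: "\<And>s. \<bar>s\<bar> < r \<Longrightarrow> H1 m s = 0"
  shows quadratic
proof (rule quadratic_if_e_constant)
  define K where "K s = (W s)^3 * (e1 s)\<^sup>2" for s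
  define K1 where "K1 s = 2 * (W s)\<^sup>2 * e1 s * (W s * e2 s - 3 * s * e1 s)" for s
  have K1: "(K has_real_derivative K1 s) (at s)" if "\<bar>s\<bar> < \<rho>" for s
    unfolding K_def[abs_def] K1_def
    by (rule DERIV_cong, (rule DERIV_mult' DERIV_power e1_derivative W_derivative that)+)
       (simp add: algebra_simps power2_eq_square power3_eq_cube)
  have sgn: "s * K1 s \<ge> 0" if s: "\<bar>s\<bar> < r" for s
  proof -
    have ep: "e s > 0" by (rule e_pos) (use s in simp)
    have pp: "\<phi> s > 0" by (rule \<phi>_pos) (use s in simp)
    let ?D = "(\<phi> s)\<^sup>2 * N s" and ?D1 = "2 * \<phi> s * \<phi>1 s * N s + (\<phi> s)\<^sup>2 * N1 s"
    have "e s * H1 m s = e s ^ m * (real m * e1 s * ?D + e s * ?D1)"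
      by (cases m) (simp_all add: H1_def algebra_simps)
    then have 1: "real m * e1 s * ?D + e s * ?D1 = 0" using H1[OF s] ep by simp
    \<comment> \<open>an identity that holds for every profile function\<close>
    have 2: "s * ?D1 = - (\<phi> s)\<^sup>2 * (W s * e2 s - 3 * s * e1 s)"
      by (simp add: N_def N1_def e2_def e1_def algebra_simps power2_eq_square)
    have "e s * (\<phi> s)\<^sup>2 * (W s * e2 s - 3 * s * e1 s) = real m * e1 s * ?D * s"
      using 1 2 by algebra
    then have "e s * (\<phi> s)\<^sup>2 * (s * K1 s) = 2 * (W s)\<^sup>2 * (s * e1 s)\<^sup>2 * real m * ?D"
      unfolding K1_def by algebra
    also have "\<dots> \<ge> 0" using N_pos[OF s] by simp
    finally have "0 \<le> e s * (\<phi> s)\<^sup>2 * (s * K1 s)" .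
    moreover have "0 < e s * (\<phi> s)\<^sup>2" using ep pp by simp
    ultimately show ?thesis by (metis mult_le_cancel_left_pos mult_zero_right)
  qed
  fix s assume s: "\<bar>s\<bar> < r"
  have Kr: "K r = 0" "K (-r) = 0" by (simp_all add: K_def W_def)
  have "K s \<le> 0"
  proof (cases "s \<ge> 0")
    case True
    obtain z where z: "s < z" "z < r" "K r - K s = (r - s) * K1 z"
      using MVT2[of s r K K1] K1 s r by force
    have "K1 z \<ge> 0" using sgn[of z] z True by (simp add: zero_le_mult_iff)
    then show ?thesis using z(2,3) Kr s by (smt (verit) mult_nonneg_nonneg)
  next
    case False
    obtain z where z: "-r < z" "z < s" "K s - K (-r) = (s - (-r)) * K1 z"
      using MVT2[of "-r" s K K1] K1 s r by force
    have "K1 z \<le> 0" using sgn[of z] z False s by (simp add: zero_le_mult_iff)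
    then show ?thesis using z Kr s by (simp add: mult_nonneg_nonpos)
  qed
  then have "(W s)^3 * (e1 s)\<^sup>2 \<le> 0" by (simp add: K_def)
  then show "e1 s = 0" using W_pos[OF s] by (simp add: mult_le_0_iff)
qed

lemma E_derivative: "\<bar>s\<bar> < \<rho> \<Longrightarrow> (E has_real_derivative \<phi> s - s * \<phi>1 s + W s * \<phi>2 s) (at s)"
  unfolding E_def[abs_def]
  by (rule DERIV_cong, (rule DERIV_mult' DERIV_add DERIV_ident W_derivative d1 d2 | assumption)+)
     (simp add: algebra_simps)

lemma E_strict_mono:
  assumes st: "-r < s" "s < t" "t < r"
  shows "E s < E t"
proof (rule DERIV_pos_imp_increasing[OF st(2)])
  fix x assume "s \<le> x" "x \<le> t"
  then have x: "\<bar>x\<bar> < r" using st by auto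
  have "\<phi> x - x * \<phi>1 x + W x * \<phi>2 x > 0"
    using N_pos[OF x] \<phi>_pos[of x] x by (simp add: N_def zero_less_mult_iff)
  moreover have "(E has_real_derivative \<phi> x - x * \<phi>1 x + W x * \<phi>2 x) (at x)"
    by (rule E_derivative) (use x r in simp)
  ultimately show "\<exists>y. (E has_real_derivative y) (at x) \<and> 0 < y" by blast
qed

text \<open>Since \<^term>\<open>E\<close> is strictly monotone, it is nonzero somewhere near any point at which \<open>H1\<close> is.\<close>

lemma not_quadratic_witness:
  assumes "\<not> quadratic"
  obtains s where "\<bar>s\<bar> < r" "H1 m s \<noteq> 0" "E s \<noteq> 0"
proof -
  obtain s0 where s0: "\<bar>s0\<bar> < r" "H1 m s0 \<noteq> 0" using assms quadratic_if_H_constant by blast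
  have "\<forall>\<^sub>F s in at s0. H1 m s \<noteq> 0"
    using H1_isCont[of s0 m] s0 r tendsto_imp_eventually_ne unfolding isCont_def by fastforce
  then obtain d where d: "d > 0" "\<And>s. s \<noteq> s0 \<Longrightarrow> dist s s0 < d \<Longrightarrow> H1 m s \<noteq> 0"
    unfolding eventually_at by auto
  define s1 where "s1 = s0 + min (d/2) ((r - s0) / 2)"
  have s1: "s0 < s1" "s1 < r" "dist s1 s0 < d" using d(1) s0(1) by (auto simp: s1_def dist_real_def min_def field_simps)
  then have "H1 m s1 \<noteq> 0" using d(2) by simp
  moreover have "E s0 < E s1" using s0 s1 by (intro E_strict_mono) auto
  moreover have "\<bar>s1\<bar> < r" using s0 s1 by auto
  ultimately show thesis using that s0 by (cases "E s0 = 0") auto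
qed

end

section \<open>The geometry of an (alpha, beta)-norm on a vector space\<close>

lemma det_scaleR: "det (k *\<^sub>R M) = k ^ CARD('n) * det M" for M :: "real^'n^'n"
proof -
  have "k *\<^sub>R M = (\<chi> i. k *s M $ i)" by (simp add: vec_eq_iff)
  then show ?thesis using det_rows_mul[of "\<lambda>_. k" "\<lambda>i. M $ i"] by simp
qed

lemma Cauchy_Schwarz_matrix_inv:
  fixes a :: "real^'n^'n"
  assumes sym: "transpose a = a" and pos: "\<And>y. y \<noteq> 0 \<Longrightarrow> y \<bullet> (a *v y) > 0"
  shows "(b \<bullet> y)\<^sup>2 \<le> (b \<bullet> (matrix_inv a *v b)) * (y \<bullet> (a *v y))"
proof (cases "y = 0")
  case False
  let ?X = "matrix_inv a *v b" and ?q = "y \<bullet> (a *v y)"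
  have aX: "a *v ?X = b" by (rule matrix_inv_mult_vec(1)[OF positive_definite_invertible[OF pos]])
  let ?z = "?X - ((b \<bullet> y) / ?q) *\<^sub>R y"
  have q: "?q > 0" by (rule pos[OF False])
  have Xy: "?X \<bullet> (a *v y) = b \<bullet> y" using inner_matrix_symmetric[OF sym, of ?X y] by (simp add: aX inner_commute)
  have "0 \<le> ?z \<bullet> (a *v ?z)" using pos[of ?z] by (cases "?z = 0") auto
  also have "?z \<bullet> (a *v ?z) = b \<bullet> ?X - (b \<bullet> y)\<^sup>2 / ?q"
    using q by (simp add: matrix_vector_mult_diff_distrib matrix_vector_mult_scaleR aX inner_diff_left inner_diff_right
        Xy inner_commute[of _ b] power2_eq_square)
  finally show ?thesis using q by (simp add: field_simps)
qed simp

locale covector_frame = radius r for r :: real +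
  fixes a :: "real^'n^'n" and b :: "real^'n"
  assumes dim: "CARD('n) \<ge> 2"
    and a_sym: "transpose a = a"
    and a_pos: "y \<noteq> 0 \<Longrightarrow> y \<bullet> (a *v y) > 0"
    and r_eq: "r\<^sup>2 = b \<bullet> (matrix_inv a *v b)"
begin

definition bs :: "real^'n" where "bs = matrix_inv a *v b"
definition al :: "real^'n \<Rightarrow> real" where "al y = sqrt (y \<bullet> (a *v y))"
definition sl :: "real^'n \<Rightarrow> real" where "sl y = (b \<bullet> y) / al y"
definition eta :: "real^'n \<Rightarrow> real^'n" where "eta y = (a *v y) /\<^sub>R al y"
definition w :: "real^'n \<Rightarrow> real^'n" where "w y = b - sl y *\<^sub>R eta y"
lemma a_inv: "invertible a" by (rule positive_definite_invertible) (rule a_pos)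

lemma a_bs: "a *v bs = b" by (simp add: bs_def matrix_inv_mult_vec[OF a_inv])

lemma a_swap: "y \<bullet> (a *v z) = z \<bullet> (a *v y)" by (rule inner_matrix_symmetric[OF a_sym])

lemma b_bs: "b \<bullet> bs = r\<^sup>2" by (simp add: r_eq bs_def)

lemma bs_a: "bs \<bullet> (a *v y) = b \<bullet> y" using a_swap[of bs y] by (simp add: a_bs inner_commute)

lemma al_pos: "y \<noteq> 0 \<Longrightarrow> al y > 0" by (simp add: al_def a_pos)

lemma al_sq: "(al y)\<^sup>2 = y \<bullet> (a *v y)"
  using a_pos[of y] by (cases "y = 0") (simp_all add: al_def)

lemma eta_y: "y \<noteq> 0 \<Longrightarrow> eta y \<bullet> y = al y"
  using al_pos[of y] al_sq[of y] by (simp add: eta_def inner_commute field_simps power2_eq_square)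

lemma w_y: "y \<noteq> 0 \<Longrightarrow> w y \<bullet> y = 0"
  using al_pos[of y] by (simp add: w_def inner_diff_left eta_y sl_def)

lemma eta_bs: "eta y \<bullet> bs = sl y"
  by (simp add: eta_def sl_def inner_commute[of "a *v y" bs] bs_a divide_inverse mult.commute)

lemma w_bs: "w y \<bullet> bs = W (sl y)"
  by (simp add: w_def W_def inner_diff_left b_bs eta_bs power2_eq_square)

lemma b_eq: "b = w y + sl y *\<^sub>R eta y" by (simp add: w_def)

lemma sl_le:
  assumes y: "y \<noteq> 0"
  shows "\<bar>sl y\<bar> \<le> r"
proof -
  have "(sl y)\<^sup>2 = (b \<bullet> y)\<^sup>2 / (al y)\<^sup>2" by (simp add: sl_def power_divide)
  also have "\<dots> \<le> r\<^sup>2"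
    using Cauchy_Schwarz_matrix_inv[OF a_sym a_pos, of b y] a_pos[OF y]
    by (simp add: al_sq r_eq[symmetric] field_simps)
  finally show ?thesis using r_pos abs_le_square_iff[of "sl y" r] by simp
qed

lemma al_has_derivative:
  assumes y: "y \<noteq> 0"
  shows "(al has_derivative (\<lambda>h. eta y \<bullet> h)) (at y)"
proof -
  have "((\<lambda>y. a *v y) has_derivative (\<lambda>h. a *v h)) (at y)" by (rule bounded_linear_imp_has_derivative) simp
  from has_derivative_inner[OF has_derivative_ident this]
  have "((\<lambda>y. y \<bullet> (a *v y)) has_derivative (\<lambda>h. y \<bullet> (a *v h) + h \<bullet> (a *v y))) (at y)" .
  from has_derivative_real_sqrt[OF a_pos[OF y] this]
  have "(al has_derivative (\<lambda>h. (y \<bullet> (a *v h) + h \<bullet> (a *v y)) * (inverse (sqrt (y \<bullet> (a *v y))) / 2))) (at y)"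
    by (simp add: al_def[abs_def] mult.commute)
  moreover have "(y \<bullet> (a *v h) + h \<bullet> (a *v y)) * (inverse (sqrt (y \<bullet> (a *v y))) / 2) = eta y \<bullet> h" for h
  proof -
    have "eta y \<bullet> h = inverse (sqrt (y \<bullet> (a *v y))) * (h \<bullet> (a *v y))"
      unfolding eta_def al_def inner_scaleR_left inner_commute[of "a *v y" h] ..
    then show ?thesis unfolding a_swap[of y h] by simp
  qed
  ultimately show ?thesis by simp
qed

lemma sl_has_derivative:
  assumes y: "y \<noteq> 0"
  shows "(sl has_derivative (\<lambda>h. (w y \<bullet> h) / al y)) (at y)"
proof -
  have al: "al y \<noteq> 0" using al_pos[OF y] by simp
  have "((\<lambda>y. (b \<bullet> y) / al y) has_derivative (\<lambda>h. - (b \<bullet> y) * (inverse (al y) * (eta y \<bullet> h) * inverse (al y)) + (b \<bullet> h) / al y)) (at y)"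
    by (rule has_derivative_divide[OF _ al_has_derivative[OF y] al]) (auto intro!: derivative_eq_intros)
  moreover have "- (b \<bullet> y) * (inverse (al y) * (eta y \<bullet> h) * inverse (al y)) + (b \<bullet> h) / al y = (w y \<bullet> h) / al y" for h
    using al by (simp add: w_def sl_def inner_diff_left field_simps)
  ultimately show ?thesis by (simp add: sl_def[abs_def])
qed

lemma has_derivative_of_sl:
  assumes y: "y \<noteq> 0" and f: "(f has_real_derivative f') (at (sl y))"
  shows "((\<lambda>y. f (sl y)) has_derivative (\<lambda>h. f' * ((w y \<bullet> h) / al y))) (at y)"
  by (rule has_derivative_compose[OF sl_has_derivative[OF y] f[unfolded has_field_derivative_def]])

subsection \<open>Vectors with a prescribed value of the one-form\<close>

definition nn :: "real^'n" where "nn = bs /\<^sub>R r"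

lemma b_nn: "b \<bullet> nn = r" using r_pos by (simp add: nn_def b_bs power2_eq_square)

lemma nn_a: "nn \<bullet> (a *v v) = (b \<bullet> v) / r" by (simp add: nn_def bs_a divide_inverse mult.commute)

text \<open>Together with \<^term>\<open>nn\<close>, such a vector is an orthonormal basis of a plane that determines the
  norm, as \<^term>\<open>ray\<close> below runs through all values of \<open>\<beta> / \<alpha>\<close>.\<close>

definition transversal :: "real^'n \<Rightarrow> bool" where
  "transversal v \<longleftrightarrow> b \<bullet> v = 0 \<and> v \<bullet> (a *v v) = 1"

lemma transversal_uminus: "transversal v \<Longrightarrow> transversal (- v)"
  by (simp add: transversal_def vec.neg)

lemma transversal_decomposition:
  obtains c v where "transversal v" "y = (b \<bullet> y / r) *\<^sub>R nn + c *\<^sub>R v"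
proof -
  define z where "z = y - (b \<bullet> y / r) *\<^sub>R nn"
  have bz: "b \<bullet> z = 0" using r_pos by (simp add: z_def inner_diff_right b_nn)
  have unit: "transversal (x /\<^sub>R al x)" "x = al x *\<^sub>R (x /\<^sub>R al x)" if "x \<noteq> 0" "b \<bullet> x = 0" for x
    using al_pos[OF that(1)] al_sq[of x] that(2)
    by (auto simp: transversal_def matrix_vector_mult_scaleR field_simps power2_eq_square)
  show thesis
  proof (cases "z = 0")
    case False
    have "y = (b \<bullet> y / r) *\<^sub>R nn + al z *\<^sub>R (z /\<^sub>R al z)" using unit(2)[OF False bz] by (simp add: z_def)
    then show thesis using that unit(1)[OF False bz] by blast
  next
    case True
    obtain x where "x \<noteq> 0" "orthogonal b x"
      using orthogonal_to_vector_exists[of b] dim by auto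
    then have "transversal (x /\<^sub>R al x)" using unit(1) by (simp add: orthogonal_def)
    moreover have "y = (b \<bullet> y / r) *\<^sub>R nn + 0 *\<^sub>R (x /\<^sub>R al x)" using True by (simp add: z_def)
    ultimately show thesis using that by blast
  qed
qed

lemma transversal_exists: "\<exists>v. transversal v"
  using transversal_decomposition[of 0] by metis

definition ray :: "real^'n \<Rightarrow> real \<Rightarrow> real^'n" where
  "ray v s = (s / r) *\<^sub>R nn + sqrt (1 - (s / r)\<^sup>2) *\<^sub>R v"

lemma ray_coeff: "\<bar>s\<bar> \<le> r \<Longrightarrow> (sqrt (1 - (s / r)\<^sup>2))\<^sup>2 = W s / r\<^sup>2"
proof -
  assume "\<bar>s\<bar> \<le> r"
  then have "s\<^sup>2 \<le> r\<^sup>2" using abs_le_square_iff[of s r] r_pos by simp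
  then have "0 \<le> 1 - (s / r)\<^sup>2" using r_pos by (simp add: power_divide)
  then show ?thesis using r_pos by (simp add: W_def power_divide diff_divide_distrib)
qed

lemma ray_b: "transversal v \<Longrightarrow> b \<bullet> ray v s = s"
  using r_pos by (simp add: ray_def inner_add_right b_nn transversal_def)

lemma ray_al:
  assumes v: "transversal v" and s: "\<bar>s\<bar> \<le> r"
  shows "al (ray v s) = 1"
proof -
  let ?c = "sqrt (1 - (s / r)\<^sup>2)"
  have vn: "v \<bullet> (a *v nn) = 0" using v a_swap[of v nn] by (simp add: nn_a transversal_def)
  have "ray v s \<bullet> (a *v ray v s) = (s / r)\<^sup>2 + ?c\<^sup>2"
    using v r_pos vn by (simp add: ray_def transversal_def inner_add_left inner_add_right matrix_vector_right_distrib
        matrix_vector_mult_scaleR nn_a b_nn power2_eq_square)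
  also have "\<dots> = 1" unfolding ray_coeff[OF s] using r_pos by (simp add: W_def power_divide field_simps)
  finally show ?thesis by (simp add: al_def)
qed

lemma ray_sl: "transversal v \<Longrightarrow> \<bar>s\<bar> \<le> r \<Longrightarrow> sl (ray v s) = s"
  by (simp add: sl_def ray_b ray_al)

lemma ray_nz: "transversal v \<Longrightarrow> \<bar>s\<bar> \<le> r \<Longrightarrow> ray v s \<noteq> 0"
  using ray_al[of v s] by (auto simp: al_def)

end

locale alpha_beta_norm = profile r \<phi> \<phi>1 \<phi>2 \<phi>3 \<rho> + covector_frame r a b
  for r \<rho> :: real and \<phi> \<phi>1 \<phi>2 \<phi>3 :: "real \<Rightarrow> real" and a :: "real^'n^'n" and b :: "real^'n"
begin

definition u2 :: "real \<Rightarrow> real" where "u2 s = (\<phi>1 s)\<^sup>2 + \<phi> s * \<phi>2 s"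

text \<open>The gradient and the Hessian of half the square of the norm.\<close>

definition grad :: "real^'n \<Rightarrow> real^'n" where
  "grad y = e (sl y) *\<^sub>R (a *v y) + (al y * (\<phi> (sl y) * \<phi>1 (sl y))) *\<^sub>R b"

definition hess :: "real^'n \<Rightarrow> real^'n^'n" where
  "hess y = e (sl y) *\<^sub>R a
     + outer (eta y) ((sl y * (\<phi> (sl y) * \<phi>1 (sl y))) *\<^sub>R eta y + (\<phi> (sl y) * \<phi>1 (sl y)) *\<^sub>R w y)
     + outer (w y) ((\<phi> (sl y) * \<phi>1 (sl y)) *\<^sub>R eta y + u2 (sl y) *\<^sub>R w y)"

text \<open>A multiple of the vector that corresponds to \<^term>\<open>w y\<close> under the Hessian.\<close>

definition dual :: "real^'n \<Rightarrow> real^'n" where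
  "dual y = bs - (E (sl y) / (\<phi> (sl y) * al y)) *\<^sub>R y"

lemma sl_less: "y \<noteq> 0 \<Longrightarrow> \<bar>sl y\<bar> < \<rho>" using sl_le r by fastforce

lemma \<phi>_sl: "y \<noteq> 0 \<Longrightarrow> \<phi> (sl y) > 0" using sl_le \<phi>_pos by blast

lemma norm_sq_has_derivative:
  assumes y: "y \<noteq> 0"
  shows "((\<lambda>y. (al y * \<phi> (sl y))\<^sup>2) has_derivative (\<lambda>h. 2 * (grad y \<bullet> h))) (at y)"
proof -
  note d = has_derivative_mult[OF al_has_derivative[OF y] has_derivative_of_sl[OF y d1[OF sl_less[OF y]]]]
  have ay: "a *v y = al y *\<^sub>R eta y" using al_pos[OF y] by (simp add: eta_def)
  show ?thesis
    unfolding power2_eq_square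
  proof (rule has_derivative_eq_rhs[OF has_derivative_mult[OF d d]], rule ext)
    fix h
    have "grad y \<bullet> h = e (sl y) * (al y * (eta y \<bullet> h)) + al y * (\<phi> (sl y) * \<phi>1 (sl y)) * (w y \<bullet> h + sl y * (eta y \<bullet> h))"
      unfolding grad_def ay by (subst (3) b_eq[of y]) (simp add: inner_add_left)
    then show "al y * \<phi> (sl y) * (al y * (\<phi>1 (sl y) * (w y \<bullet> h / al y)) + eta y \<bullet> h * \<phi> (sl y)) +
         (al y * (\<phi>1 (sl y) * (w y \<bullet> h / al y)) + eta y \<bullet> h * \<phi> (sl y)) * (al y * \<phi> (sl y)) = 2 * (grad y \<bullet> h)"
      using al_pos[OF y] by (simp add: e_def algebra_simps)
  qed
qed

lemma grad_has_derivative: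
  assumes y: "y \<noteq> 0"
  shows "(grad has_derivative (\<lambda>h. hess y *v h)) (at y)"
proof -
  note s = sl_less[OF y]
  have ay: "((\<lambda>y. a *v y) has_derivative (\<lambda>h. a *v h)) (at y)" by (rule bounded_linear_imp_has_derivative) simp
  have dpp: "((\<lambda>s. \<phi> s * \<phi>1 s) has_real_derivative u2 (sl y)) (at (sl y))"
    unfolding u2_def by (rule DERIV_cong[OF DERIV_mult'[OF d1[OF s] d2[OF s]]]) (simp add: power2_eq_square)
  have 1: "a *v y = al y *\<^sub>R eta y" using al_pos[OF y] by (simp add: eta_def)
  have 2: "e1 (sl y) = \<phi> (sl y) * \<phi>1 (sl y) - sl y * u2 (sl y)" by (simp add: e1_def u2_def)
  have al: "al y \<noteq> 0" using al_pos[OF y] by simp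
  show ?thesis
    unfolding grad_def[abs_def]
  proof (rule has_derivative_eq_rhs[OF has_derivative_add[OF
          has_derivative_scaleR[OF has_derivative_of_sl[OF y e_derivative[OF s]] ay]
          has_derivative_scaleR_left[OF has_derivative_mult[OF al_has_derivative[OF y] has_derivative_of_sl[OF y dpp]]]]],
        rule ext)
    fix h
    have "(e (sl y) *\<^sub>R (a *v h) + (e1 (sl y) * (w y \<bullet> h / al y)) *\<^sub>R (a *v y)) +
       (al y * (u2 (sl y) * (w y \<bullet> h / al y)) + eta y \<bullet> h * (\<phi> (sl y) * \<phi>1 (sl y))) *\<^sub>R b
      = e (sl y) *\<^sub>R (a *v h) + (e1 (sl y) * (w y \<bullet> h)) *\<^sub>R eta y
        + (u2 (sl y) * (w y \<bullet> h) + (eta y \<bullet> h) * (\<phi> (sl y) * \<phi>1 (sl y))) *\<^sub>R (w y + sl y *\<^sub>R eta y)"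
      unfolding 1 b_eq[of y, symmetric] using al by simp
    also have "\<dots> = hess y *v h"
      by (simp add: hess_def 2 matrix_vector_mult_add_rdistrib outer_mult_vec inner_add_left
          scaleR_matrix_vector_assoc[symmetric] algebra_simps)
    finally show "(e (sl y) *\<^sub>R (a *v h) + (e1 (sl y) * (w y \<bullet> h / al y)) *\<^sub>R (a *v y)) +
       (al y * (u2 (sl y) * (w y \<bullet> h / al y)) + eta y \<bullet> h * (\<phi> (sl y) * \<phi>1 (sl y))) *\<^sub>R b = hess y *v h" .
  qed
qed

lemma hess_y:
  assumes y: "y \<noteq> 0"
  shows "hess y *v y = (al y * (\<phi> (sl y))\<^sup>2) *\<^sub>R eta y + (al y * (\<phi> (sl y) * \<phi>1 (sl y))) *\<^sub>R w y"
proof -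
  have 1: "a *v y = al y *\<^sub>R eta y" using al_pos[OF y] by (simp add: eta_def)
  show ?thesis
    by (simp add: hess_def matrix_vector_mult_add_rdistrib outer_mult_vec inner_add_left eta_y[OF y] w_y[OF y]
        scaleR_matrix_vector_assoc[symmetric] 1 e_def power2_eq_square algebra_simps)
qed

lemma hess_bs:
  "hess y *v bs = (\<phi> (sl y) * E (sl y)) *\<^sub>R eta y + ((\<phi> (sl y))\<^sup>2 + u2 (sl y) * W (sl y)) *\<^sub>R w y"
proof -
  have "hess y *v bs = e (sl y) *\<^sub>R (w y + sl y *\<^sub>R eta y)
     + (sl y * (\<phi> (sl y) * \<phi>1 (sl y)) * sl y + \<phi> (sl y) * \<phi>1 (sl y) * W (sl y)) *\<^sub>R eta y
     + (\<phi> (sl y) * \<phi>1 (sl y) * sl y + u2 (sl y) * W (sl y)) *\<^sub>R w y"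
    by (simp add: hess_def matrix_vector_mult_add_rdistrib outer_mult_vec inner_add_left eta_bs w_bs
        scaleR_matrix_vector_assoc[symmetric] a_bs b_eq[of y, symmetric])
  also have "\<dots> = (e (sl y) * sl y + (sl y * (\<phi> (sl y) * \<phi>1 (sl y)) * sl y + \<phi> (sl y) * \<phi>1 (sl y) * W (sl y))) *\<^sub>R eta y
     + (e (sl y) + (\<phi> (sl y) * \<phi>1 (sl y) * sl y + u2 (sl y) * W (sl y))) *\<^sub>R w y"
    by (simp add: scaleR_add_left scaleR_add_right)
  also have "e (sl y) * sl y + (sl y * (\<phi> (sl y) * \<phi>1 (sl y)) * sl y + \<phi> (sl y) * \<phi>1 (sl y) * W (sl y)) = \<phi> (sl y) * E (sl y)"
    by (simp add: e_def E_def algebra_simps)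
  also have "e (sl y) + (\<phi> (sl y) * \<phi>1 (sl y) * sl y + u2 (sl y) * W (sl y)) = (\<phi> (sl y))\<^sup>2 + u2 (sl y) * W (sl y)"
    by (simp add: e_def algebra_simps power2_eq_square)
  finally show ?thesis .
qed

lemma hess_dual:
  assumes y: "y \<noteq> 0"
  shows "hess y *v dual y = N (sl y) *\<^sub>R w y"
proof -
  have al: "al y \<noteq> 0" using al_pos[OF y] by simp
  have p: "\<phi> (sl y) \<noteq> 0" using \<phi>_sl[OF y] by simp
  have "hess y *v dual y = hess y *v bs - (E (sl y) / (\<phi> (sl y) * al y)) *\<^sub>R (hess y *v y)"
    by (simp add: dual_def matrix_vector_mult_diff_distrib matrix_vector_mult_scaleR)
  also have "(E (sl y) / (\<phi> (sl y) * al y)) *\<^sub>R (hess y *v y) = (\<phi> (sl y) * E (sl y)) *\<^sub>R eta y + (E (sl y) * \<phi>1 (sl y)) *\<^sub>R w y"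
    unfolding hess_y[OF y] using al p by (simp add: scaleR_add_right power2_eq_square)
  also have "hess y *v bs - ((\<phi> (sl y) * E (sl y)) *\<^sub>R eta y + (E (sl y) * \<phi>1 (sl y)) *\<^sub>R w y)
     = ((\<phi> (sl y))\<^sup>2 + u2 (sl y) * W (sl y) - E (sl y) * \<phi>1 (sl y)) *\<^sub>R w y"
    unfolding hess_bs by (simp add: scaleR_diff_left)
  also have "(\<phi> (sl y))\<^sup>2 + u2 (sl y) * W (sl y) - E (sl y) * \<phi>1 (sl y) = N (sl y)"
    by (simp add: u2_def E_def N_def power2_eq_square algebra_simps)
  finally show ?thesis .
qed

lemma w_dual: "y \<noteq> 0 \<Longrightarrow> w y \<bullet> dual y = W (sl y)"
  by (simp add: dual_def inner_diff_right w_bs w_y)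

text \<open>The Hessian is a multiple of \<^term>\<open>a\<close> up to two terms of rank one.\<close>

lemma det_hess:
  assumes y: "y \<noteq> 0" and e: "e (sl y) \<noteq> 0"
  shows "det (hess y) = det a * H (CARD('n) - 2) (sl y)"
proof -
  let ?s = "sl y" and ?v = "bs - sl y *\<^sub>R (y /\<^sub>R al y)"
  let ?u = "y /\<^sub>R al y"
  let ?p = "(?s * (\<phi> ?s * \<phi>1 ?s)) *\<^sub>R eta y + (\<phi> ?s * \<phi>1 ?s) *\<^sub>R w y"
  let ?q = "(\<phi> ?s * \<phi>1 ?s) *\<^sub>R eta y + u2 ?s *\<^sub>R w y"
  have al: "al y \<noteq> 0" using al_pos[OF y] by simp
  have au: "a *v ?u = eta y" by (simp add: matrix_vector_mult_scaleR eta_def)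
  have av: "a *v ?v = w y"
    by (simp add: matrix_vector_mult_diff_distrib matrix_vector_mult_scaleR a_bs w_def eta_def)
  have pair: "eta y \<bullet> ?u = 1" "w y \<bullet> ?u = 0" "eta y \<bullet> ?v = 0" "w y \<bullet> ?v = W ?s"
    using al by (simp_all add: eta_y[OF y] w_y[OF y] inner_diff_right eta_bs w_bs)
  have pu: "?p \<bullet> ?u = ?s * (\<phi> ?s * \<phi>1 ?s)" and pv: "?p \<bullet> ?v = \<phi> ?s * \<phi>1 ?s * W ?s"
    and qu: "?q \<bullet> ?u = \<phi> ?s * \<phi>1 ?s" and qv: "?q \<bullet> ?v = u2 ?s * W ?s"
    by (simp_all only: inner_add_left inner_scaleR_left pair mult_1_right mult_zero_right add_0_right add_0_left)
  have e': "e ?s + ?s * (\<phi> ?s * \<phi>1 ?s) = (\<phi> ?s)\<^sup>2" by (simp add: e_def algebra_simps power2_eq_square)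
  let ?M = "mat 1 + outer (?u /\<^sub>R e ?s) ?p + outer (?v /\<^sub>R e ?s) ?q"
  have "hess y = a ** (e ?s *\<^sub>R ?M)"
  proof -
    have "k *\<^sub>R (mat 1 + outer (u /\<^sub>R k) p + outer (v /\<^sub>R k) q) = k *\<^sub>R mat 1 + outer u p + outer v q"
      if "k \<noteq> 0" for k and u v p q :: "real^'n"
      using that by (simp add: vec_eq_iff distrib_left mult.assoc[symmetric])
    from this[OF e] have sM: "e ?s *\<^sub>R ?M = e ?s *\<^sub>R mat 1 + outer ?u ?p + outer ?v ?q" .
    have sa: "a ** (c *\<^sub>R mat 1) = c *\<^sub>R a" for c
      by (simp add: vec_eq_iff matrix_matrix_mult_def mat_def if_distrib cong: if_cong)
    show ?thesis by (simp only: sM sa matrix_add_ldistrib matrix_mult_outer au av hess_def)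
  qed
  then have "det (hess y) = det a * det (e ?s *\<^sub>R ?M)" by (simp add: det_mul)
  also have "det (e ?s *\<^sub>R ?M) = e ?s ^ CARD('n) * det ?M" by (rule det_scaleR)
  also have "det ?M = (1 + ?p \<bullet> (?u /\<^sub>R e ?s)) * (1 + ?q \<bullet> (?v /\<^sub>R e ?s)) - (?q \<bullet> (?u /\<^sub>R e ?s)) * (?p \<bullet> (?v /\<^sub>R e ?s))"
  proof (rule det_mat_1_plus_two_outer)
    have "1 + ?p \<bullet> (?u /\<^sub>R e ?s) = (\<phi> ?s)\<^sup>2 / e ?s"
      unfolding inner_scaleR_right[of _ "inverse (e ?s)"] pu using e e' by (simp add: field_simps)
    then show "1 + ?p \<bullet> (?u /\<^sub>R e ?s) \<noteq> 0" using e \<phi>_sl[OF y] by simp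
  qed
  also have "\<dots> = (1 + (?s * (\<phi> ?s * \<phi>1 ?s)) / e ?s) * (1 + (u2 ?s * W ?s) / e ?s) - (\<phi> ?s * \<phi>1 ?s) / e ?s * ((\<phi> ?s * \<phi>1 ?s * W ?s) / e ?s)"
    unfolding inner_scaleR_right[of _ "inverse (e ?s)"] pu pv qu qv by (simp add: divide_inverse mult_ac)
  also have "\<dots> = ((e ?s + ?s * (\<phi> ?s * \<phi>1 ?s)) * (e ?s + u2 ?s * W ?s) - (\<phi> ?s * \<phi>1 ?s) * (\<phi> ?s * \<phi>1 ?s * W ?s)) / (e ?s)\<^sup>2"
    using e by (simp add: field_simps power2_eq_square)
  also have "(e ?s + ?s * (\<phi> ?s * \<phi>1 ?s)) * (e ?s + u2 ?s * W ?s) - (\<phi> ?s * \<phi>1 ?s) * (\<phi> ?s * \<phi>1 ?s * W ?s) = (\<phi> ?s)\<^sup>2 * N ?s"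
    unfolding e' by (simp add: e_def u2_def N_def algebra_simps power2_eq_square)
  also have "e ?s ^ CARD('n) * ((\<phi> ?s)\<^sup>2 * N ?s / (e ?s)\<^sup>2) = H (CARD('n) - 2) ?s"
  proof -
    have "e ?s ^ CARD('n) = e ?s ^ (CARD('n) - 2) * (e ?s)\<^sup>2"
      using power_add[of "e ?s" "CARD('n) - 2" 2] by (simp only: le_add_diff_inverse2[OF dim])
    then show ?thesis using e by (simp add: H_def)
  qed
  finally show ?thesis .
qed

text \<open>Evaluate the Hessian on a transversal vector and on \<^term>\<open>dual y\<close>.\<close>

lemma convex_profile:
  assumes pos: "\<And>y v. y \<noteq> 0 \<Longrightarrow> v \<noteq> 0 \<Longrightarrow> v \<bullet> (hess y *v v) > 0"
  shows "convex_profile r \<phi> \<phi>1 \<phi>2 \<phi>3 \<rho>"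
proof
  obtain v where v: "transversal v" using transversal_exists by blast
  have v0: "v \<noteq> 0" using v by (auto simp: transversal_def)
  fix s :: real
  show "r\<^sup>2 * e s - s * W s * e1 s > 0" if s: "\<bar>s\<bar> \<le> r"
  proof -
    let ?y = "ray v s" and ?c = "sqrt (1 - (s / r)\<^sup>2)"
    note y = ray_nz[OF v s] and sl = ray_sl[OF v s] and al = ray_al[OF v s]
    have vn: "v \<bullet> (a *v nn) = 0" using v a_swap[of v nn] by (simp add: nn_a transversal_def)
    have "eta ?y = a *v ?y" by (simp add: eta_def al)
    then have ev: "eta ?y \<bullet> v = ?c"
      using v vn by (simp add: ray_def inner_commute[of _ v] matrix_vector_right_distrib
          matrix_vector_mult_scaleR inner_add_right transversal_def)
    have wv: "w ?y \<bullet> v = - s * ?c" using v by (simp add: w_def inner_diff_left ev sl transversal_def)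
    have "v \<bullet> (hess ?y *v v) = e s + (s * (\<phi> s * \<phi>1 s) * ?c + \<phi> s * \<phi>1 s * (- s * ?c)) * ?c
        + (\<phi> s * \<phi>1 s * ?c + u2 s * (- s * ?c)) * (- s * ?c)"
      using v by (simp add: hess_def sl matrix_vector_mult_add_rdistrib outer_mult_vec inner_add_left inner_add_right ev wv
          scaleR_matrix_vector_assoc[symmetric] transversal_def inner_commute[of v])
    also have "\<dots> = e s - s * ?c\<^sup>2 * e1 s" by (simp add: e1_def u2_def algebra_simps power2_eq_square)
    finally have "v \<bullet> (hess ?y *v v) = e s - s * (W s / r\<^sup>2) * e1 s" unfolding ray_coeff[OF s] .
    then have "e s - s * (W s / r\<^sup>2) * e1 s > 0" using pos[OF y v0] by simp
    then have "r\<^sup>2 * (e s - s * (W s / r\<^sup>2) * e1 s) > 0" using r by simp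
    then show ?thesis using r by (simp add: right_diff_distrib)
  qed
  show "N s > 0" if s: "\<bar>s\<bar> < r"
  proof -
    have s': "\<bar>s\<bar> \<le> r" using s by simp
    let ?y = "ray v s"
    note y = ray_nz[OF v s'] and sl = ray_sl[OF v s']
    have W: "W s > 0" using s power2_strict_mono[of s r] by (simp add: W_def)
    have "dual ?y \<noteq> 0" using w_dual[OF y] W sl by auto
    from pos[OF y this] have "N s * W s > 0"
      by (simp add: hess_dual[OF y] sl inner_commute[of "dual _"] w_dual[OF y])
    then show ?thesis using W by (simp add: zero_less_mult_iff)
  qed
qed

text \<open>In an adapted frame, the parts of the relation that are even and odd in the transversal
  direction are linear relations between \<^term>\<open>e\<close> and \<open>\<phi> \<phi>1\<close>, so their coefficients vanish unless the
  norm is Euclidean.\<close>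

lemma invariance_rigid:
  assumes nq: "\<not> quadratic" and A: "transpose A = A"
    and rel: "\<And>y. y \<noteq> 0 \<Longrightarrow> e (sl y) * (y \<bullet> (A *v y)) + 2 * (al y * (\<phi> (sl y) * \<phi>1 (sl y))) * (B \<bullet> y) = 0"
  shows "A = 0" "B = 0"
proof -
  have parts: "nn \<bullet> (A *v nn) = 0 \<and> B \<bullet> nn = 0 \<and> nn \<bullet> (A *v v) = 0 \<and> B \<bullet> v = 0 \<and> v \<bullet> (A *v v) = 0"
    if v: "transversal v" for v
  proof -
    let ?Ann = "nn \<bullet> (A *v nn)" and ?Anv = "nn \<bullet> (A *v v)" and ?Avv = "v \<bullet> (A *v v)"
    have both: "e s * ((s / r)\<^sup>2 * ?Ann + W s / r\<^sup>2 * ?Avv) + 2 * (\<phi> s * \<phi>1 s) * ((s / r) * (B \<bullet> nn)) = 0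
        \<and> e s * ((s / r) * ?Anv) + \<phi> s * \<phi>1 s * (B \<bullet> v) = 0" if s: "\<bar>s\<bar> < r" for s
    proof -
      let ?c = "sqrt (1 - (s / r)\<^sup>2)"
      have s': "\<bar>s\<bar> \<le> r" using s by simp
      have c2: "?c\<^sup>2 = W s / r\<^sup>2" by (rule ray_coeff[OF s'])
      have "W s > 0" using s power2_strict_mono[of s r] by (simp add: W_def)
      then have c: "?c \<noteq> 0" using c2 r by (metis divide_pos_pos less_irrefl power_zero_numeral zero_less_power)
      have gen: "e s * ((s / r)\<^sup>2 * ?Ann + 2 * (s / r) * ?c * (nn \<bullet> (A *v x)) + W s / r\<^sup>2 * (x \<bullet> (A *v x)))
          + 2 * (\<phi> s * \<phi>1 s) * ((s / r) * (B \<bullet> nn) + ?c * (B \<bullet> x)) = 0" if x: "transversal x" for x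
      proof -
        have q: "ray x s \<bullet> (A *v ray x s) = (s / r)\<^sup>2 * ?Ann + 2 * (s / r) * ?c * (nn \<bullet> (A *v x)) + ?c\<^sup>2 * (x \<bullet> (A *v x))"
          using inner_matrix_symmetric[OF A, of x nn]
          by (simp add: ray_def inner_add_left inner_add_right matrix_vector_right_distrib matrix_vector_mult_scaleR
              power2_eq_square algebra_simps del: real_sqrt_mult_self)
        have bb: "B \<bullet> ray x s = (s / r) * (B \<bullet> nn) + ?c * (B \<bullet> x)" by (simp add: ray_def inner_add_right)
        show ?thesis
          using rel[OF ray_nz[OF x s']] unfolding ray_sl[OF x s'] ray_al[OF x s'] q bb c2 by simp
      qed
      have p: "e s * ((s / r)\<^sup>2 * ?Ann + 2 * (s / r) * ?c * ?Anv + W s / r\<^sup>2 * ?Avv)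
          + 2 * (\<phi> s * \<phi>1 s) * ((s / r) * (B \<bullet> nn) + ?c * (B \<bullet> v)) = 0" by (rule gen[OF v])
      have m: "e s * ((s / r)\<^sup>2 * ?Ann - 2 * (s / r) * ?c * ?Anv + W s / r\<^sup>2 * ?Avv)
          + 2 * (\<phi> s * \<phi>1 s) * ((s / r) * (B \<bullet> nn) - ?c * (B \<bullet> v)) = 0"
        using gen[OF transversal_uminus[OF v]] by (simp add: vec.neg)
      define X where "X = e s * ((s / r)\<^sup>2 * ?Ann + W s / r\<^sup>2 * ?Avv) + 2 * (\<phi> s * \<phi>1 s) * ((s / r) * (B \<bullet> nn))"
      define Y where "Y = e s * ((s / r) * ?Anv) + \<phi> s * \<phi>1 s * (B \<bullet> v)"
      have "X + 2 * ?c * Y = 0" using p unfolding X_def Y_def by (simp only: algebra_simps)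
      moreover have "X - 2 * ?c * Y = 0" using m unfolding X_def Y_def by (simp only: algebra_simps)
      ultimately have "X = 0" "?c * Y = 0" by linarith+
      then show ?thesis using c unfolding X_def Y_def by simp
    qed
    have "?Avv = 0"
      using both[of 0] r \<phi>_pos[of 0] by (simp add: e_def W_def)
    have "?Anv / r = 0 \<and> B \<bullet> v = 0"
    proof (rule ccontr)
      assume "\<not> ?thesis"
      then have "?Anv / r \<noteq> 0 \<or> B \<bullet> v \<noteq> 0" by blast
      then have quadratic
        by (rule quadratic_if_linear_relation) (use both in \<open>simp add: algebra_simps\<close>)
      then show False using nq by blast
    qed
    moreover have "?Ann / r = 0 \<and> 2 * (B \<bullet> nn) = 0"
    proof (rule ccontr)
      assume "\<not> ?thesis"
      then have "?Ann / r \<noteq> 0 \<or> 2 * (B \<bullet> nn) \<noteq> 0" by blast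
      then have quadratic
      proof (rule quadratic_if_linear_relation)
        fix s assume s: "\<bar>s\<bar> < r" "s \<noteq> 0"
        have "(s / r) * (?Ann / r * s * e s + 2 * (B \<bullet> nn) * (\<phi> s * \<phi>1 s)) = 0"
          using both[OF s(1)] \<open>?Avv = 0\<close> by (simp add: algebra_simps power2_eq_square)
        then show "?Ann / r * s * e s + 2 * (B \<bullet> nn) * (\<phi> s * \<phi>1 s) = 0" using s r by simp
      qed
      then show False using nq by blast
    qed
    ultimately show ?thesis using \<open>?Avv = 0\<close> r by simp
  qed
  have all: "y \<bullet> (A *v y) = 0 \<and> B \<bullet> y = 0" for y
  proof -
    obtain c v where v: "transversal v" and y: "y = (b \<bullet> y / r) *\<^sub>R nn + c *\<^sub>R v" by (rule transversal_decomposition)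
    have "v \<bullet> (A *v nn) = 0" using parts[OF v] inner_matrix_symmetric[OF A, of v nn] by simp
    then show ?thesis using parts[OF v]
      by (subst (1 2) y, subst y)
         (simp add: inner_add_left inner_add_right matrix_vector_right_distrib matrix_vector_mult_scaleR)
  qed
  show "B = 0" using all by (metis inner_eq_zero_iff)
  have "z \<bullet> (A *v y) = 0" for y z
    using all[of "y + z"] all[of y] all[of z] inner_matrix_symmetric[OF A, of y z]
    by (simp add: matrix_vector_right_distrib inner_add_left inner_add_right)
  then have "A *v y = 0" for y by (metis inner_eq_zero_iff)
  then show "A = 0" by (simp add: matrix_eq)
qed

text \<open>Again the relation splits into parts that are even and odd in the transversal direction; here
  one value of \<open>\<beta> / \<alpha>\<close> suffices, at which both factors \<^term>\<open>e s\<close> and \<^term>\<open>E s\<close> are nonzero.\<close>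

lemma bilinear_rigid:
  assumes s: "\<bar>s\<bar> < r" and e: "e s \<noteq> 0" and E: "E s \<noteq> 0"
    and P0: "\<And>z. bs \<bullet> (P *v z) = 0"
    and rel: "\<And>y. y \<noteq> 0 \<Longrightarrow> sl y = s \<Longrightarrow> e s * (y \<bullet> (P *v y)) + al y * (\<phi> s * \<phi>1 s) * (y \<bullet> (P *v bs)) = 0"
  shows "y \<bullet> (P *v y) = 0"
proof -
  have nP: "nn \<bullet> (P *v z) = 0" for z using P0 by (simp add: nn_def)
  have parts: "v \<bullet> (P *v v) = 0 \<and> v \<bullet> (P *v nn) = 0" if v: "transversal v" for v
  proof -
    let ?c = "sqrt (1 - (s / r)\<^sup>2)"
    have s': "\<bar>s\<bar> \<le> r" using s by simp
    have c2: "?c\<^sup>2 = W s / r\<^sup>2" by (rule ray_coeff[OF s'])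
    have "W s > 0" using s power2_strict_mono[of s r] by (simp add: W_def)
    then have c: "?c \<noteq> 0" using c2 r by (metis divide_pos_pos less_irrefl power_zero_numeral zero_less_power)
    have bsn: "bs = r *\<^sub>R nn" using r by (simp add: nn_def)
    have gen: "e s * ((s / r) * ?c * (x \<bullet> (P *v nn)) + ?c * ?c * (x \<bullet> (P *v x))) + (\<phi> s * \<phi>1 s) * (r * ?c * (x \<bullet> (P *v nn))) = 0"
      if x: "transversal x" for x
    proof -
      have "ray x s \<bullet> (P *v ray x s) = (s / r) * ?c * (x \<bullet> (P *v nn)) + ?c * ?c * (x \<bullet> (P *v x))"
        by (simp add: ray_def inner_add_left inner_add_right matrix_vector_right_distrib matrix_vector_mult_scaleR nP
            del: real_sqrt_mult_self)
      moreover have "ray x s \<bullet> (P *v bs) = r * ?c * (x \<bullet> (P *v nn))"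
        by (simp add: ray_def inner_add_left nP bsn matrix_vector_mult_scaleR)
      ultimately show ?thesis using rel[OF ray_nz[OF x s'] ray_sl[OF x s']] by (simp add: ray_al[OF x s'])
    qed
    define X where "X = e s * (v \<bullet> (P *v v))"
    define Y where "Y = (e s * (s / r) + \<phi> s * \<phi>1 s * r) * (v \<bullet> (P *v nn))"
    have "?c * (Y + ?c * X) = 0" using gen[OF v] unfolding X_def Y_def by (simp only: algebra_simps)
    moreover have "?c * (- Y + ?c * X) = 0"
      using gen[OF transversal_uminus[OF v]] unfolding X_def Y_def by (simp add: vec.neg algebra_simps del: real_sqrt_mult_self)
    ultimately have "Y + ?c * X = 0" "- Y + ?c * X = 0" using c by simp_all
    then have XY: "?c * X = 0" "Y = 0" by linarith+
    have "r * (e s * (s / r) + \<phi> s * \<phi>1 s * r) = \<phi> s * E s"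
      using r by (simp add: e_def E_def W_def algebra_simps power2_eq_square)
    moreover have "\<phi> s * E s \<noteq> 0" using \<phi>_pos[OF s'] E by simp
    ultimately have "e s * (s / r) + \<phi> s * \<phi>1 s * r \<noteq> 0" by auto
    then show ?thesis using XY c e unfolding X_def Y_def by simp
  qed
  obtain c v where v: "transversal v" and y: "y = (b \<bullet> y / r) *\<^sub>R nn + c *\<^sub>R v" by (rule transversal_decomposition)
  show ?thesis using parts[OF v]
    by (subst y, subst (2) y) (simp add: inner_add_left inner_add_right matrix_vector_right_distrib matrix_vector_mult_scaleR nP)
qed

end

section \<open>(Alpha, beta)-metrics with a compatible connection\<close>

lemma form_length_eq: "form_length a b c x = sqrt (b c x \<bullet> (matrix_inv (a c x) *v b c x))"
  by (simp add: form_length_def inner_vec_def matrix_vector_mult_def sum_distrib_left mult_ac)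

context flow_invariant_finsler
begin

text \<open>The fundamental tensor of a Riemannian metric is constant along the fibres.\<close>

lemma S_curvature_quadratic:
  assumes h: "\<And>x y. x \<in> img_of c \<Longrightarrow> (F c x y)\<^sup>2 = y \<bullet> (h x *v y)"
    and sym: "\<And>x. x \<in> img_of c \<Longrightarrow> transpose (h x) = h x"
    and x: "x \<in> img_of c" and y: "y \<noteq> 0"
  shows "S_curvature F c x y = 0"
proof -
  have d: "((\<lambda>y. (F c x y)\<^sup>2) has_derivative (\<lambda>k. 2 * ((h x *v y) \<bullet> k))) (at y)" for y
  proof -
    have "((\<lambda>y. h x *v y) has_derivative (\<lambda>k. h x *v k)) (at y)" by (rule bounded_linear_imp_has_derivative) simp
    from has_derivative_inner[OF has_derivative_ident this]
    have "((\<lambda>y. y \<bullet> (h x *v y)) has_derivative (\<lambda>k. y \<bullet> (h x *v k) + k \<bullet> (h x *v y))) (at y)" .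
    moreover have "y \<bullet> (h x *v k) + k \<bullet> (h x *v y) = 2 * ((h x *v y) \<bullet> k)" for k
      using inner_matrix_symmetric[OF sym[OF x], of y k] inner_commute[of k "h x *v y"] by simp
    ultimately show ?thesis by (simp add: h[OF x])
  qed
  have "partial i (\<lambda>y. (F c x y)\<^sup>2) z = 2 * (h x *v z) $ i" for i z
    using partial_eq[OF d, of i z] by (simp add: inner_axis)
  then have "g x z = h x" for z
  proof -
    have "partial j (\<lambda>y. 2 * (h x *v y) $ i) z = 2 * h x $ i $ j" for i j
    proof -
      have "((\<lambda>y. 2 * (h x *v y) $ i) has_derivative (\<lambda>k. 2 * (h x *v k) $ i)) (at z)"
        by (intro has_derivative_mult_right bounded_linear.has_derivative[OF bounded_linear_vec_nth]
            bounded_linear_imp_has_derivative matrix_vector_mul_bounded_linear)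
      from partial_eq[OF this, of j] show ?thesis by (simp add: matrix_vector_mul_component inner_axis)
    qed
    then show ?thesis
      unfolding fundamental_tensor_def \<open>\<And>z i. partial i (\<lambda>y. (F c x y)\<^sup>2) z = 2 * (h x *v z) $ i\<close>
      by (simp add: vec_eq_iff)
  qed
  then have "((\<lambda>y. g x y) has_derivative (\<lambda>_. 0)) (at y)" by simp
  then have "Dg x y = (\<lambda>_. 0)" using has_derivative_unique g_has_derivative[OF x y] by blast
  then show ?thesis by (simp add: S_curvature_eq[OF x y] trace_def matrix_matrix_mult_def)
qed

end

locale alpha_beta_chart = flow_invariant_finsler F c \<Gamma>
  for F :: "('m, 'n::finite) chart \<Rightarrow> real^'n \<Rightarrow> real^'n \<Rightarrow> real" and c :: "('m, 'n) chart"
    and \<Gamma> :: "('m, 'n) chart \<Rightarrow> real^'n \<Rightarrow> 'n \<Rightarrow> 'n \<Rightarrow> 'n \<Rightarrow> real" +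
  fixes a :: "('m, 'n) chart \<Rightarrow> real^'n \<Rightarrow> real^'n^'n" and b :: "('m, 'n) chart \<Rightarrow> real^'n \<Rightarrow> real^'n"
    and b0 :: ereal and \<phi> \<phi>1 \<phi>2 \<phi>3 :: "real \<Rightarrow> real"
  assumes dim: "CARD('n) \<ge> 2"
    and smooth_a: "smooth_on (img_of c) (a c)" and smooth_b: "smooth_on (img_of c) (b c)"
    and a_sym: "x \<in> img_of c \<Longrightarrow> transpose (a c x) = a c x"
    and a_pos: "x \<in> img_of c \<Longrightarrow> y \<noteq> 0 \<Longrightarrow> y \<bullet> (a c x *v y) > 0"
    and d1: "ereal \<bar>s\<bar> < b0 \<Longrightarrow> (\<phi> has_real_derivative \<phi>1 s) (at s)"
    and d2: "ereal \<bar>s\<bar> < b0 \<Longrightarrow> (\<phi>1 has_real_derivative \<phi>2 s) (at s)"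
    and d3: "ereal \<bar>s\<bar> < b0 \<Longrightarrow> (\<phi>2 has_real_derivative \<phi>3 s) (at s)"
    and c3: "ereal \<bar>s\<bar> < b0 \<Longrightarrow> isCont \<phi>3 s"
    and length_less: "x \<in> img_of c \<Longrightarrow> ereal (form_length a b c x) < b0"
    and F_eq: "x \<in> img_of c \<Longrightarrow> F c x y = riem_norm a c x y * \<phi> ((b c x \<bullet> y) / riem_norm a c x y)"
begin

abbreviation len :: "real^'n \<Rightarrow> real" where "len x \<equiv> form_length a b c x"

definition da :: "real^'n \<Rightarrow> real^'n \<Rightarrow> real^'n^'n" where "da x = frechet_derivative (a c) (at x)"
definition db :: "real^'n \<Rightarrow> real^'n \<Rightarrow> real^'n" where "db x = frechet_derivative (b c) (at x)"
text \<open>The vector dual to beta.\<close>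

definition X :: "real^'n \<Rightarrow> real^'n" where "X x = matrix_inv (a c x) *v b c x"

lemma a_derivative: "x \<in> img_of c \<Longrightarrow> (a c has_derivative da x) (at x)"
  unfolding da_def by (rule smooth_on_has_derivative[OF smooth_a])

lemma b_derivative: "x \<in> img_of c \<Longrightarrow> (b c has_derivative db x) (at x)"
  unfolding db_def by (rule smooth_on_has_derivative[OF smooth_b])

lemma a_inv: "x \<in> img_of c \<Longrightarrow> invertible (a c x)"
  by (rule positive_definite_invertible) (rule a_pos)

lemma a_X: "x \<in> img_of c \<Longrightarrow> a c x *v X x = b c x"
  by (simp add: X_def matrix_inv_mult_vec a_inv)

lemma a_swap: "x \<in> img_of c \<Longrightarrow> y \<bullet> (a c x *v z) = z \<bullet> (a c x *v y)"
  by (rule inner_matrix_symmetric[OF a_sym])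

lemma b_X_nonneg:
  assumes x: "x \<in> img_of c"
  shows "0 \<le> b c x \<bullet> X x"
proof (cases "X x = 0")
  case False
  then show ?thesis using a_pos[OF x False] by (simp add: a_X[OF x] inner_commute[of "b c x"])
qed simp

lemma len_sq: "x \<in> img_of c \<Longrightarrow> (len x)\<^sup>2 = b c x \<bullet> X x"
  using b_X_nonneg by (simp add: form_length_eq X_def)

lemma len_nonneg: "x \<in> img_of c \<Longrightarrow> len x \<ge> 0"
  using b_X_nonneg by (simp add: form_length_eq X_def)

lemma abs_form_le: "x \<in> img_of c \<Longrightarrow> y \<noteq> 0 \<Longrightarrow> \<bar>(b c x \<bullet> y) / riem_norm a c x y\<bar> \<le> len x"
proof -
  assume x: "x \<in> img_of c" and y: "y \<noteq> 0"
  have "(b c x \<bullet> y)\<^sup>2 \<le> (len x)\<^sup>2 * (y \<bullet> (a c x *v y))"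
    using Cauchy_Schwarz_matrix_inv[OF a_sym[OF x] a_pos[OF x], of "b c x" y] by (simp add: len_sq[OF x] X_def)
  then have "((b c x \<bullet> y) / riem_norm a c x y)\<^sup>2 \<le> (len x)\<^sup>2"
    using a_pos[OF x y] by (simp add: riem_norm_def power_divide field_simps)
  then show ?thesis using len_nonneg[OF x] abs_le_square_iff[of "(b c x \<bullet> y) / riem_norm a c x y" "len x"] by simp
qed

lemma X_derivative:
  assumes x: "x \<in> img_of c"
  shows "(X has_derivative (\<lambda>h. matrix_inv (a c x) *v (db x h - da x h *v X x))) (at x)"
  unfolding X_def
  by (rule has_derivative_matrix_inv_vec[OF open_img x a_inv a_derivative[OF x] b_derivative[OF x]])

lemma len_sq_derivative:
  assumes x: "x \<in> img_of c"
  shows "((\<lambda>x. b c x \<bullet> X x) has_derivative (\<lambda>h. 2 * (db x h \<bullet> X x) - X x \<bullet> (da x h *v X x))) (at x)"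
proof (rule has_derivative_eq_rhs[OF has_derivative_inner[OF b_derivative[OF x] X_derivative[OF x]]], rule ext)
  fix h
  let ?u = "db x h - da x h *v X x"
  have "b c x \<bullet> (matrix_inv (a c x) *v ?u) = (matrix_inv (a c x) *v ?u) \<bullet> (a c x *v X x)"
    by (simp add: a_X[OF x] inner_commute)
  also have "\<dots> = X x \<bullet> ?u"
    unfolding a_swap[OF x, of "matrix_inv (a c x) *v ?u" "X x"] matrix_inv_mult_vec(1)[OF a_inv[OF x]] ..
  finally show "b c x \<bullet> (matrix_inv (a c x) *v ?u) + db x h \<bullet> X x = 2 * (db x h \<bullet> X x) - X x \<bullet> (da x h *v X x)"
    by (simp add: inner_diff_right inner_commute)
qed

lemma len_continuous_on: "continuous_on (img_of c) len"
proof -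
  have "continuous_on (img_of c) (\<lambda>x. b c x \<bullet> X x)"
    using len_sq_derivative has_derivative_continuous by (blast intro: continuous_at_imp_continuous_on)
  then have "continuous_on (img_of c) (\<lambda>x. sqrt (b c x \<bullet> X x))" by (rule continuous_on_real_sqrt)
  then show ?thesis by (simp add: form_length_eq[abs_def] X_def)
qed

end

locale alpha_beta_point = alpha_beta_chart F c \<Gamma> a b b0 \<phi> \<phi>1 \<phi>2 \<phi>3
  for F :: "('m, 'n::finite) chart \<Rightarrow> real^'n \<Rightarrow> real^'n \<Rightarrow> real" and c :: "('m, 'n) chart"
    and \<Gamma> :: "('m, 'n) chart \<Rightarrow> real^'n \<Rightarrow> 'n \<Rightarrow> 'n \<Rightarrow> 'n \<Rightarrow> real"
    and a :: "('m, 'n) chart \<Rightarrow> real^'n \<Rightarrow> real^'n^'n" and b :: "('m, 'n) chart \<Rightarrow> real^'n \<Rightarrow> real^'n"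
    and b0 :: ereal and \<phi> \<phi>1 \<phi>2 \<phi>3 :: "real \<Rightarrow> real" +
  fixes x :: "real^'n" and \<rho> :: real
  assumes x: "x \<in> img_of c" and len_pos: "form_length a b c x > 0"
    and len_less: "form_length a b c x < \<rho>" and \<rho>_le: "ereal \<rho> \<le> b0"
begin

lemma inside: "\<bar>s\<bar> < \<rho> \<Longrightarrow> ereal \<bar>s\<bar> < b0"
  using \<rho>_le by (metis ereal_less_eq(3) less_ereal.simps(1) order_less_le_trans)

sublocale V: covector_frame "len x" "a c x" "b c x"
  by unfold_locales (use len_pos dim a_sym[OF x] a_pos[OF x] len_sq[OF x] in \<open>auto simp: X_def\<close>)

lemma al_eq: "V.al y = riem_norm a c x y" by (simp add: V.al_def riem_norm_def)

lemma F_at: "F c x y = V.al y * \<phi> (V.sl y)"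
  by (simp add: F_eq[OF x] V.sl_def al_eq)

sublocale V: alpha_beta_norm "len x" \<rho> \<phi> \<phi>1 \<phi>2 \<phi>3 "a c x" "b c x"
proof unfold_locales
  show "len x < \<rho>" by (rule len_less)
  fix s :: real
  show "0 < \<phi> s" if s: "\<bar>s\<bar> \<le> len x"
  proof -
    obtain v where v: "V.transversal v" using V.transversal_exists by blast
    have "F c x (V.ray v s) > 0"
      using F_nonneg[OF x, of "V.ray v s"] F_eq_0[OF x, of "V.ray v s"] V.ray_nz[OF v s] by linarith
    then show ?thesis by (simp add: F_at V.ray_al[OF v s] V.ray_sl[OF v s])
  qed
qed (use inside d1 d2 d3 c3 in auto)

lemma X_eq: "V.bs = X x" by (simp add: V.bs_def X_def)

lemma L1_eq:
  assumes y: "y \<noteq> 0"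
  shows "L1 i (x, y) = 2 * V.grad y $ i"
proof -
  have "((\<lambda>y. (F c x y)\<^sup>2) has_derivative (\<lambda>h. 2 * (V.grad y \<bullet> h))) (at y)"
    unfolding F_at by (rule V.norm_sq_has_derivative[OF y])
  from partial_eq[OF this, of i] show ?thesis by (simp add: partial_y[OF x y] inner_axis)
qed

lemma g_eq:
  assumes y: "y \<noteq> 0"
  shows "g x y = V.hess y"
proof -
  have "frechet_derivative (L1 i) (at (x, y)) (0, axis j 1) = 2 * V.hess y $ i $ j" for i j
  proof -
    have "((\<lambda>y. 2 * V.grad y $ i) has_derivative (\<lambda>h. 2 * (V.hess y *v h) $ i)) (at y)"
      by (intro has_derivative_mult_right bounded_linear.has_derivative[OF bounded_linear_vec_nth V.grad_has_derivative[OF y]])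
    then have "((\<lambda>y. L1 i (x, y)) has_derivative (\<lambda>h. 2 * (V.hess y *v h) $ i)) (at y)"
      by (rule has_derivative_transform_within_open[of _ _ _ _ "-{0}"]) (use y L1_eq in auto)
    then have "(\<lambda>h. 2 * (V.hess y *v h) $ i) = (\<lambda>h. frechet_derivative (L1 i) (at (x, y)) (0, h))"
      using has_derivative_unique L1_y_derivative[OF x y] by blast
    from fun_cong[OF this, of "axis j 1"] show ?thesis by (simp add: matrix_vector_mul_component inner_axis)
  qed
  then show ?thesis by (simp add: vec_eq_iff g_nth[OF x y])
qed

sublocale V: convex_profile "len x" \<phi> \<phi>1 \<phi>2 \<phi>3 \<rho>
  by (rule V.convex_profile) (use g_pos[OF x] g_eq in metis)

text \<open>The derivative of the squared norm along the base, for fixed components of the vector.\<close>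

lemma dL_x:
  assumes y: "y \<noteq> 0"
  shows "frechet_derivative L (at (x, y)) (v, 0) =
    V.e (V.sl y) * (y \<bullet> (da x v *v y)) + 2 * (V.al y * (\<phi> (V.sl y) * \<phi>1 (V.sl y))) * (db x v \<bullet> y)"
proof -
  let ?q = "\<lambda>x. y \<bullet> (a c x *v y)" and ?\<beta> = "\<lambda>x. b c x \<bullet> y"
  let ?s = "V.sl y" and ?al = "V.al y"
  have q: "?q x > 0" by (rule a_pos[OF x y])
  have al: "?al = sqrt (?q x)" "?al > 0" using V.al_pos[OF y] by (simp_all add: V.al_def)
  have dq: "(?q has_derivative (\<lambda>h. y \<bullet> (da x h *v y))) (at x)"
    using has_derivative_inner_right[OF bounded_linear.has_derivative[OF
        bounded_bilinear.bounded_linear_left[OF bounded_bilinear_matrix_vector_mult] a_derivative[OF x]]] .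
  have d\<beta>: "(?\<beta> has_derivative (\<lambda>h. db x h \<bullet> y)) (at x)"
    by (rule has_derivative_inner_left[OF b_derivative[OF x]])
  let ?dr = "\<lambda>h. (y \<bullet> (da x h *v y)) * (inverse (sqrt (?q x)) / 2)"
  let ?ds = "\<lambda>h. - ?\<beta> x * (inverse (sqrt (?q x)) * ?dr h * inverse (sqrt (?q x))) + (db x h \<bullet> y) / sqrt (?q x)"
  let ?f = "\<lambda>x. sqrt (?q x) * \<phi> (?\<beta> x / sqrt (?q x))"
  let ?r = "\<lambda>h. V.e ?s * (y \<bullet> (da x h *v y)) + 2 * (?al * (\<phi> ?s * \<phi>1 ?s)) * (db x h \<bullet> y)"
  have dr: "((\<lambda>x. sqrt (?q x)) has_derivative ?dr) (at x)"
    using has_derivative_real_sqrt[OF q dq] by (simp add: mult.commute)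
  have ds: "((\<lambda>x. ?\<beta> x / sqrt (?q x)) has_derivative ?ds) (at x)"
    by (rule has_derivative_divide[OF d\<beta> dr]) (use q in simp)
  have \<phi>: "(\<phi> has_derivative (*) (\<phi>1 ?s)) (at (?\<beta> x / sqrt (?q x)))"
    using V.d1[OF V.sl_less[OF y]] by (simp add: has_field_derivative_def V.sl_def al(1))
  note d = has_derivative_mult[OF dr has_derivative_compose[OF ds \<phi>]]
  have "((\<lambda>x. (F c x y)\<^sup>2) has_derivative ?r) (at x)"
  proof (rule has_derivative_transform_within_open[OF _ open_img x])
    show "(?f z)\<^sup>2 = (F c z y)\<^sup>2" if "z \<in> img_of c" for z
      by (simp add: F_eq[OF that] riem_norm_def)
    show "((\<lambda>x. (?f x)\<^sup>2) has_derivative ?r) (at x)"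
      unfolding power2_eq_square
    proof (rule has_derivative_eq_rhs[OF has_derivative_mult[OF d d]], rule ext)
      fix h
      define Q where "Q = y \<bullet> (da x h *v y)"
      define B where "B = db x h \<bullet> y"
      define l where "l = sqrt (?q x)"
      have l: "l > 0" using q by (simp add: l_def)
      have \<beta>: "?\<beta> x = ?s * l" using l by (simp add: V.sl_def al(1) l_def)
      have s: "?\<beta> x / l = ?s" using l \<beta> by simp
      have all: "?al = l" by (simp add: al(1) l_def)
      let ?df = "sqrt (?q x) * (\<phi>1 ?s * ?ds h) + ?dr h * \<phi> (?\<beta> x / sqrt (?q x))"
      show "?f x * ?df + ?df * ?f x = ?r h"
        unfolding l_def[symmetric] Q_def[symmetric] B_def[symmetric] s all unfolding \<beta>
        using l by (simp add: V.e_def field_simps)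
    qed
  qed
  moreover have "((\<lambda>x. (F c x y)\<^sup>2) has_derivative (\<lambda>h. frechet_derivative L (at (x, y)) (h, 0))) (at x)"
    using frechet_derivative_slice(2)[OF smooth_on_differentiable[OF smooth_L], of x y] x y by (simp add: L_def)
  ultimately have "(\<lambda>h. frechet_derivative L (at (x, y)) (h, 0)) = ?r"
    using has_derivative_unique by blast
  then show ?thesis by (rule fun_cong)
qed

text \<open>Unless the norm at \<^term>\<open>x\<close> is Euclidean, the connection preserves both alpha and beta.\<close>

lemma connection_metrical:
  assumes nq: "\<not> quadratic_up_to \<phi> (len x)"
  shows "da x v = a c x ** C x v + transpose (C x v) ** a c x" "db x v = transpose (C x v) *v b c x"
proof -
  let ?A = "da x v - (a c x ** C x v + transpose (C x v) ** a c x)" and ?B = "db x v - transpose (C x v) *v b c x"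
  have at: "transpose (a c x) = a c x" by (rule a_sym[OF x])
  have dat: "transpose (da x v) = da x v"
  proof -
    have bl: "bounded_linear (transpose :: real^'n^'n \<Rightarrow> real^'n^'n)"
      by (simp add: linear_conv_bounded_linear[symmetric] linearI transpose_def vec_eq_iff)
    have "(a c has_derivative (\<lambda>h. transpose (da x h))) (at x)"
      by (rule has_derivative_transform_within_open[OF bounded_linear.has_derivative[OF bl a_derivative[OF x]] open_img x])
         (rule a_sym)
    then have "(\<lambda>h. transpose (da x h)) = da x" using has_derivative_unique a_derivative[OF x] by blast
    then show ?thesis by (rule fun_cong)
  qed
  have At: "transpose ?A = ?A"
  proof -
    have tp: "transpose (P + Q) = transpose P + transpose Q" "transpose (P - Q) = transpose P - transpose Q" for P Q :: "real^'n^'n"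
      by (simp_all add: vec_eq_iff transpose_def)
    show ?thesis by (simp add: tp dat at matrix_transpose_mul)
  qed
  have t1: "(transpose M *v u) \<bullet> z = u \<bullet> (M *v z)" for M :: "real^'n^'n" and u z
    by (simp only: transpose_matrix_vector dot_lmul_matrix)
  then have t2: "z \<bullet> (transpose M *v u) = u \<bullet> (M *v z)" for M :: "real^'n^'n" and u z
    by (simp only: inner_commute[of z "transpose M *v u"])
  note tinner = t1 t2
  have rel: "V.e (V.sl y) * (y \<bullet> (?A *v y)) + 2 * (V.al y * (\<phi> (V.sl y) * \<phi>1 (V.sl y))) * (?B \<bullet> y) = 0" if y: "y \<noteq> 0" for y
  proof -
    have 1: "y \<bullet> (?A *v y) = y \<bullet> (da x v *v y) - 2 * ((a c x *v y) \<bullet> (C x v *v y))"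
    proof -
      have "y \<bullet> ((a c x ** C x v) *v y) = (C x v *v y) \<bullet> (a c x *v y)"
        by (simp add: matrix_vector_mul_assoc[symmetric] a_swap[OF x, of y "C x v *v y"])
      moreover have "y \<bullet> ((transpose (C x v) ** a c x) *v y) = (a c x *v y) \<bullet> (C x v *v y)"
        by (simp only: matrix_vector_mul_assoc[symmetric] tinner)
      ultimately show ?thesis
        by (simp add: matrix_vector_mult_diff_rdistrib matrix_vector_mult_add_rdistrib inner_diff_right inner_add_right
            inner_commute[of "C x v *v y"])
    qed
    have 2: "?B \<bullet> y = db x v \<bullet> y - b c x \<bullet> (C x v *v y)" by (simp only: inner_diff_left tinner)
    have "frechet_derivative L (at (x, y)) (v, 0) = 2 * (V.grad y \<bullet> (C x v *v y))"
      unfolding horizontal_derivative_L[OF x y] L1_eq[OF y] by (simp add: inner_vec_def sum_distrib_left mult_ac)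
    then have "V.e (V.sl y) * (y \<bullet> (da x v *v y)) + 2 * (V.al y * (\<phi> (V.sl y) * \<phi>1 (V.sl y))) * (db x v \<bullet> y)
      = 2 * (V.e (V.sl y) * ((a c x *v y) \<bullet> (C x v *v y)) + V.al y * (\<phi> (V.sl y) * \<phi>1 (V.sl y)) * (b c x \<bullet> (C x v *v y)))"
      unfolding dL_x[OF y] V.grad_def by (simp add: inner_add_left)
    then show ?thesis unfolding 1 2 by (simp add: algebra_simps)
  qed
  show "da x v = a c x ** C x v + transpose (C x v) ** a c x" using V.invariance_rigid(1)[OF nq At rel] by simp
  show "db x v = transpose (C x v) *v b c x" using V.invariance_rigid(2)[OF nq At rel] by simp
qed

end

context alpha_beta_chart
begin

lemma alpha_beta_point_exists:
  assumes "x \<in> img_of c" "len x > 0"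
  obtains \<rho> where "alpha_beta_point F c \<Gamma> a b b0 \<phi> \<phi>1 \<phi>2 \<phi>3 x \<rho>"
proof -
  obtain \<rho> where "ereal (len x) < ereal \<rho>" "ereal \<rho> < b0"
    using ereal_dense2[OF length_less[OF assms(1)]] by blast
  then have "alpha_beta_point F c \<Gamma> a b b0 \<phi> \<phi>1 \<phi>2 \<phi>3 x \<rho>"
    by unfold_locales (use assms in auto)
  then show thesis by (rule that)
qed

lemma not_quadratic_len_pos: "x \<in> img_of c \<Longrightarrow> \<not> quadratic_up_to \<phi> (len x) \<Longrightarrow> len x > 0"
proof (rule ccontr)
  assume x: "x \<in> img_of c" "\<not> quadratic_up_to \<phi> (len x)" "\<not> len x > 0"
  then have "len x = 0" using len_nonneg by force
  then show False using x(2) by (auto simp: quadratic_up_to_def)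
qed

text \<open>A connection that preserves alpha and beta preserves the length of beta.\<close>

lemma len_locally_constant:
  assumes x: "x \<in> img_of c" and nq: "\<not> quadratic_up_to \<phi> (len x)"
  obtains d where "d > 0" "\<And>z. z \<in> ball x d \<Longrightarrow> z \<in> img_of c \<and> len z = len x"
proof -
  obtain \<rho> where "alpha_beta_point F c \<Gamma> a b b0 \<phi> \<phi>1 \<phi>2 \<phi>3 x \<rho>"
    using alpha_beta_point_exists[OF x not_quadratic_len_pos[OF x nq]] .
  then interpret P: alpha_beta_point F c \<Gamma> a b b0 \<phi> \<phi>1 \<phi>2 \<phi>3 x \<rho> .
  obtain r' where r': "r' < len x" "\<not> quadratic_up_to \<phi> r'" using P.V.not_quadratic_smaller[OF nq] .
  have "open (img_of c \<inter> len -` {r'<..})"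
    by (rule continuous_open_preimage[OF len_continuous_on open_img]) simp
  moreover have "x \<in> img_of c \<inter> len -` {r'<..}" using x r' by simp
  ultimately obtain d where d: "d > 0" "ball x d \<subseteq> img_of c \<inter> len -` {r'<..}" by (rule openE)
  have "b c z \<bullet> X z = b c x \<bullet> X x" if z: "z \<in> ball x d" for z
  proof (rule has_derivative_zero_unique[of "ball x d" "\<lambda>x. b c x \<bullet> X x"])
    fix y assume "y \<in> ball x d"
    then have y: "y \<in> img_of c" "r' < len y" using d by auto
    have nqy: "\<not> quadratic_up_to \<phi> (len y)" using r'(2) quadratic_up_to_mono y(2) less_imp_le by blast
    obtain \<rho> where "alpha_beta_point F c \<Gamma> a b b0 \<phi> \<phi>1 \<phi>2 \<phi>3 y \<rho>"
      using alpha_beta_point_exists[OF y(1) not_quadratic_len_pos[OF y(1) nqy]] .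
    then interpret Q: alpha_beta_point F c \<Gamma> a b b0 \<phi> \<phi>1 \<phi>2 \<phi>3 y \<rho> .
    have "2 * (db y h \<bullet> X y) - X y \<bullet> (da y h *v X y) = 0" for h
    proof -
      have 1: "db y h \<bullet> X y = b c y \<bullet> (C y h *v X y)"
        by (simp add: Q.connection_metrical(2)[OF nqy] transpose_matrix_vector dot_lmul_matrix)
      have 2: "X y \<bullet> ((a c y ** C y h) *v X y) = (C y h *v X y) \<bullet> b c y"
        by (simp add: matrix_vector_mul_assoc[symmetric] a_swap[OF y(1), of "X y" "C y h *v X y"] a_X[OF y(1)])
      have 3: "X y \<bullet> ((transpose (C y h) ** a c y) *v X y) = b c y \<bullet> (C y h *v X y)"
        by (simp add: matrix_vector_mul_assoc[symmetric] a_X[OF y(1)] transpose_matrix_vector inner_commute[of "X y"] dot_lmul_matrix)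
      show ?thesis
        unfolding Q.connection_metrical(1)[OF nqy] 1 matrix_vector_mult_add_rdistrib inner_add_right 2 3
        by (simp add: inner_commute)
    qed
    then have "((\<lambda>x. b c x \<bullet> X x) has_derivative (\<lambda>h. 0)) (at y)"
      using len_sq_derivative[OF y(1)] by simp
    then show "((\<lambda>x. b c x \<bullet> X x) has_derivative (\<lambda>h. 0)) (at y within ball x d)"
      by (rule has_derivative_at_withinI)
  qed (use d z in auto)
  then have "len z = len x" if "z \<in> ball x d" for z using that by (simp add: form_length_eq X_def)
  then show thesis using that d by blast
qed

end

subsection \<open>Vanishing S-curvature and Killing's equation at a point\<close>

context alpha_beta_point
begin

lemma inner_transpose: "z \<bullet> (transpose M *v u) = u \<bullet> (M *v z)" for M :: "real^'n^'n"
  by (simp only: transpose_matrix_vector inner_commute[of z] dot_lmul_matrix)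

lemma theta_inner:
  assumes y: "y \<noteq> 0"
  shows "theta x y \<bullet> z = (C x y *v z - C x z *v y) \<bullet> V.grad y"
proof -
  have m: "(C x y *v z - C x z *v y) $ m = (\<Sum>l\<in>UNIV. \<Sum>k\<in>UNIV. torsion x m k l * y $ k * z $ l)" for m
  proof -
    have "(C x y *v z) $ m = (\<Sum>l\<in>UNIV. \<Sum>k\<in>UNIV. \<Gamma> c x m k l * y $ k * z $ l)"
      by (simp add: connection_matrix_def matrix_vector_mult_def sum_distrib_right)
    moreover have "(C x z *v y) $ m = (\<Sum>k\<in>UNIV. \<Sum>l\<in>UNIV. \<Gamma> c x m l k * y $ k * z $ l)"
      by (simp add: connection_matrix_def matrix_vector_mult_def sum_distrib_left sum_distrib_right mult_ac)
    then have "(C x z *v y) $ m = (\<Sum>l\<in>UNIV. \<Sum>k\<in>UNIV. \<Gamma> c x m l k * y $ k * z $ l)"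
      using sum.swap[of "\<lambda>k l. \<Gamma> c x m l k * y $ k * z $ l" UNIV UNIV] by simp
    ultimately show ?thesis by (simp add: torsion_def left_diff_distrib sum_subtractf)
  qed
  have "theta x y \<bullet> z = (\<Sum>l\<in>UNIV. \<Sum>m\<in>UNIV. (\<Sum>k\<in>UNIV. torsion x m k l * y $ k * z $ l) * V.grad y $ m)"
    by (simp add: theta_def inner_vec_def L1_eq[OF y] sum_distrib_left sum_distrib_right mult_ac)
  also have "\<dots> = (\<Sum>m\<in>UNIV. \<Sum>l\<in>UNIV. (\<Sum>k\<in>UNIV. torsion x m k l * y $ k * z $ l) * V.grad y $ m)"
    by (rule sum.swap)
  also have "\<dots> = (C x y *v z - C x z *v y) \<bullet> V.grad y"
    by (simp add: inner_vec_def m[unfolded vector_minus_component] sum_distrib_right)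
  finally show ?thesis .
qed

text \<open>The torsion with one slot filled by the vector dual to beta, as an endomorphism and, with
  the index lowered, as a bilinear form. If the connection preserves alpha and beta, the
  symmetrization of this form is minus the Lie derivative of alpha along that vector.\<close>

definition K :: "real^'n \<Rightarrow> real^'n" where "K y = C x y *v X x - C x (X x) *v y"

definition P :: "real^'n^'n" where "P = transpose (matrix K) ** a c x"

lemma linear_K: "linear K"
  unfolding K_def
  by (rule linearI)
     (simp_all add: linear_add[OF linear_C] linear_scale[OF linear_C] matrix_vector_mult_add_rdistrib
        matrix_vector_right_distrib matrix_vector_mult_scaleR scaleR_matrix_vector_assoc[symmetric] scaleR_diff_right)

lemma P_inner: "y \<bullet> (P *v z) = K y \<bullet> (a c x *v z)"
  by (simp only: P_def matrix_vector_mul_assoc[symmetric] inner_transpose fun_cong[OF matrix_vector_mul(2)[OF linear_K]] inner_commute)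

lemma X_P: "X x \<bullet> (P *v z) = 0"
  by (simp add: P_inner K_def)

text \<open>The determinant is a function of \<open>\<beta> / \<alpha>\<close> alone, whose derivative is a multiple of \<open>w\<close>.\<close>

lemma S_curvature_zero_iff:
  assumes y: "y \<noteq> 0"
  shows "S_curvature F c x y = 0 \<longleftrightarrow>
    V.H1 (CARD('n) - 2) (V.sl y) = 0 \<or> V.w y \<bullet> deviation x y = 0"
proof -
  let ?m = "CARD('n) - 2" and ?X = "deviation x y"
  let ?d = "det (a c x) * (V.H1 ?m (V.sl y) * ((V.w y \<bullet> ?X) / V.al y))"
  have e: "V.e (V.sl z) \<noteq> 0" if "z \<noteq> 0" for z
    using V.e_pos[OF V.sl_le[OF that]] by simp
  have line: "((\<lambda>t. y + t *\<^sub>R ?X) has_derivative (\<lambda>h. h *\<^sub>R ?X)) (at 0)"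
    by (auto intro!: derivative_eq_intros)
  have "((\<lambda>z. V.H ?m (V.sl z)) has_derivative (\<lambda>h. V.H1 ?m (V.sl y) * ((V.w y \<bullet> h) / V.al y))) (at (y + 0 *\<^sub>R ?X))"
    using V.has_derivative_of_sl[OF y V.H_derivative[OF V.sl_less[OF y]]] by simp
  from has_derivative_mult_right[OF has_derivative_compose[OF line this], of "det (a c x)"]
  have "((\<lambda>t. det (a c x) * V.H ?m (V.sl (y + t *\<^sub>R ?X))) has_real_derivative ?d) (at 0)"
    unfolding has_field_derivative_def by (rule has_derivative_eq_rhs) (simp add: fun_eq_iff)
  moreover have "open {t. y + t *\<^sub>R ?X \<noteq> 0}" by (intro open_Collect_neq continuous_intros)
  ultimately have "((\<lambda>t. det (g x (y + t *\<^sub>R ?X))) has_real_derivative ?d) (at 0)"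
  proof (rule has_field_derivative_transform_within_open)
    show "det (a c x) * V.H ?m (V.sl (y + t *\<^sub>R ?X)) = det (g x (y + t *\<^sub>R ?X))"
      if "t \<in> {t. y + t *\<^sub>R ?X \<noteq> 0}" for t
      using that by (simp add: g_eq V.det_hess e)
  qed (use y in simp)
  from S_curvature_det[OF x y this] have "S_curvature F c x y = - ?d / (2 * det (g x y))" .
  moreover have "det (a c x) \<noteq> 0" using a_inv[OF x] by (simp add: invertible_det_nz)
  moreover have "det (g x y) \<noteq> 0" using g_invertible[OF x y] by (simp add: invertible_det_nz)
  ultimately show ?thesis using V.al_pos[OF y] by simp
qed

text \<open>Up to the factor \<open>N\<close>, the covector \<open>w\<close> corresponds under \<^term>\<open>g x y\<close> to the sum of the dual of beta
  and a multiple of \<^term>\<open>y\<close>; the latter pairs to zero with the torsion term.\<close>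

lemma w_deviation:
  assumes y: "y \<noteq> 0"
  shows "V.N (V.sl y) * (V.w y \<bullet> deviation x y) =
    V.e (V.sl y) * (y \<bullet> (P *v y)) + V.al y * (\<phi> (V.sl y) * \<phi>1 (V.sl y)) * (y \<bullet> (P *v X x))"
proof -
  have sym: "transpose (g x y) = g x y" by (simp add: vec_eq_iff transpose_def g_symmetric[OF x y])
  have gX: "g x y *v deviation x y = theta x y"
    by (simp add: deviation_def matrix_inv_mult_vec[OF g_invertible[OF x y]])
  have "V.N (V.sl y) * (V.w y \<bullet> deviation x y) = deviation x y \<bullet> (g x y *v V.dual y)"
    by (simp add: g_eq[OF y] V.hess_dual[OF y] inner_commute)
  also have "\<dots> = V.dual y \<bullet> theta x y" by (simp add: inner_matrix_symmetric[OF sym, of "deviation x y"] gX)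
  also have "\<dots> = theta x y \<bullet> X x"
    using theta_inner[OF y, of y] by (simp add: V.dual_def X_eq inner_diff_left inner_commute[of y] inner_commute[of "X x"])
  also have "\<dots> = K y \<bullet> V.grad y" unfolding theta_inner[OF y] K_def ..
  also have "\<dots> = V.e (V.sl y) * (y \<bullet> (P *v y)) + V.al y * (\<phi> (V.sl y) * \<phi>1 (V.sl y)) * (y \<bullet> (P *v X x))"
    by (simp add: V.grad_def inner_add_right P_inner a_X[OF x])
  finally show ?thesis .
qed

text \<open>The factor \<open>H1\<close> can vanish for many vectors, but not for all values of \<open>\<beta> / \<alpha>\<close> unless the norm is
  Euclidean; one suitable value where it does not is enough to recover the whole form.\<close>

lemma S_curvature_zero_at_iff:
  assumes nq: "\<not> quadratic_up_to \<phi> (len x)"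
  shows "(\<forall>y. y \<noteq> 0 \<longrightarrow> S_curvature F c x y = 0) \<longleftrightarrow> (\<forall>y. y \<bullet> (P *v y) = 0)"
proof
  assume P0: "\<forall>y. y \<bullet> (P *v y) = 0"
  have PX: "y \<bullet> (P *v X x) = 0" for y
  proof -
    have "(y + X x) \<bullet> (P *v (y + X x)) = 0" using P0 by blast
    then show ?thesis using P0 X_P by (simp add: matrix_vector_right_distrib inner_add_left inner_add_right)
  qed
  show "\<forall>y. y \<noteq> 0 \<longrightarrow> S_curvature F c x y = 0"
  proof (intro allI impI)
    fix y :: "real^'n" assume y: "y \<noteq> 0"
    have "V.w y \<bullet> deviation x y = 0"
    proof (cases "\<bar>V.sl y\<bar> < len x")
      case True
      then show ?thesis using w_deviation[OF y] P0 PX V.N_pos[OF True] by simp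
    next
      \<comment> \<open>here \<open>y\<close> is proportional to the dual vector, where \<open>w\<close> vanishes\<close>
      case False
      then have "\<bar>V.sl y\<bar> = len x" using V.sl_le[OF y] by simp
      then have "(V.sl y)\<^sup>2 = (len x)\<^sup>2" by (metis power2_abs)
      then have W: "V.W (V.sl y) = 0" by (simp add: V.W_def)
      let ?z = "X x - V.sl y *\<^sub>R (y /\<^sub>R V.al y)"
      have az: "a c x *v ?z = V.w y"
        by (simp add: matrix_vector_mult_diff_distrib matrix_vector_mult_scaleR a_X[OF x] V.w_def V.eta_def)
      have "?z \<bullet> (a c x *v ?z) = 0"
        unfolding az inner_commute[of ?z] using V.w_bs[of y] V.w_y[OF y] W by (simp add: inner_diff_right X_eq)
      then have "?z = 0" using a_pos[OF x, of ?z] by force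
      then have "V.w y = 0" using az by simp
      then show ?thesis by simp
    qed
    then show "S_curvature F c x y = 0" by (simp add: S_curvature_zero_iff[OF y])
  qed
next
  assume S: "\<forall>y. y \<noteq> 0 \<longrightarrow> S_curvature F c x y = 0"
  obtain s where s: "\<bar>s\<bar> < len x" "V.H1 (CARD('n) - 2) s \<noteq> 0" "V.E s \<noteq> 0"
    using V.not_quadratic_witness[OF nq] by blast
  have e: "V.e s \<noteq> 0" using V.e_pos[of s] s(1) by simp
  show "\<forall>y. y \<bullet> (P *v y) = 0"
  proof
    fix y
    show "y \<bullet> (P *v y) = 0"
    proof (rule V.bilinear_rigid[OF s(1) e s(3)])
      show "V.bs \<bullet> (P *v z) = 0" for z by (simp add: X_eq X_P)
      show "V.e s * (z \<bullet> (P *v z)) + V.al z * (\<phi> s * \<phi>1 s) * (z \<bullet> (P *v V.bs)) = 0" if z: "z \<noteq> 0" "V.sl z = s" for z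
      proof -
        have "V.w z \<bullet> deviation x z = 0" using S z S_curvature_zero_iff[OF z(1)] s(2) by simp
        then show ?thesis using w_deviation[OF z(1)] z(2) by (simp add: X_eq)
      qed
    qed
  qed
qed

lemma partial_a: "partial i (\<lambda>x. a c x $ j $ l) x = da x (axis i 1) $ j $ l"
  by (rule partial_eq[OF bounded_linear.has_derivative[OF bounded_linear_entry a_derivative[OF x]]])

lemma partial_b: "partial j (\<lambda>x. b c x $ i) x = db x (axis j 1) $ i"
  by (rule partial_eq[OF bounded_linear.has_derivative[OF bounded_linear_vec_nth b_derivative[OF x]]])

text \<open>In the Christoffel symbols contracted with beta, the inverse of the metric cancels against the
  one in the dual vector.\<close>

lemma cov_deriv_form_eq:
  "cov_deriv_form a b c x i j = db x (axis j 1) \<bullet> axis i 1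
    - 1/2 * (axis j 1 \<bullet> (da x (axis i 1) *v X x) + axis i 1 \<bullet> (da x (axis j 1) *v X x) - axis i 1 \<bullet> (da x (X x) *v axis j 1))"
proof -
  define D where "D = (\<chi> l. da x (axis i 1) $ j $ l + da x (axis j 1) $ i $ l - da x (axis l 1) $ i $ j)"
  have chr: "christoffel a c x k i j = 1/2 * (matrix_inv (a c x) *v D) $ k" for k
    by (simp add: christoffel_def partial_a D_def matrix_vector_mult_def)
  have "(\<Sum>k\<in>UNIV. christoffel a c x k i j * b c x $ k) = 1/2 * ((matrix_inv (a c x) *v D) \<bullet> (a c x *v X x))"
    unfolding chr a_X[OF x] by (simp add: inner_vec_def sum_divide_distrib)
  also have "(matrix_inv (a c x) *v D) \<bullet> (a c x *v X x) = X x \<bullet> D"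
    unfolding a_swap[OF x, of "matrix_inv (a c x) *v D"] matrix_inv_mult_vec(1)[OF a_inv[OF x]] ..
  also have "X x \<bullet> D = axis j 1 \<bullet> (da x (axis i 1) *v X x) + axis i 1 \<bullet> (da x (axis j 1) *v X x) - axis i 1 \<bullet> (da x (X x) *v axis j 1)"
  proof -
    have "da x (X x) = (\<Sum>l\<in>UNIV. X x $ l *\<^sub>R da x (axis l 1))"
    proof -
      have "linear (da x)" using a_derivative[OF x] has_derivative_bounded_linear bounded_linear.linear by blast
      then have "da x (\<Sum>l\<in>UNIV. X x $ l *\<^sub>R axis l 1) = (\<Sum>l\<in>UNIV. X x $ l *\<^sub>R da x (axis l 1))"
        by (simp add: linear_sum linear_scale)
      then show ?thesis using basis_expansion[of "X x"] by (simp add: scalar_mult_eq_scaleR)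
    qed
    then have "axis i 1 \<bullet> (da x (X x) *v axis j 1) = (\<Sum>l\<in>UNIV. X x $ l * da x (axis l 1) $ i $ j)"
      by (simp add: inner_axis' matrix_vector_mul_component inner_axis)
    moreover have "axis j 1 \<bullet> (da x (axis i 1) *v X x) = (\<Sum>l\<in>UNIV. X x $ l * da x (axis i 1) $ j $ l)" for i j
      by (simp add: inner_axis' matrix_vector_mult_def mult.commute)
    ultimately show ?thesis
      by (simp add: D_def inner_vec_def[of "X x"] distrib_left right_diff_distrib sum.distrib sum_subtractf)
  qed
  finally show ?thesis by (simp add: cov_deriv_form_def partial_b inner_axis)
qed

lemma cov_deriv_form_symmetrized:
  assumes nq: "\<not> quadratic_up_to \<phi> (len x)"
  shows "cov_deriv_form a b c x i j + cov_deriv_form a b c x j i = - (P $ i $ j + P $ j $ i)"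
proof -
  let ?u = "axis i 1 :: real^'n" and ?v = "axis j 1 :: real^'n" and ?X = "X x"
  have db': "db x p \<bullet> q = b c x \<bullet> (C x p *v q)" for p q
    unfolding connection_metrical(2)[OF nq] by (simp only: transpose_matrix_vector dot_lmul_matrix)
  have da': "p \<bullet> (da x h *v q) = (C x h *v q) \<bullet> (a c x *v p) + (C x h *v p) \<bullet> (a c x *v q)" for p q h
    by (simp add: connection_metrical(1)[OF nq] matrix_vector_mult_add_rdistrib inner_add_right
        matrix_vector_mul_assoc[symmetric] inner_transpose a_swap[OF x, of p "C x h *v q"] inner_commute[of "a c x *v q"]
        del: transpose_matrix_vector)
  have Pij: "P $ i $ j = K (axis i 1) \<bullet> (a c x *v axis j 1)" for i j
    using P_inner[of "axis i 1" "axis j 1"] by (simp add: inner_axis' matrix_vector_mul_component inner_axis)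
  show ?thesis
    unfolding cov_deriv_form_eq db' da' Pij K_def a_X[OF x]
    by (simp add: inner_diff_left inner_commute[of "b c x"]) (simp add: field_simps)
qed

lemma killing_at_iff:
  assumes nq: "\<not> quadratic_up_to \<phi> (len x)"
  shows "(\<forall>i j. 1/2 * (cov_deriv_form a b c x i j + cov_deriv_form a b c x j i) = 0) \<longleftrightarrow> (\<forall>y. y \<bullet> (P *v y) = 0)"
proof
  assume "\<forall>i j. 1/2 * (cov_deriv_form a b c x i j + cov_deriv_form a b c x j i) = 0"
  then have "P $ i $ j + P $ j $ i = 0" for i j
    unfolding cov_deriv_form_symmetrized[OF nq] by (metis mult_eq_0_iff neg_equal_0_iff_equal divide_eq_0_iff zero_neq_numeral zero_neq_one)
  then have "transpose P = - P" by (simp add: vec_eq_iff transpose_def eq_neg_iff_add_eq_0)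
  then have "y \<bullet> (P *v y) = y \<bullet> ((- P) *v y)" for y using inner_transpose[of y P y] by simp
  moreover have "(- P) *v y = - (P *v y)" for y by (simp add: vec_eq_iff matrix_vector_mult_def sum_negf)
  ultimately show "\<forall>y. y \<bullet> (P *v y) = 0" by simp
next
  assume P0: "\<forall>y. y \<bullet> (P *v y) = 0"
  have "P $ i $ j + P $ j $ i = 0" for i j
  proof -
    have ij: "axis i 1 \<bullet> (P *v axis j 1) = P $ i $ j" for i j by (simp add: inner_axis' matrix_vector_mul_component inner_axis)
    have "(axis i 1 + axis j 1) \<bullet> (P *v (axis i 1 + axis j 1)) = 0" using P0 by blast
    then show ?thesis using P0[rule_format, of "axis i 1"] P0[rule_format, of "axis j 1"]
      by (simp add: matrix_vector_right_distrib inner_add_left inner_add_right ij)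
  qed
  then show "\<forall>i j. 1/2 * (cov_deriv_form a b c x i j + cov_deriv_form a b c x j i) = 0"
    by (simp add: cov_deriv_form_symmetrized[OF nq])
qed

end

section \<open>From charts to the manifold\<close>

lemma smooth_on_has_real_derivative:
  fixes f :: "real \<Rightarrow> real"
  assumes "smooth_on S f" "s \<in> S"
  shows "(f has_real_derivative frechet_derivative f (at s) 1) (at s)"
proof -
  have d: "(f has_derivative frechet_derivative f (at s)) (at s)" by (rule smooth_on_has_derivative[OF assms])
  have "frechet_derivative f (at s) h = frechet_derivative f (at s) 1 * h" for h
    using linear_simps(5)[OF has_derivative_bounded_linear[OF d], of h 1] by (simp add: mult.commute)
  then have "frechet_derivative f (at s) = (*) (frechet_derivative f (at s) 1)" by (rule ext)
  then show ?thesis using d by (simp only: has_field_derivative_def)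
qed

lemma flow_invariant_finsler_chart:
  assumes M: "smooth_manifold M A" and \<Gamma>: "covariant_derivative A \<Gamma>"
    and F: "parallel_translations_preserve M A \<Gamma> F" "finsler_metric A F" and c: "c \<in> A"
  shows "flow_invariant_finsler F c \<Gamma>"
proof
  show "open (img_of c)" by (rule chart_open_img[OF M c])
  show "continuous_on (img_of c) (\<lambda>x. \<Gamma> c x k i j)" for k i j
    using \<Gamma> c by (intro smooth_on_continuous_on) (simp add: covariant_derivative_def)
  show "\<exists>e \<Phi>. e > 0 \<and> \<Phi> 0 = mat 1 \<and>
      (\<forall>k j. ((\<lambda>t. \<Phi> t $ k $ j) has_real_derivative - (connection_matrix \<Gamma> c x v $ k $ j)) (at 0)) \<and>
      (\<forall>t y. t \<in> {-e<..<e} \<longrightarrow> F c (x + t *\<^sub>R v) (\<Phi> t *v y) = F c x y)" if x: "x \<in> img_of c" for x v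
    by (rule parallel_flow[OF M \<Gamma> F(1) c x, of v]) blast
qed (use F(2) c in \<open>auto simp: finsler_metric_def\<close>)

lemma alpha_beta_chart_chart:
  assumes ab: "alpha_beta_metric A a b b0 \<phi> F" and fl: "flow_invariant_finsler F c \<Gamma>" and c: "c \<in> A"
    and dim: "CARD('n::finite) \<ge> 2"
  shows "alpha_beta_chart F (c :: ('m, 'n) chart) \<Gamma> a b b0 \<phi> (\<lambda>s. frechet_derivative \<phi> (at s) 1)
    (\<lambda>s. frechet_derivative (\<lambda>s. frechet_derivative \<phi> (at s) 1) (at s) 1)
    (\<lambda>s. frechet_derivative (\<lambda>s. frechet_derivative (\<lambda>s. frechet_derivative \<phi> (at s) 1) (at s) 1) (at s) 1)"
proof -
  interpret flow_invariant_finsler F c \<Gamma> by (rule fl)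
  let ?S = "{s. ereal \<bar>s\<bar> < b0}"
  have s0: "smooth_on ?S \<phi>" using ab by (simp add: alpha_beta_metric_def)
  note s1 = smooth_on_frechet_derivative[OF s0, of 1]
  note s2 = smooth_on_frechet_derivative[OF s1, of 1]
  note s3 = smooth_on_frechet_derivative[OF s2, of 1]
  show ?thesis
  proof unfold_locales
    fix s assume "ereal \<bar>s\<bar> < b0"
    then have s: "s \<in> ?S" by simp
    show "(\<phi> has_real_derivative frechet_derivative \<phi> (at s) 1) (at s)"
      by (rule smooth_on_has_real_derivative[OF s0 s])
    show "((\<lambda>s. frechet_derivative \<phi> (at s) 1) has_real_derivative
        frechet_derivative (\<lambda>s. frechet_derivative \<phi> (at s) 1) (at s) 1) (at s)"
      by (rule smooth_on_has_real_derivative[OF s1 s])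
    show "((\<lambda>s. frechet_derivative (\<lambda>s. frechet_derivative \<phi> (at s) 1) (at s) 1) has_real_derivative
        frechet_derivative (\<lambda>s. frechet_derivative (\<lambda>s. frechet_derivative \<phi> (at s) 1) (at s) 1) (at s) 1) (at s)"
      by (rule smooth_on_has_real_derivative[OF s2 s])
    show "isCont (\<lambda>s. frechet_derivative (\<lambda>s. frechet_derivative (\<lambda>s. frechet_derivative \<phi> (at s) 1) (at s) 1) (at s) 1) s"
      by (rule DERIV_isCont[OF smooth_on_has_real_derivative[OF s3 s]])
  qed (use ab c dim in \<open>auto simp: alpha_beta_metric_def riemannian_metric_def one_form_def\<close>)
qed

lemma form_length_chart_independent:
  assumes M: "smooth_manifold M A" and a: "riemannian_metric A a" and b: "one_form A b"
    and c: "c \<in> A" "c' \<in> A" and p: "p \<in> dom_of c" "p \<in> dom_of c'"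
  shows "form_length a b c (map_of_chart c p) = form_length a b c' (map_of_chart c' p)"
proof -
  let ?x = "map_of_chart c p" and ?x' = "map_of_chart c' p"
  let ?J = "dtransition c c' ?x"
  have ov: "?x \<in> overlap c c'" using p by (auto simp: overlap_def)
  have img: "?x \<in> img_of c" "?x' \<in> img_of c'" using p by (auto simp: img_of_def)
  have T: "transition c c' ?x = ?x'" by (rule transition_map[OF M c(1) p(1)])
  have a': "y \<bullet> (a c ?x *v z) = ?J y \<bullet> (a c' ?x' *v ?J z)" for y z
    using a c ov T unfolding riemannian_metric_def by metis
  have b': "b c ?x \<bullet> y = b c' ?x' \<bullet> ?J y" for y
    using b c ov T unfolding one_form_def by metis
  have pos: "y \<bullet> (a c1 x1 *v y) > 0" if "c1 \<in> A" "x1 \<in> img_of c1" "y \<noteq> 0" for c1 x1 y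
    using a that unfolding riemannian_metric_def by blast
  have inv: "invertible (a c ?x)" "invertible (a c' ?x')"
    by (rule positive_definite_invertible; use pos c img in blast)+
  define X where "X = matrix_inv (a c ?x) *v b c ?x"
  have aX: "a c ?x *v X = b c ?x" by (simp add: X_def matrix_inv_mult_vec[OF inv(1)])
  have "(a c' ?x' *v ?J X) \<bullet> u = b c' ?x' \<bullet> u" for u
  proof -
    define y where "y = dtransition c' c ?x' u"
    have u: "u = ?J y" unfolding y_def using dtransition_inverse[OF M c p] by simp
    have "(a c' ?x' *v ?J X) \<bullet> u = y \<bullet> (a c ?x *v X)" unfolding u a' by (rule inner_commute)
    also have "\<dots> = b c' ?x' \<bullet> u" unfolding aX u b'[symmetric] by (rule inner_commute)
    finally show ?thesis .
  qed
  then have "a c' ?x' *v ?J X = b c' ?x'" by (metis inner_commute vector_eq_rdot)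
  then have X': "matrix_inv (a c' ?x') *v b c' ?x' = ?J X" by (metis matrix_inv_mult_vec(2)[OF inv(2)])
  show ?thesis unfolding form_length_eq X' X_def[symmetric] b' ..
qed

text \<open>Wherever beta has the same length as at the given point, the norm is not Euclidean either, so
  the length is locally constant. The points with this length thus form an open set, and a closed
  one by continuity.\<close>

lemma form_length_constant:
  assumes M: "smooth_manifold M A" and a: "riemannian_metric A a" and b: "one_form A b"
    and chart: "\<And>c. c \<in> A \<Longrightarrow> alpha_beta_chart F c \<Gamma> a b b0 \<phi> \<phi>1 \<phi>2 \<phi>3"
    and c0: "c0 \<in> A" "x0 \<in> img_of c0" and nq: "\<not> quadratic_up_to \<phi> (form_length a b c0 x0)"
    and c: "c \<in> A" and x: "x \<in> img_of c"
  shows "form_length a b c x = form_length a b c0 x0"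
proof -
  let ?l = "form_length a b c0 x0"
  define S where "S = {p. \<exists>c\<in>A. p \<in> dom_of c \<and> form_length a b c (map_of_chart c p) = ?l}"
  have S_iff: "p \<in> S \<longleftrightarrow> form_length a b c (map_of_chart c p) = ?l" if "c \<in> A" "p \<in> dom_of c" for c p
  proof
    assume "p \<in> S"
    then obtain c' where c': "c' \<in> A" "p \<in> dom_of c'" "form_length a b c' (map_of_chart c' p) = ?l" by (auto simp: S_def)
    show "form_length a b c (map_of_chart c p) = ?l"
      using form_length_chart_independent[OF M a b that(1) c'(1) that(2) c'(2)] c'(3) by simp
  next
    assume "form_length a b c (map_of_chart c p) = ?l"
    then show "p \<in> S" unfolding S_def using that by blast
  qed
  have top: "topspace M = (\<Union>c\<in>A. dom_of c)" using M by (simp add: smooth_manifold_def)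
  have "openin M S"
  proof (subst openin_subopen, intro ballI)
    fix p assume "p \<in> S"
    then obtain c where c: "c \<in> A" "p \<in> dom_of c" "form_length a b c (map_of_chart c p) = ?l" by (auto simp: S_def)
    interpret alpha_beta_chart F c \<Gamma> a b b0 \<phi> \<phi>1 \<phi>2 \<phi>3 by (rule chart[OF c(1)])
    have img: "map_of_chart c p \<in> img_of c" using c by (auto simp: img_of_def)
    have "\<not> quadratic_up_to \<phi> (form_length a b c (map_of_chart c p))" using nq c(3) by simp
    then obtain d where d: "d > 0" "\<And>z. z \<in> ball (map_of_chart c p) d \<Longrightarrow>
        z \<in> img_of c \<and> form_length a b c z = form_length a b c (map_of_chart c p)"
      using len_locally_constant[OF img] by blast
    let ?U = "{q \<in> dom_of c. map_of_chart c q \<in> ball (map_of_chart c p) d}"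
    have "openin M ?U" by (rule open_vimage_chart[OF M c(1) open_ball])
    moreover have "p \<in> ?U" using c d(1) by simp
    moreover have "?U \<subseteq> S" using d(2) c(3) S_iff[OF c(1)] by auto
    ultimately show "\<exists>T. openin M T \<and> p \<in> T \<and> T \<subseteq> S" by blast
  qed
  moreover have "openin M (topspace M - S)"
  proof (subst openin_subopen, intro ballI)
    fix p assume p: "p \<in> topspace M - S"
    then obtain c where c: "c \<in> A" "p \<in> dom_of c" using top by auto
    interpret alpha_beta_chart F c \<Gamma> a b b0 \<phi> \<phi>1 \<phi>2 \<phi>3 by (rule chart[OF c(1)])
    let ?V = "img_of c \<inter> form_length a b c -` (- {?l})"
    have "open ?V" by (rule continuous_open_preimage[OF len_continuous_on open_img]) auto
    then have "openin M {q \<in> dom_of c. map_of_chart c q \<in> ?V}" by (rule open_vimage_chart[OF M c(1)])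
    moreover have "p \<in> {q \<in> dom_of c. map_of_chart c q \<in> ?V}" using p c S_iff[OF c] by (auto simp: img_of_def)
    moreover have "{q \<in> dom_of c. map_of_chart c q \<in> ?V} \<subseteq> topspace M - S" using S_iff[OF c(1)] top c(1) by auto
    ultimately show "\<exists>T. openin M T \<and> p \<in> T \<and> T \<subseteq> topspace M - S" by blast
  qed
  moreover have "S \<subseteq> topspace M" using top by (auto simp: S_def)
  ultimately have "S = {} \<or> S = topspace M"
    using M unfolding smooth_manifold_def connected_space_clopen_in closedin_def by blast
  moreover have "inv_chart c0 x0 \<in> S"
    using S_iff[OF c0(1) inv_chart_dom[OF c0(2)]] map_inv_chart[OF c0(2)] by simp
  ultimately have "inv_chart c x \<in> S" using top c inv_chart_dom[OF x] by blast
  then show ?thesis using S_iff[OF c inv_chart_dom[OF x]] map_inv_chart[OF x] by simp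
qed

text \<open>If all norms are Euclidean, a single coefficient serves all points, since the profile
  function determines it.\<close>

lemma riemannian_if_quadratic:
  assumes M: "smooth_manifold M A" and ab: "alpha_beta_metric A a b b0 \<phi> F"
    and chart: "\<And>c. c \<in> A \<Longrightarrow> alpha_beta_chart F c \<Gamma> a b b0 \<phi> \<phi>1 \<phi>2 \<phi>3"
    and q: "\<And>c x. c \<in> A \<Longrightarrow> x \<in> img_of c \<Longrightarrow> quadratic_up_to \<phi> (form_length a b c x)"
  shows "riemannian A F"
proof -
  have a: "riemannian_metric A a" and b: "one_form A b" and fm: "finsler_metric A F"
    using ab by (simp_all add: alpha_beta_metric_def)
  have nonneg: "form_length a b c x \<ge> 0" if "c \<in> A" "x \<in> img_of c" for c x
    using alpha_beta_chart.len_nonneg[OF chart[OF that(1)] that(2)] .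
  have "\<exists>\<kappa>. \<forall>c\<in>A. \<forall>x\<in>img_of c. \<forall>s. \<bar>s\<bar> \<le> form_length a b c x \<longrightarrow> (\<phi> s)\<^sup>2 = (\<phi> 0)\<^sup>2 + \<kappa> * s\<^sup>2"
  proof (cases "\<exists>c\<in>A. \<exists>x\<in>img_of c. form_length a b c x > 0")
    case True
    then obtain c1 x1 where 1: "c1 \<in> A" "x1 \<in> img_of c1" "form_length a b c1 x1 > 0" by blast
    obtain \<kappa> where \<kappa>: "\<And>s. \<bar>s\<bar> \<le> form_length a b c1 x1 \<Longrightarrow> (\<phi> s)\<^sup>2 = (\<phi> 0)\<^sup>2 + \<kappa> * s\<^sup>2"
      using q[OF 1(1,2)] unfolding quadratic_up_to_def by blast
    have "(\<phi> s)\<^sup>2 = (\<phi> 0)\<^sup>2 + \<kappa> * s\<^sup>2" if cx: "c \<in> A" "x \<in> img_of c" and s: "\<bar>s\<bar> \<le> form_length a b c x" for c x s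
    proof (cases "form_length a b c x > 0")
      case pos: True
      obtain \<kappa>' where \<kappa>': "\<And>s. \<bar>s\<bar> \<le> form_length a b c x \<Longrightarrow> (\<phi> s)\<^sup>2 = (\<phi> 0)\<^sup>2 + \<kappa>' * s\<^sup>2"
        using q[OF cx] unfolding quadratic_up_to_def by blast
      have "\<kappa> = \<kappa>'"
        by (rule quadratic_coefficient_unique[of "form_length a b c1 x1" \<phi> \<kappa> "form_length a b c x" \<kappa>', OF \<kappa> \<kappa>' 1(3) pos])
      then show ?thesis using \<kappa>'[OF s] by simp
    next
      case False
      then have "s = 0" using s by linarith
      then show ?thesis by simp
    qed
    then show ?thesis by blast
  next
    case False
    then have "(\<phi> s)\<^sup>2 = (\<phi> 0)\<^sup>2 + 0 * s\<^sup>2" if "c \<in> A" "x \<in> img_of c" "\<bar>s\<bar> \<le> form_length a b c x" for c x s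
    proof -
      have "form_length a b c x \<le> 0" using False that by force
      then have "s = 0" using that(3) by linarith
      then show ?thesis by simp
    qed
    then show ?thesis by blast
  qed
  then obtain \<kappa> where \<kappa>: "\<And>c x s. c \<in> A \<Longrightarrow> x \<in> img_of c \<Longrightarrow> \<bar>s\<bar> \<le> form_length a b c x \<Longrightarrow> (\<phi> s)\<^sup>2 = (\<phi> 0)\<^sup>2 + \<kappa> * s\<^sup>2"
    by blast
  define h where "h = (\<lambda>c x. (\<phi> 0)\<^sup>2 *\<^sub>R a c x + \<kappa> *\<^sub>R outer (b c x) (b c x))"
  have h: "y \<bullet> (h c x *v z) = (\<phi> 0)\<^sup>2 * (y \<bullet> (a c x *v z)) + \<kappa> * (b c x \<bullet> y) * (b c x \<bullet> z)" for c x y z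
    by (simp add: h_def matrix_vector_mult_add_rdistrib scaleR_matrix_vector_assoc[symmetric] outer_mult_vec
        inner_add_right inner_commute[of y "b c x"])
  have F: "F c x y = riem_norm h c x y \<and> (y \<noteq> 0 \<longrightarrow> y \<bullet> (h c x *v y) > 0)" if cx: "c \<in> A" "x \<in> img_of c" for c x y
  proof (cases "y = 0")
    case True
    then show ?thesis using fm cx by (simp add: finsler_metric_def riem_norm_def)
  next
    case False
    interpret alpha_beta_chart F c \<Gamma> a b b0 \<phi> \<phi>1 \<phi>2 \<phi>3 by (rule chart[OF cx(1)])
    let ?al = "riem_norm a c x y"
    have al: "?al\<^sup>2 = y \<bullet> (a c x *v y)" "?al > 0" using a_pos[OF cx(2) False] by (simp_all add: riem_norm_def)
    have "(F c x y)\<^sup>2 = ?al\<^sup>2 * ((\<phi> 0)\<^sup>2 + \<kappa> * ((b c x \<bullet> y) / ?al)\<^sup>2)"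
      unfolding F_eq[OF cx(2)] power_mult_distrib \<kappa>[OF cx abs_form_le[OF cx(2) False]] ..
    also have "\<dots> = y \<bullet> (h c x *v y)"
      unfolding h al(1)[symmetric] using al(2) by (simp add: field_simps power2_eq_square)
    finally have sq: "(F c x y)\<^sup>2 = y \<bullet> (h c x *v y)" .
    have "F c x y > 0" using F_nonneg[OF cx(2), of y] F_eq_0[OF cx(2), of y] False by linarith
    then have "F c x y = sqrt (y \<bullet> (h c x *v y))" "y \<bullet> (h c x *v y) > 0"
      unfolding sq[symmetric] by simp_all
    then show ?thesis by (simp add: riem_norm_def)
  qed
  have "riemannian_metric A h"
    unfolding riemannian_metric_def
  proof (intro conjI ballI allI impI)
    fix c assume c: "c \<in> A"
    have op: "open (img_of c)" by (rule chart_open_img[OF M c])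
    have sa: "smooth_on (img_of c) (a c)" and sb: "smooth_on (img_of c) (b c)"
      using a b c by (simp_all add: riemannian_metric_def one_form_def)
    show "smooth_on (img_of c) (h c)"
      unfolding h_def
      by (intro smooth_on_add[OF op] smooth_on_bounded_linear[OF bounded_linear_scaleR_right op] sa
          smooth_on_bounded_bilinear[OF bounded_bilinear_outer op] sb)
    fix x assume x: "x \<in> img_of c"
    have "transpose (a c x) = a c x" using a c x by (simp add: riemannian_metric_def)
    then have "a c x $ i $ j = a c x $ j $ i" for i j by (metis transpose_def vec_lambda_beta)
    then show "transpose (h c x) = h c x" by (simp add: h_def vec_eq_iff transpose_def mult.commute)
    show "0 < y \<bullet> (h c x *v y)" if "y \<noteq> 0" for y using F[OF c x] that by blast
  next
    fix c c' x y z assume c: "c \<in> A" "c' \<in> A" and x: "x \<in> overlap c c'"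
    have 1: "y \<bullet> (a c x *v z) = dtransition c c' x y \<bullet> (a c' (transition c c' x) *v dtransition c c' x z)"
      using a c x unfolding riemannian_metric_def by blast
    have 2: "b c x \<bullet> y = b c' (transition c c' x) \<bullet> dtransition c c' x y" for y
      using b c x unfolding one_form_def by blast
    show "y \<bullet> (h c x *v z) = dtransition c c' x y \<bullet> (h c' (transition c c' x) *v dtransition c c' x z)"
      unfolding h 1 2[of y] 2[of z] ..
  qed
  then show ?thesis unfolding riemannian_def using F by blast
qed

theorem lemma3p2:
  fixes M :: "'m topology"
    and A :: "('m, 'n::finite) chart set"
    and a :: "('m, 'n) chart \<Rightarrow> real^'n \<Rightarrow> real^'n^'n"
    and b :: "('m, 'n) chart \<Rightarrow> real^'n \<Rightarrow> real^'n"
    and b\<^sub>0 :: ereal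
    and \<phi> :: "real \<Rightarrow> real"
    and F :: "('m, 'n) chart \<Rightarrow> real^'n \<Rightarrow> real^'n \<Rightarrow> real"
  assumes "CARD('n) \<ge> 2"
    and "smooth_manifold M A"
    and "alpha_beta_metric A a b b\<^sub>0 \<phi> F"
    and "generalized_berwald M A F"
  shows "S_curvature_vanishes A F \<longleftrightarrow>
           riemannian A F \<or> (killing_form A a b \<and> constant_length A a b)"
proof -
  have a: "riemannian_metric A a" and b: "one_form A b"
    using assms(3) by (simp_all add: alpha_beta_metric_def)
  obtain \<Gamma> where \<Gamma>: "covariant_derivative A \<Gamma>" "parallel_translations_preserve M A \<Gamma> F" and fm: "finsler_metric A F"
    using assms(4) by (auto simp: generalized_berwald_def)
  have flow: "flow_invariant_finsler F c \<Gamma>" if "c \<in> A" for c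
    by (rule flow_invariant_finsler_chart[OF assms(2) \<Gamma> fm that])
  obtain \<phi>1 \<phi>2 \<phi>3 where chart: "\<And>c. c \<in> A \<Longrightarrow> alpha_beta_chart F c \<Gamma> a b b\<^sub>0 \<phi> \<phi>1 \<phi>2 \<phi>3"
    using alpha_beta_chart_chart[OF assms(3) flow _ assms(1)] by blast
  have riem: "S_curvature_vanishes A F" if R: "riemannian A F"
    unfolding S_curvature_vanishes_def
  proof (intro ballI allI impI)
    fix c x y assume c: "c \<in> A" and x: "x \<in> img_of c" and y: "y \<noteq> (0 :: real^'n)"
    obtain h where h: "riemannian_metric A h" and F: "\<And>x y. x \<in> img_of c \<Longrightarrow> F c x y = riem_norm h c x y"
      using R c unfolding riemannian_def by blast
    have h': "transpose (h c x) = h c x \<and> (y \<noteq> 0 \<longrightarrow> y \<bullet> (h c x *v y) > 0)" if "x \<in> img_of c" for x y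
      using h c that by (simp add: riemannian_metric_def)
    show "S_curvature F c x y = 0"
    proof (rule flow_invariant_finsler.S_curvature_quadratic[OF flow[OF c] _ _ x y])
      show "(F c x y)\<^sup>2 = y \<bullet> (h c x *v y)" if "x \<in> img_of c" for x y
        using h'[OF that, of y] by (cases "y = 0") (simp_all add: F[OF that] riem_norm_def)
    qed (use h' in blast)
  qed
  show ?thesis
  proof (cases "\<forall>c\<in>A. \<forall>x\<in>img_of c. quadratic_up_to \<phi> (form_length a b c x)")
    case True
    then have "riemannian A F" by (intro riemannian_if_quadratic[OF assms(2,3) chart]) blast+
    then show ?thesis using riem by blast
  next
    case False
    then obtain c0 x0 where 0: "c0 \<in> A" "x0 \<in> img_of c0" "\<not> quadratic_up_to \<phi> (form_length a b c0 x0)" by blast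
    have len: "form_length a b c x = form_length a b c0 x0" if "c \<in> A" "x \<in> img_of c" for c x
      by (rule form_length_constant[OF assms(2) a b chart 0 that])
    then have const: "constant_length A a b" unfolding constant_length_def by blast
    have "(\<forall>y. y \<noteq> 0 \<longrightarrow> S_curvature F c x y = 0) \<longleftrightarrow>
        (\<forall>i j. 1/2 * (cov_deriv_form a b c x i j + cov_deriv_form a b c x j i) = 0)"
      if c: "c \<in> A" and x: "x \<in> img_of c" for c x
    proof -
      have nq: "\<not> quadratic_up_to \<phi> (form_length a b c x)" using 0(3) len[OF c x] by simp
      interpret alpha_beta_chart F c \<Gamma> a b b\<^sub>0 \<phi> \<phi>1 \<phi>2 \<phi>3 by (rule chart[OF c])
      obtain \<rho> where "alpha_beta_point F c \<Gamma> a b b\<^sub>0 \<phi> \<phi>1 \<phi>2 \<phi>3 x \<rho>"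
        using alpha_beta_point_exists[OF x not_quadratic_len_pos[OF x nq]] .
      then interpret P: alpha_beta_point F c \<Gamma> a b b\<^sub>0 \<phi> \<phi>1 \<phi>2 \<phi>3 x \<rho> .
      show ?thesis using P.S_curvature_zero_at_iff[OF nq] P.killing_at_iff[OF nq] by blast
    qed
    then have "S_curvature_vanishes A F \<longleftrightarrow> killing_form A a b"
      unfolding S_curvature_vanishes_def killing_form_def by blast
    then show ?thesis using const riem by blast
  qed
qed

end
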